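(* Let $n$ be a non-negative integer, let $p,q\in\mathbb{C}$ with $q\notin\{-1,-2,-3,\dots\}$, and let $\delta,\delta',\mu,\mu',\epsilon,\tau\in\mathbb{C}$ be such that $\Re(\epsilon)>0$ and $$\Re(\tau)>\max\{0,\ \Re(-\mu'),\ \Re(\delta'+\mu-\epsilon),\ \Re(\delta+\delta'-\epsilon)+[\Re(\epsilon)]+1\}.$$ Assume that neither $\tau-\delta'+\mu'$ nor $\tau+\epsilon-\delta-\delta'-\mu$ is a non-positive integer (so that the right-hand side below exists). Then for every $x>0$, $$\left(D_{-}^{\delta,\delta',\mu,\mu',\epsilon}\,t^{-\tau}M_n^{(p,q)}\left(\tfrac1t\right)\right)(x)=\frac{(-1)^n\,\Gamma(q+n+1)\,\Gamma(\mu'+\tau)\,\Gamma(-\delta-\delta'+\epsilon+\tau)\,\Gamma(-\delta'-\mu+\epsilon+\tau)}{\Gamma(q+1)\,\Gamma(\tau)\,\Gamma(-\delta'+\mu'+\tau)\,\Gamma(-\delta-\delta'-\mu+\epsilon+\tau)}\,x^{\delta+\delta'-\epsilon-\tau}$$ $$\times\ {}_5F_4\left[\begin{array}{c}1+n-p,\ -n,\ \tau+\mu',\ \tau-\delta-\delta'+\epsilon,\ \tau-\delta'-\mu+\epsilon\\ \tau,\ \tau-\delta'+\mu',\ \tau+\epsilon-\delta-\delta'-\mu,\ q+1\end{array}\Big|\,-\frac1x\right].$$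
   Context: Pochhammer symbol: $(a)_0=1$, $(a)_k=a(a+1)\cdots(a+k-1)$. The generalized hypergeometric function is $${}_rF_s\left[\begin{array}{c}a_1,\dots,a_r\\ c_1,\dots,c_s\end{array}\Big|\,z\right]=\sum_{k=0}^\infty\frac{(a_1)_k\cdots(a_r)_k}{(c_1)_k\cdots(c_s)_k}\frac{z^k}{k!};$$ when one upper parameter is $-n$ with $n$ a non-negative integer (as here), the series is the finite sum over $0\le k\le n$ and is taken for all $z$. The Jacobi type orthogonal polynomial is $$M_n^{(p,q)}(x)=(-1)^n\,n!\sum_{k=0}^n\binom{p-n-1}{k}\binom{q+n}{n-k}(-x)^k,$$ where $\binom{a}{k}=a(a-1)\cdots(a-k+1)/k!$ for $a\in\mathbb{C}$. Appell's function is $F_3(a,a',b,b';c;X,Y)=\sum_{m,l\ge0}\frac{(a)_m(a')_l(b)_m(b')_l}{(c)_{m+l}\,m!\,l!}X^mY^l$ for $|X|,|Y|<1$, extended by analytic continuation to $(\mathbb{C}\setminus[1,\infty))^2$. The (right-sided) Marichev-Saigo-Maeda fractional integral, for $\Re(\epsilon)>0$ and $x>0$, is $$\left(I_{-}^{\delta,\delta',\mu,\mu',\epsilon}f\right)(x)=\frac{x^{-\delta'}}{\Gamma(\epsilon)}\int_x^\infty(t-x)^{\epsilon-1}t^{-\delta}F_3\left(\delta,\delta',\mu,\mu';\epsilon;1-\frac xt,1-\frac tx\right)f(t)\,dt.$$ The corresponding fractional derivative is $$\left(D_{-}^{\delta,\delta',\mu,\mu',\epsilon}f\right)(x)=\left(-\frac{d}{dx}\right)^{[\Re(\epsilon)]+1}\left(I_{-}^{-\delta',-\delta,-\mu',-\mu+[\Re(\epsilon)]+1,-\epsilon+[\Re(\epsilon)]+1}f\right)(x),$$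 where $[\cdot]$ denotes the integer part (floor). Here $(D f(t))(x)$ means the operator applied to the function $t\mapsto f(t)$, evaluated at $x$. *)

theory Defs
  imports "HOL-Complex_Analysis.Complex_Analysis"
begin

definition hypergeom :: "complex list \<Rightarrow> complex list \<Rightarrow> complex \<Rightarrow> complex" where
  "hypergeom as cs z = eval_fps (fps_hypergeo as cs 1) z"

lemma hypergeom_series:
  "hypergeom as cs z =
     (\<Sum>k. (\<Prod>a\<leftarrow>as. pochhammer a k) / (\<Prod>c\<leftarrow>cs. pochhammer c k) * (z ^ k / fact k))"
proof -
  have "foldl (\<lambda>r a. r * pochhammer a k) y xs = y * (\<Prod>a\<leftarrow>xs. pochhammer a k)"
    for xs :: "complex list" and y k
    by (induction xs arbitrary: y) (auto simp: mult.assoc)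
  then show ?thesis
    by (simp add: hypergeom_def eval_fps_def)
qed

lemma hypergeom_terminating:
  assumes "- of_nat n \<in> set as"
  shows "hypergeom as cs z =
     (\<Sum>k\<le>n. (\<Prod>a\<leftarrow>as. pochhammer a k) / (\<Prod>c\<leftarrow>cs. pochhammer c k) * (z ^ k / fact k))"
proof -
  have "(\<Prod>a\<leftarrow>as. pochhammer a k) = 0" if "k \<notin> {..n}" for k
    using assms that by (force simp: prod_list_zero_iff pochhammer_of_nat_eq_0_iff image_iff)
  then show ?thesis
    unfolding hypergeom_series by (intro suminf_finite) auto
qed

definition jacobi_M :: "nat \<Rightarrow> complex \<Rightarrow> complex \<Rightarrow> complex \<Rightarrow> complex" where
  "jacobi_M n p q x = (- 1) ^ n * fact n *
     (\<Sum>k\<le>n. ((p - of_nat n - 1) gchoose k) * ((q + of_nat n) gchoose (n - k)) * (- x) ^ k)"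

definition slit_plane :: "complex set" where
  "slit_plane = - complex_of_real ` {1..}"

definition F3_term ::
  "complex \<Rightarrow> complex \<Rightarrow> complex \<Rightarrow> complex \<Rightarrow> complex \<Rightarrow> complex \<Rightarrow> complex \<Rightarrow> nat \<times> nat \<Rightarrow> complex" where
  "F3_term a a' b b' c X Y = (\<lambda>(m, l).
     pochhammer a m * pochhammer a' l * pochhammer b m * pochhammer b' l /
       (pochhammer c (m + l) * fact m * fact l) * X ^ m * Y ^ l)"

text \<open>
  Holomorphy in two variables is expressed as joint continuity together with holomorphy in each
  variable separately (equivalent to joint complex differentiability by Osgood's lemma).
\<close>
definition is_F3_continuation ::
  "complex \<Rightarrow> complex \<Rightarrow> complex \<Rightarrow> complex \<Rightarrow> complex \<Rightarrow> (complex \<Rightarrow> complex \<Rightarrow> complex) \<Rightarrow> bool" where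
  "is_F3_continuation a a' b b' c F \<longleftrightarrow>
     continuous_on (slit_plane \<times> slit_plane) (\<lambda>(X, Y). F X Y) \<and>
     (\<forall>Y\<in>slit_plane. (\<lambda>X. F X Y) holomorphic_on slit_plane) \<and>
     (\<forall>X\<in>slit_plane. (\<lambda>Y. F X Y) holomorphic_on slit_plane) \<and>
     (\<forall>X Y. norm X < 1 \<longrightarrow> norm Y < 1 \<longrightarrow> (F3_term a a' b b' c X Y has_sum F X Y) UNIV)"

text \<open>
  On \<open>slit_plane \<times> slit_plane\<close> the choice below is irrelevant, by uniqueness of the continuation
  (\<open>is_F3_continuation_unique\<close>); outside that set the value is unspecified.
\<close>
definition appell_F3 ::
  "complex \<Rightarrow> complex \<Rightarrow> complex \<Rightarrow> complex \<Rightarrow> complex \<Rightarrow> complex \<Rightarrow> complex \<Rightarrow> complex" where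
  "appell_F3 a a' b b' c = (SOME F. is_F3_continuation a a' b b' c F)"

lemma open_slit_plane: "open slit_plane"
proof -
  have "closed (complex_of_real ` {1..})"
    by (intro closed_injective_linear_image) (auto simp: linear_of_real inj_def)
  then show ?thesis
    unfolding slit_plane_def by (rule open_Compl)
qed

lemma connected_slit_plane: "connected slit_plane"
  unfolding slit_plane_def
  by (intro starlike_imp_connected starlike_slotted_complex_plane_right)

lemma ball_subset_slit_plane: "ball 0 1 \<subseteq> slit_plane"
  by (auto simp: slit_plane_def)

lemma is_F3_continuation_unique:
  assumes F: "is_F3_continuation a a' b b' c F" and G: "is_F3_continuation a a' b b' c G"
    and X: "X \<in> slit_plane" and Y: "Y \<in> slit_plane"
  shows "F X Y = G X Y"
proof -
  have cont: "f w = g w"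
    if "f holomorphic_on slit_plane" "g holomorphic_on slit_plane"
      "\<And>z. z \<in> ball 0 1 \<Longrightarrow> f z = g z" "w \<in> slit_plane" for f g :: "complex \<Rightarrow> complex" and w
    by (rule analytic_continuation_open[of "ball 0 1" slit_plane f g])
       (use that open_slit_plane connected_slit_plane ball_subset_slit_plane in auto)
  have *: "F X' Y' = G X' Y'" if "X' \<in> ball 0 1" "Y' \<in> ball 0 1" for X' Y'
    using F G that unfolding is_F3_continuation_def mem_ball_0 by (metis has_sum_unique)
  have **: "F X Y' = G X Y'" if Y': "Y' \<in> ball 0 1" for Y'
    by (rule cont[of "\<lambda>X. F X Y'" "\<lambda>X. G X Y'"])
       (use F G X Y' * ball_subset_slit_plane in \<open>auto simp: is_F3_continuation_def\<close>)
  show ?thesis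
    by (rule cont[of "F X" "G X"])
       (use F G X Y ** in \<open>auto simp: is_F3_continuation_def\<close>)
qed

definition MSM_integral ::
  "complex \<Rightarrow> complex \<Rightarrow> complex \<Rightarrow> complex \<Rightarrow> complex \<Rightarrow> (real \<Rightarrow> complex) \<Rightarrow> real \<Rightarrow> complex" where
  "MSM_integral \<delta> \<delta>' \<mu> \<mu>' \<epsilon> f x =
     of_real x powr (- \<delta>') / Gamma \<epsilon> *
     (LBINT t:{x<..}. of_real (t - x) powr (\<epsilon> - 1) * of_real t powr (- \<delta>) *
        appell_F3 \<delta> \<delta>' \<mu> \<mu>' \<epsilon> (of_real (1 - x / t)) (of_real (1 - t / x)) * f t)"

definition MSM_derivative ::
  "complex \<Rightarrow> complex \<Rightarrow> complex \<Rightarrow> complex \<Rightarrow> complex \<Rightarrow> (real \<Rightarrow> complex) \<Rightarrow> real \<Rightarrow> complex" where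
  "MSM_derivative \<delta> \<delta>' \<mu> \<mu>' \<epsilon> f =
     (let N = nat (\<lfloor>Re \<epsilon>\<rfloor> + 1) in
      ((\<lambda>g x. - vector_derivative g (at x)) ^^ N)
        (MSM_integral (- \<delta>') (- \<delta>) (- \<mu>') (- \<mu> + of_nat N) (- \<epsilon> + of_nat N) f))"

end

theory Submission
  imports Defs "HOL-Real_Asymp.Real_Asymp"
begin

text \<open>
  Put \<open>N = \<lfloor>Re \<epsilon>\<rfloor> + 1\<close> and \<open>a = -\<delta>'\<close>, \<open>a' = -\<delta>\<close>, \<open>b = -\<mu>'\<close>, \<open>b' = -\<mu> + N\<close>, \<open>c = -\<epsilon> + N\<close>, so that
  \<open>Re c > 0\<close>. The polynomial in \<open>1/t\<close> is a combination of powers, so everything rests on the action of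
  the fractional integral on one power: it sends \<open>t\<^sup>-\<^sup>s\<close> to \<open>x\<close> to the power \<open>c - a - a' - s\<close> times
  \<open>\<Gamma>(s-b) \<Gamma>(s+a+a'-c) \<Gamma>(s+a+b'-c) / (\<Gamma>(s) \<Gamma>(s+a-b) \<Gamma>(s+a+a'+b'-c))\<close>
  (\<open>MSM_multiplier\<close>, \<open>MSM_integral_sum_powr\<close>). The \<open>N\<close> derivatives then add one Pochhammer factor, which
  shifts the second Gamma factor by \<open>N\<close>, and the sum over the coefficients of the polynomial is the
  terminating hypergeometric sum.

  After the substitution \<open>t = x / (1 - u)\<close> the multiplier is an integral over \<open>0 < u < 1\<close> that involves
  Appell's function at \<open>X = u\<close>, \<open>Y = u / (u - 1)\<close>, that is, on the curve \<open>XY = X + Y\<close>. Three things are needed.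

  (1) The continuation of \<open>F\<^sub>3\<close> exists, so that \<open>appell_F3\<close> denotes it. It is an Euler integral of a product
  of two Gauss functions \<open>f(uX) g((1-u)Y)\<close>, each of which continues to the slit plane: the coefficients
  \<open>(b)\<^sub>m/(e)\<^sub>m\<close> can be introduced into a power series by beta integrals, differentiations and removal of the
  constant term, all of which respect continuability (\<open>slit_continuable_pochhammer_quotient\<close>).

  (2) On the curve, \<open>F\<^sub>3 = (1-X)\<^sup>c\<^sup>-\<^sup>a\<^sup>-\<^sup>b \<Sum>\<^sub>j\<^sub>,\<^sub>k t\<^sub>j\<^sub>k X\<^sup>j\<^sup>+\<^sup>k\<close> for \<open>|X| < 1\<close>, with explicit products of Pochhammer
  symbols \<open>t\<^sub>j\<^sub>k\<close> (\<open>appell_F3_on_curve\<close>). Near the origin this is Euler's transformation in \<open>X\<close> for each power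
  of \<open>Y\<close>, followed by a transformation of terminating \<open>\<^sub>3F\<^sub>2\<close> sums; analytic continuation does the rest.
  The second step matters: the Euler transformed double series need not converge absolutely up to \<open>X = 1\<close>,
  whereas the series with coefficients \<open>t\<^sub>j\<^sub>k\<close> can be integrated term by term over the whole interval under the
  conditions on \<open>\<tau>\<close> (\<open>curve_Beta_summable\<close>).

  (3) Integrated term by term, each \<open>X\<^sup>j\<^sup>+\<^sup>k\<close> gives a beta value, and the resulting double series is summed by
  Gauss's theorem first over \<open>j\<close>, then over \<open>k\<close> (\<open>gauss_sum\<close>, \<open>curve_Beta_sum\<close>). The reciprocal
  Gamma function keeps these sums meaningful when a lower parameter is a non-positive integer.
\<close>

section \<open>Integrals depending on a parameter\<close>

text \<open>
  Differentiation under the integral sign. Cauchy's inequality turns the local bound \<open>w\<close> on the integrand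
  into a bound on its difference quotients, so dominated convergence applies to them.
\<close>
lemma holomorphic_on_lebesgue_integral:
  fixes f :: "'a \<Rightarrow> complex \<Rightarrow> complex"
  assumes "open S"
    and meas: "\<And>z. z \<in> S \<Longrightarrow> (\<lambda>u. f u z) \<in> borel_measurable M"
    and hol: "\<And>u. u \<in> space M \<Longrightarrow> f u holomorphic_on S"
    and bound: "\<And>z. z \<in> S \<Longrightarrow> \<exists>r>0. \<exists>w. integrable M w \<and> cball z r \<subseteq> S \<and>
                  (\<forall>u\<in>space M. \<forall>\<zeta>\<in>cball z r. norm (f u \<zeta>) \<le> w u)"
  shows "(\<lambda>z. \<integral>u. f u z \<partial>M) holomorphic_on S"
  unfolding holomorphic_on_open[OF \<open>open S\<close>]
proof
  fix z assume z: "z \<in> S"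
  obtain r w where r: "r > 0" and w: "integrable M w" and sub: "cball z r \<subseteq> S"
    and le: "\<And>u \<zeta>. u \<in> space M \<Longrightarrow> \<zeta> \<in> cball z r \<Longrightarrow> norm (f u \<zeta>) \<le> w u"
    using bound[OF z] by blast
  have int: "integrable M (\<lambda>u. f u \<zeta>)" if "\<zeta> \<in> cball z r" for \<zeta>
    by (rule Bochner_Integration.integrable_bound[OF w meas])
       (use that sub le in \<open>force intro!: AE_I2 order.trans[OF _ abs_ge_self]\<close>)+
  define q where "q u h = (if h = 0 then deriv (f u) z else (f u (z + h) - f u z) / h)" for u h
  have qb: "norm (q u h) \<le> 2 / r * w u" if u: "u \<in> space M" and h: "norm h < r / 2" for u h
  proof -
    have d: "norm (deriv (f u) \<zeta>) \<le> 2 / r * w u" if "\<zeta> \<in> ball z (r/2)" for \<zeta>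
    proof -
      have "cball \<zeta> (r/2) \<subseteq> cball z r"
        using that by (auto simp: cball_subset_cball_iff dist_commute)
      then have *: "f u holomorphic_on cball \<zeta> (r/2)" "\<And>x. x \<in> cball \<zeta> (r/2) \<Longrightarrow> norm (f u x) \<le> w u"
        using sub le[OF u] hol[OF u] by (blast intro: holomorphic_on_subset)+
      have "norm ((deriv ^^ 1) (f u) \<zeta>) \<le> fact 1 * w u / (r/2) ^ 1"
        by (rule Cauchy_inequality)
           (use * r in \<open>auto intro: holomorphic_on_subset holomorphic_on_imp_continuous_on simp: dist_norm norm_minus_commute\<close>)
      then show ?thesis by (simp add: field_simps)
    qed
    show ?thesis
    proof (cases "h = 0")
      case True then show ?thesis using d[of z] r by (simp add: q_def)
    next
      case False
      have "norm (f u (z + h) - f u z) \<le> (2 / r * w u) * norm (z + h - z)"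
      proof (rule field_differentiable_bound[of "ball z (r/2)" "f u" "deriv (f u)"])
        fix y assume "y \<in> ball z (r/2)"
        then have "y \<in> S" using sub r by auto
        then have "(f u has_field_derivative deriv (f u) y) (at y)"
          using hol[OF u] \<open>open S\<close> holomorphic_derivI by blast
        then show "(f u has_field_derivative deriv (f u) y) (at y within ball z (r/2))"
          using has_field_derivative_at_within by blast
      qed (use d h r in \<open>auto simp: dist_norm\<close>)
      then show ?thesis using False by (simp add: q_def norm_divide field_simps)
    qed
  qed
  have lim: "((\<lambda>h. q u h) \<longlongrightarrow> deriv (f u) z) (at 0)" if "u \<in> space M" for u
  proof -
    have "(f u has_field_derivative deriv (f u) z) (at z)"
      using hol[OF that] \<open>open S\<close> z holomorphic_derivI by blast
    then have "((\<lambda>h. (f u (z + h) - f u z) / h) \<longlongrightarrow> deriv (f u) z) (at 0)"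
      by (simp add: DERIV_def)
    then show ?thesis
      by (rule Lim_transform_eventually) (auto simp: q_def eventually_at_filter)
  qed
  have main: "(\<lambda>n. \<integral>u. q u (X n) \<partial>M) \<longlonglongrightarrow> (\<integral>u. deriv (f u) z \<partial>M)"
    if X: "X \<longlonglongrightarrow> 0" "\<And>n. X n \<noteq> 0" "\<And>n. norm (X n) < r/2" for X
  proof (rule integral_dominated_convergence[where w = "\<lambda>u. 2 / r * w u"])
    have "X n + z \<in> cball z r" for n using X(3)[of n] r by (simp add: dist_norm)
    then have "X n + z \<in> S" for n using sub by blast
    then have m: "(\<lambda>u. q u (X n)) \<in> borel_measurable M" for n
      unfolding q_def using X(2) z sub meas[of z] meas[of "X n + z"]
      by (auto simp: add.commute[of z] intro!: borel_measurable_divide borel_measurable_diff)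
    show "(\<lambda>u. q u (X n)) \<in> borel_measurable M" for n by (rule m)
    have l: "(\<lambda>n. q u (X n)) \<longlonglongrightarrow> deriv (f u) z" if "u \<in> space M" for u
      using lim[OF that] X unfolding tendsto_at_iff_sequentially o_def by auto
    then show "AE u in M. (\<lambda>n. q u (X n)) \<longlonglongrightarrow> deriv (f u) z" by (intro AE_I2) auto
    show "(\<lambda>u. deriv (f u) z) \<in> borel_measurable M"
      by (rule borel_measurable_LIMSEQ_metric[OF m l])
    show "integrable M (\<lambda>u. 2 / r * w u)" using w by simp
    show "AE u in M. norm (q u (X n)) \<le> 2 / r * w u" for n
      using qb X(3) by (intro AE_I2) auto
  qed
  have "((\<lambda>h. \<integral>u. q u h \<partial>M) \<longlongrightarrow> (\<integral>u. deriv (f u) z \<partial>M)) (at 0 within ball 0 (r/2))"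
    unfolding tendsto_at_iff_sequentially
    using main by (auto simp: o_def dist_norm)
  then have L: "((\<lambda>h. \<integral>u. q u h \<partial>M) \<longlongrightarrow> (\<integral>u. deriv (f u) z \<partial>M)) (at 0)"
    using r by (subst (asm) at_within_open) auto
  have "eventually (\<lambda>h. h \<in> ball 0 r - {0}) (at (0::complex))"
    using r by (intro eventually_at_in_open) auto
  then have "eventually (\<lambda>h. (\<integral>u. q u h \<partial>M) =
      ((\<integral>u. f u (z + h) \<partial>M) - (\<integral>u. f u z \<partial>M)) / h) (at 0)"
  proof eventually_elim
    case (elim h)
    then have "h \<noteq> 0" "z + h \<in> cball z r" by (auto simp: dist_norm)
    moreover have "z \<in> cball z r" using r by simp
    ultimately show ?case using int by (simp add: q_def Bochner_Integration.integral_diff)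
  qed
  from Lim_transform_eventually[OF L this]
  show "\<exists>f'. ((\<lambda>z. \<integral>u. f u z \<partial>M) has_field_derivative f') (at z)"
    unfolding DERIV_def by blast
qed

lemma has_sum_complex_abs:
  "(f has_sum (S::complex)) A \<Longrightarrow> (\<lambda>x. norm (f x)) summable_on A"
  by (rule summable_on_iff_abs_summable_on_complex[THEN iffD1, OF has_sum_imp_summable])

lemma summable_on_norm_le:
  fixes f :: "'a \<Rightarrow> complex"
  assumes "g summable_on A" "\<And>x. x \<in> A \<Longrightarrow> norm (f x) \<le> g x"
  shows "f summable_on A"
  by (rule summable_on_iff_abs_summable_on_complex[THEN iffD2])
     (rule Infinite_Sum.abs_summable_on_comparison_test'[OF assms])

text \<open>
  Unconditional sums over a countable index type are transported to series over the natural numbers along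
  \<open>to_nat\<close>, where the theorem on termwise integration of series applies.
\<close>
lemma has_sum_integral_countable:
  fixes f :: "'i::countable \<Rightarrow> 'a \<Rightarrow> complex"
  assumes int: "\<And>i. integrable M (f i)"
    and summable: "(\<lambda>i. \<integral>u. norm (f i u) \<partial>M) summable_on UNIV"
    and F: "\<And>u. u \<in> space M \<Longrightarrow> ((\<lambda>i. f i u) has_sum F u) UNIV"
  shows "integrable M F" "((\<lambda>i. \<integral>u. f i u \<partial>M) has_sum (\<integral>u. F u \<partial>M)) UNIV"
proof -
  define g where "g n = (if n \<in> range (to_nat :: 'i \<Rightarrow> nat) then f (from_nat n) else (\<lambda>_. 0))" for n
  have pw: "(\<lambda>i. norm (f i u)) summable_on UNIV" if "u \<in> space M" for u
    by (rule has_sum_complex_abs[OF F[OF that]])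
  have inj: "inj (to_nat :: 'i \<Rightarrow> nat)" by simp
  have transfer: "((\<lambda>n. \<phi> (g n)) has_sum s) UNIV \<longleftrightarrow> ((\<lambda>i. \<phi> (f i)) has_sum s) UNIV"
    if "\<phi> (\<lambda>_. 0) = (0::'b)" for \<phi> and s :: "'b::{comm_monoid_add,topological_space}"
  proof -
    have "((\<lambda>n. \<phi> (g n)) has_sum s) UNIV \<longleftrightarrow> ((\<lambda>n. \<phi> (g n)) has_sum s) (range (to_nat :: 'i \<Rightarrow> nat))"
      by (intro has_sum_cong_neutral) (use that in \<open>auto simp: g_def\<close>)
    also have "\<dots> \<longleftrightarrow> ((\<lambda>i. \<phi> (f i)) has_sum s) UNIV"
      by (subst has_sum_reindex[OF inj]) (simp add: g_def o_def)
    finally show ?thesis .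
  qed
  have gi: "integrable M (g n)" for n using int by (auto simp: g_def)
  have s1: "summable (\<lambda>n. \<integral>u. norm (g n u) \<partial>M)"
    using summable transfer[of "\<lambda>h. \<integral>u. norm (h u) \<partial>M"]
    by (auto simp: summable_on_def intro!: summable_on_imp_summable)
  have s2: "AE u in M. summable (\<lambda>n. norm (g n u))"
  proof (intro AE_I2)
    fix u assume "u \<in> space M"
    then show "summable (\<lambda>n. norm (g n u))"
      using pw[of u] transfer[of "\<lambda>h. norm (h u)"]
      by (auto simp: summable_on_def intro!: summable_on_imp_summable)
  qed
  have eq: "(\<Sum>n. g n u) = F u" if "u \<in> space M" for u
    using F[OF that] transfer[of "\<lambda>h. h u" "F u"]
    by (auto dest!: has_sum_imp_sums simp: sums_iff)
  show "integrable M F"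
    using integrable_suminf[OF gi s2 s1] eq by (simp cong: Bochner_Integration.integrable_cong)
  have "(\<lambda>n. \<integral>u. g n u \<partial>M) sums (\<integral>u. (\<Sum>n. g n u) \<partial>M)"
    by (rule sums_integral[OF gi s2 s1])
  also have "(\<integral>u. (\<Sum>n. g n u) \<partial>M) = (\<integral>u. F u \<partial>M)"
    using eq by (rule Bochner_Integration.integral_cong[OF refl])
  finally have sums: "(\<lambda>n. \<integral>u. g n u \<partial>M) sums (\<integral>u. F u \<partial>M)" .
  have "summable (\<lambda>n. norm (\<integral>u. g n u \<partial>M))"
    by (rule summable_comparison_test'[OF s1, of 0]) (simp add: integral_norm_bound)
  from norm_summable_imp_has_sum[OF this sums]
  show "((\<lambda>i. \<integral>u. f i u \<partial>M) has_sum (\<integral>u. F u \<partial>M)) UNIV"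
    by (subst (asm) transfer[of "\<lambda>h. \<integral>u. h u \<partial>M"]) auto
qed

section \<open>The complex beta integral\<close>

lemma Re_pos_not_nonpos_Ints: "Re z > 0 \<Longrightarrow> z \<notin> \<int>\<^sub>\<le>\<^sub>0"
  by (auto elim!: nonpos_Ints_cases)

lemma pochhammer_nonzero: "Re c > 0 \<Longrightarrow> pochhammer c n \<noteq> 0"
  using Re_pos_not_nonpos_Ints pochhammer_eq_0_imp_nonpos_Int by blast

lemma of_real_powr_eq_exp: "r > 0 \<Longrightarrow> of_real r powr z = exp (z * of_real (ln r) :: complex)"
  by (simp add: powr_def Ln_of_real)

lemma norm_of_real_powr: "r > 0 \<Longrightarrow> norm (of_real r powr z :: complex) = r powr Re z"
  by (simp add: of_real_powr_eq_exp powr_def)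

text \<open>
  The cut-off to the open unit interval is part of the kernel, so that integrals run over the whole line and
  integrands need not be controlled outside the interval.
\<close>
definition Beta_kernel :: "complex \<Rightarrow> complex \<Rightarrow> real \<Rightarrow> complex" where
  "Beta_kernel a b u = indicator {0<..<1} u *\<^sub>R (of_real u powr (a - 1) * of_real (1 - u) powr (b - 1))"

lemma norm_Beta_kernel:
  "norm (Beta_kernel a b u) = indicator {0<..<1} u * (u powr (Re a - 1) * (1 - u) powr (Re b - 1))"
  by (auto simp: Beta_kernel_def norm_mult norm_of_real_powr indicator_def simp del: of_real_diff)

lemma continuous_on_powr_of_real:
  assumes "continuous_on A f" "\<And>x. x \<in> A \<Longrightarrow> f x > (0::real)"
  shows "continuous_on A (\<lambda>x. of_real (f x) powr (z::complex))"
proof -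
  have "continuous_on A (\<lambda>x. exp (z * of_real (ln (f x))))"
    using assms by (intro continuous_intros) force+
  then show ?thesis
    by (rule continuous_on_eq) (use assms in \<open>simp add: of_real_powr_eq_exp\<close>)
qed

lemma measurable_Beta_kernel [measurable]: "Beta_kernel a b \<in> borel_measurable lborel"
  unfolding Beta_kernel_def[abs_def] measurable_lborel2
  by (intro borel_measurable_continuous_on_indicator continuous_intros continuous_on_powr_of_real) auto

lemma Beta_kernel_real_integral:
  fixes a b :: real assumes "a > 0" "b > 0"
  shows "integrable lborel (\<lambda>u. indicator {0<..<1} u * (u powr (a - 1) * (1 - u) powr (b - 1)))"
    and "(\<integral>u. indicator {0<..<1} u * (u powr (a - 1) * (1 - u) powr (b - 1)) \<partial>lborel) = Beta a b"
proof -
  have i: "set_integrable lborel {0<..<1} (\<lambda>t. t powr (a - 1) * (1 - t) powr (b - 1))"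
    by (rule set_integrable_subset[OF integrable_Beta[OF assms]]) auto
  then show "integrable lborel (\<lambda>u. indicator {0<..<1} u * (u powr (a - 1) * (1 - u) powr (b - 1)))"
    by (simp add: set_integrable_def)
  have "((\<lambda>t. t powr (a - 1) * (1 - t) powr (b - 1)) has_integral Beta a b) {0<..<1}"
    using has_integral_Beta_real[OF assms] by (simp add: has_integral_Icc_iff_Ioo)
  then have "(LBINT t:{0<..<1}. t powr (a - 1) * (1 - t) powr (b - 1)) = Beta a b"
    using set_borel_integral_eq_integral(2)[OF i] by (simp add: integral_unique)
  then show "(\<integral>u. indicator {0<..<1} u * (u powr (a - 1) * (1 - u) powr (b - 1)) \<partial>lborel) = Beta a b"
    by (simp add: set_lebesgue_integral_def)
qed

lemma integrable_Beta_kernel: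
  assumes "Re a > 0" "Re b > 0" shows "integrable lborel (Beta_kernel a b)"
  by (rule Bochner_Integration.integrable_bound[OF Beta_kernel_real_integral(1)[OF assms]])
     (auto simp: norm_Beta_kernel)

lemma integral_norm_Beta_kernel:
  assumes "Re a > 0" "Re b > 0"
  shows "(\<integral>u. norm (Beta_kernel a b u) \<partial>lborel) = Beta (Re a) (Re b)"
  unfolding norm_Beta_kernel by (rule Beta_kernel_real_integral(2)[OF assms])

lemma Beta_kernel_commute: "Beta_kernel a b (1 - u) = Beta_kernel b a u"
  by (auto simp: Beta_kernel_def indicator_def)

lemma integral_Beta_kernel_commute:
  "(\<integral>u. Beta_kernel a b u \<partial>lborel) = (\<integral>u. Beta_kernel b a u \<partial>lborel)"
  using lborel_integral_real_affine[of "-1" "Beta_kernel a b" 1]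
  by (simp add: Beta_kernel_commute)

lemma open_Re_gt: "open {z. Re z > x}"
  by (rule open_halfspace_Re_gt)

text \<open>
  Near a point \<open>z\<close> the kernel is dominated by the kernel with exponent \<open>Re z / 2\<close>.
\<close>
lemma integral_Beta_kernel_holomorphic:
  assumes "Re b > 0"
  shows "(\<lambda>a. \<integral>u. Beta_kernel a b u \<partial>lborel) holomorphic_on {z. Re z > 0}"
proof (rule holomorphic_on_lebesgue_integral)
  fix u :: real
  show "(\<lambda>a. Beta_kernel a b u) holomorphic_on {z. Re z > 0}"
  proof (cases "u \<in> {0<..<1}")
    case True
    then have "Beta_kernel a b u = exp ((a - 1) * of_real (ln u)) * of_real (1 - u) powr (b - 1)" for a
      by (simp add: Beta_kernel_def of_real_powr_eq_exp del: of_real_diff)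
    then show ?thesis by (auto intro!: holomorphic_intros)
  qed (auto simp: Beta_kernel_def)
next
  fix z assume "z \<in> {z. Re z > 0}"
  then have z: "Re z > 0" by simp
  define r where "r = Re z / 2"
  have cb: "Re \<zeta> \<ge> r" if "\<zeta> \<in> cball z r" for \<zeta>
    using that abs_Re_le_cmod[of "z - \<zeta>"] unfolding r_def by (auto simp: dist_norm)
  show "\<exists>r>0. \<exists>w. integrable lborel w \<and> cball z r \<subseteq> {z. Re z > 0} \<and>
          (\<forall>u\<in>space lborel. \<forall>\<zeta>\<in>cball z r. norm (Beta_kernel \<zeta> b u) \<le> w u)"
  proof (intro exI conjI ballI)
    show "r > 0" using z by (simp add: r_def)
    show "integrable lborel (\<lambda>u. norm (Beta_kernel (of_real r) b u))"
      using assms z by (intro integrable_norm integrable_Beta_kernel) (auto simp: r_def)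
    show "cball z r \<subseteq> {z. Re z > 0}" using cb z by (force simp: r_def)
    fix u :: real and \<zeta> assume "\<zeta> \<in> cball z r"
    then show "norm (Beta_kernel \<zeta> b u) \<le> norm (Beta_kernel (of_real r) b u)"
      using cb by (auto simp: norm_Beta_kernel indicator_def intro!: mult_right_mono powr_mono')
  qed
qed (auto simp: open_Re_gt)

lemma holomorphic_eq_on_right_half_plane:
  assumes "f holomorphic_on {z. Re z > 0}" "g holomorphic_on {z. Re z > 0}"
    and eq: "\<And>x. x > 0 \<Longrightarrow> f (of_real x) = g (of_real x)" and z: "Re z > 0"
  shows "f z = g z"
proof -
  have "f z - g z = 0"
  proof (rule analytic_continuation[of "\<lambda>z. f z - g z" "{z. Re z > 0}" "complex_of_real ` {0<..}" 1])
    show "(1::complex) islimpt complex_of_real ` {0<..}"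
      unfolding islimpt_sequential
    proof (intro exI conjI allI)
      let ?s = "\<lambda>n. complex_of_real (1 + inverse (real (Suc n)))"
      show "?s n \<in> complex_of_real ` {0<..} - {1}" for n
      proof -
        have "1 + inverse (real (Suc n)) > 1" by simp
        then have "1 + inverse (real (Suc n)) \<noteq> 1" "1 + inverse (real (Suc n)) > 0" by linarith+
        then show ?thesis by (auto simp del: of_real_add of_nat_Suc simp: of_real_eq_1_iff intro!: imageI)
      qed
      have "?s \<longlonglongrightarrow> of_real (1 + 0)"
        by (intro tendsto_of_real tendsto_add tendsto_const LIMSEQ_inverse_real_of_nat)
      then show "?s \<longlonglongrightarrow> 1" by simp
    qed
    show "connected {z. 0 < Re z}" by (rule convex_connected[OF convex_halfspace_Re_gt])
  qed (use assms open_Re_gt in \<open>auto intro!: holomorphic_intros\<close>)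
  then show ?thesis by simp
qed

lemma Beta_holomorphic:
  assumes "Re b > 0" shows "(\<lambda>a. Beta a b) holomorphic_on {z. Re z > 0}"
proof -
  have "a \<notin> \<int>\<^sub>\<le>\<^sub>0" if "Re a > 0" for a :: complex
    by (rule Re_pos_not_nonpos_Ints[OF that])
  then show ?thesis unfolding Beta_def using assms
    by (intro holomorphic_intros) (auto simp: Gamma_eq_zero_iff)
qed

text \<open>
  The case of real exponents is continued analytically, first in the one exponent and then, by the symmetry
  \<open>u \<mapsto> 1 - u\<close>, in the other.
\<close>
lemma integral_Beta_kernel:
  assumes a: "Re a > 0" and b: "Re b > 0"
  shows "(\<integral>u. Beta_kernel a b u \<partial>lborel) = Beta a b"
proof -
  have real: "(\<integral>u. Beta_kernel (of_real x) (of_real y) u \<partial>lborel) = Beta (of_real x) (of_real y)"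
    if "x > 0" "y > 0" for x y
  proof -
    have "Beta_kernel (of_real x) (of_real y) u =
        of_real (indicator {0<..<1} u * (u powr (x - 1) * (1 - u) powr (y - 1)))" for u
      by (auto simp: Beta_kernel_def indicator_def powr_of_real[symmetric])
    then show ?thesis
      using Beta_kernel_real_integral(2)[OF that]
      by (simp add: Beta_complex_of_real del: of_real_mult)
  qed
  have 1: "(\<integral>u. Beta_kernel z (of_real y) u \<partial>lborel) = Beta z (of_real y)"
    if "Re z > 0" "y > 0" for z y
    by (rule holomorphic_eq_on_right_half_plane[OF integral_Beta_kernel_holomorphic Beta_holomorphic])
       (use that real in auto)
  have 2: "(\<integral>u. Beta_kernel z a u \<partial>lborel) = Beta z a" if "Re z > 0" for z
    by (rule holomorphic_eq_on_right_half_plane[OF integral_Beta_kernel_holomorphic Beta_holomorphic])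
       (use that a 1 in \<open>auto simp: integral_Beta_kernel_commute[of "of_real _" a] Beta_commute[of "of_real _" a]\<close>)
  show ?thesis using 2[OF b] integral_Beta_kernel_commute Beta_commute by metis
qed

lemma Beta_kernel_times_measurable:
  assumes cont: "continuous_on ({0..1} \<times> S) (\<lambda>(u, z). G u z)" and z: "z \<in> S"
  shows "(\<lambda>u. Beta_kernel a b u * G u z) \<in> borel_measurable lborel"
proof -
  have "continuous_on {0..1} (\<lambda>u. (u, z))" by (intro continuous_intros)
  then have "continuous_on {0..1} (\<lambda>u. G u z)"
    using continuous_on_compose2[OF cont, of "{0..1}" "\<lambda>u. (u, z)"] z by auto
  then have "(\<lambda>u. indicator {0..1} u *\<^sub>R G u z) \<in> borel_measurable borel"
    by (intro borel_measurable_continuous_on_indicator) auto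
  then have "(\<lambda>u. Beta_kernel a b u * (indicator {0..1} u *\<^sub>R G u z)) \<in> borel_measurable lborel"
    by (intro borel_measurable_times) (auto simp: measurable_lborel2)
  also have "(\<lambda>u. Beta_kernel a b u * (indicator {0..1} u *\<^sub>R G u z)) = (\<lambda>u. Beta_kernel a b u * G u z)"
    by (auto simp: Beta_kernel_def indicator_def fun_eq_iff)
  finally show ?thesis .
qed

text \<open>
  Only the kernel is singular at the end points; \<open>G\<close> is continuous up to them, hence bounded over compact sets
  of parameters, and the kernel itself, up to a constant, is a majorant.
\<close>
lemma Beta_kernel_times_bound:
  assumes ab: "Re a > 0" "Re b > 0" and cont: "continuous_on ({0..1} \<times> S) (\<lambda>(u, z). G u z)"
    and K: "compact K" "K \<subseteq> S"
  shows "\<exists>w. integrable lborel w \<and> (\<forall>u. \<forall>z\<in>K. norm (Beta_kernel a b u * G u z) \<le> w u)"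
proof -
  have "compact ((\<lambda>(u, z). G u z) ` ({0..1} \<times> K))"
    by (intro compact_continuous_image continuous_on_subset[OF cont] compact_Times K) (use K in auto)
  then obtain C where C: "\<And>u z. u \<in> {0..1} \<Longrightarrow> z \<in> K \<Longrightarrow> norm (G u z) \<le> C"
    unfolding compact_eq_bounded_closed bounded_iff by force
  have "norm (Beta_kernel a b u * G u z) \<le> C * norm (Beta_kernel a b u)" if "z \<in> K" for u z
  proof (cases "u \<in> {0<..<1}")
    case True
    then show ?thesis using C[of u z] that
      by (subst norm_mult, subst mult.commute) (intro mult_right_mono, auto)
  qed (auto simp: Beta_kernel_def)
  then show ?thesis
    using integrable_mult_right[OF integrable_norm[OF integrable_Beta_kernel[OF ab]], of C] by blast
qed

lemma holomorphic_on_integral_Beta_kernel: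
  assumes ab: "Re a > 0" "Re b > 0" and S: "open S"
    and cont: "continuous_on ({0..1} \<times> S) (\<lambda>(u, z). G u z)"
    and hol: "\<And>u. 0 < u \<Longrightarrow> u < 1 \<Longrightarrow> G u holomorphic_on S"
  shows "(\<lambda>z. \<integral>u. Beta_kernel a b u * G u z \<partial>lborel) holomorphic_on S"
proof (rule holomorphic_on_lebesgue_integral[OF S])
  fix u show "(\<lambda>z. Beta_kernel a b u * G u z) holomorphic_on S"
  proof (cases "0 < u \<and> u < 1")
    case True then show ?thesis by (intro holomorphic_intros hol) auto
  qed (auto simp: Beta_kernel_def indicator_def)
next
  fix z assume "z \<in> S"
  then obtain r where "r > 0" "cball z r \<subseteq> S" using S open_contains_cball_eq by blast
  then show "\<exists>r>0. \<exists>w. integrable lborel w \<and> cball z r \<subseteq> S \<and>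
      (\<forall>u\<in>space lborel. \<forall>\<zeta>\<in>cball z r. norm (Beta_kernel a b u * G u \<zeta>) \<le> w u)"
    using Beta_kernel_times_bound[OF ab cont, of "cball z r"] by auto
qed (rule Beta_kernel_times_measurable[OF cont])

lemma continuous_on_integral_Beta_kernel:
  fixes S :: "'a::heine_borel set"
  assumes ab: "Re a > 0" "Re b > 0"
    and cont: "continuous_on ({0..1} \<times> S) (\<lambda>(u, z). G u z)"
  shows "continuous_on S (\<lambda>z. \<integral>u. Beta_kernel a b u * G u z \<partial>lborel)"
  unfolding continuous_on_sequentially o_def
proof safe
  fix X z assume z: "z \<in> S" and X: "\<forall>n. X n \<in> S" and lim: "X \<longlonglongrightarrow> z"
  have "compact (insert z (range X))" by (rule compact_sequence_with_limit[OF lim])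
  then obtain w where w: "integrable lborel w"
      "\<And>u y. y \<in> insert z (range X) \<Longrightarrow> norm (Beta_kernel a b u * G u y) \<le> w u"
    using Beta_kernel_times_bound[OF ab cont, of "insert z (range X)"] z X by blast
  show "(\<lambda>n. \<integral>u. Beta_kernel a b u * G u (X n) \<partial>lborel) \<longlonglongrightarrow> (\<integral>u. Beta_kernel a b u * G u z \<partial>lborel)"
  proof (rule integral_dominated_convergence[where w = w])
    show "AE u in lborel. (\<lambda>n. Beta_kernel a b u * G u (X n)) \<longlonglongrightarrow> Beta_kernel a b u * G u z"
    proof (intro AE_I2)
      fix u :: real
      show "(\<lambda>n. Beta_kernel a b u * G u (X n)) \<longlonglongrightarrow> Beta_kernel a b u * G u z"
      proof (cases "u \<in> {0<..<1}")
        case True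
        have "continuous_on S (\<lambda>z. (u, z))" by (intro continuous_intros)
        moreover have "(\<lambda>z. (u, z)) ` S \<subseteq> {0..1} \<times> S" using True by auto
        ultimately have "continuous_on S (\<lambda>z. G u z)"
          using continuous_on_compose2[OF cont, of S "\<lambda>z. (u, z)"] by simp
        then have "(\<lambda>n. G u (X n)) \<longlonglongrightarrow> G u z"
          using z X lim unfolding continuous_on_sequentially o_def by blast
        then show ?thesis by (intro tendsto_intros)
      qed (auto simp: Beta_kernel_def)
    qed
  qed (use w z X Beta_kernel_times_measurable[OF cont] in auto)
qed

section \<open>Power series that continue to the slit plane\<close>

text \<open>
  The predicate is on coefficient sequences because the operations below are simplest there: multiplying the
  \<open>m\<close>-th coefficient by a function of \<open>m\<close>, and shifting the sequence.
\<close>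
definition slit_continuable :: "(nat \<Rightarrow> complex) \<Rightarrow> bool" where
  "slit_continuable f \<longleftrightarrow>
     (\<exists>F. F holomorphic_on slit_plane \<and> (\<forall>z. norm z < 1 \<longrightarrow> (\<lambda>m. f m * z ^ m) sums F z))"

lemma slit_plane_iff: "z \<in> slit_plane \<longleftrightarrow> \<not> (Re z \<ge> 1 \<and> Im z = 0)"
proof -
  have "z \<in> complex_of_real ` {1..} \<longleftrightarrow> Re z \<ge> 1 \<and> Im z = 0"
  proof
    assume "Re z \<ge> 1 \<and> Im z = 0"
    then have "z = of_real (Re z)" "Re z \<in> {1..}" by (auto simp: complex_eq_iff)
    then show "z \<in> complex_of_real ` {1..}" by (rule image_eqI)
  qed auto
  then show ?thesis unfolding slit_plane_def by auto
qed

lemma slit_plane_scale: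
  assumes "z \<in> slit_plane" "0 \<le> u" "u \<le> 1" shows "of_real u * z \<in> slit_plane"
  unfolding slit_plane_iff
proof
  assume *: "Re (of_real u * z) \<ge> 1 \<and> Im (of_real u * z) = 0"
  then have "u \<noteq> 0" "u * Re z \<ge> 1" by auto
  then have "Re z > 0" using assms(2) mult_nonneg_nonpos[of u "Re z"] by linarith
  then have "u * Re z \<le> 1 * Re z" using assms by (intro mult_right_mono) auto
  then show False using assms(1) * \<open>u \<noteq> 0\<close> \<open>u * Re z \<ge> 1\<close> by (auto simp: slit_plane_iff)
qed

text \<open>
  Convergence on the whole open disc makes convergence at each of its points absolute.
\<close>
lemma sums_unit_disc_has_sum:
  assumes "\<And>z. norm z < 1 \<Longrightarrow> (\<lambda>m. f m * z ^ m) sums F z" "norm (z::complex) < 1"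
  shows "((\<lambda>m. f m * z ^ m) has_sum F z) UNIV"
proof -
  obtain r where r: "norm z < r" "r < 1" using dense[OF assms(2)] by blast
  then have "r \<ge> 0" using norm_ge_zero[of z] by linarith
  then have "summable (\<lambda>m. f m * of_real r ^ m)"
    using assms(1)[of "of_real r"] r \<open>r \<ge> 0\<close> by (simp add: sums_iff)
  from powser_insidea[OF this, of z] r \<open>r \<ge> 0\<close> have "summable (\<lambda>m. norm (f m * z ^ m))" by simp
  from norm_summable_imp_has_sum[OF this assms(1)[OF assms(2)]] show ?thesis .
qed

lemma sums_deriv_unit_disc:
  assumes F: "\<And>z. norm z < 1 \<Longrightarrow> (\<lambda>m. f m * z ^ m) sums F z" and z: "norm (z::complex) < 1"
  shows "(\<lambda>n. diffs f n * z ^ n) sums deriv F z"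
proof -
  obtain r where r: "norm z < r" "r < 1" using dense[OF z] by blast
  then have r0: "r > 0" using norm_ge_zero[of z] by linarith
  have sr: "summable (\<lambda>m. f m * of_real r ^ m)"
    using F[of "of_real r"] r r0 by (auto simp: sums_iff)
  have D: "((\<lambda>x. \<Sum>n. f n * x ^ n) has_field_derivative (\<Sum>n. diffs f n * z ^ n)) (at z)"
    by (rule termdiffs_strong[OF sr]) (use r r0 in auto)
  have ev: "eventually (\<lambda>x. (\<Sum>n. f n * x ^ n) = F x) (nhds z)"
  proof -
    have "eventually (\<lambda>x. x \<in> ball 0 1) (nhds z)"
      using z by (intro eventually_nhds_in_open) auto
    then show ?thesis by eventually_elim (use F in \<open>auto simp: sums_iff\<close>)
  qed
  have "(F has_field_derivative (\<Sum>n. diffs f n * z ^ n)) (at z)"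
    using D DERIV_cong_ev[OF refl ev refl] by blast
  moreover have "summable (\<lambda>n. diffs f n * z ^ n)"
    by (rule termdiff_converges[of z 1 f]) (use z F in \<open>auto simp: sums_iff\<close>)
  ultimately show ?thesis by (simp add: sums_iff DERIV_imp_deriv)
qed

text \<open>
  On power series, multiplication of the coefficients by \<open>m + e\<close> is the operator \<open>z d/dz + e\<close>.
\<close>
lemma slit_continuable_theta:
  assumes "slit_continuable f"
  shows "slit_continuable (\<lambda>m. (of_nat m + e) * f m)"
proof -
  obtain F where F: "F holomorphic_on slit_plane"
    "\<And>z. norm z < 1 \<Longrightarrow> (\<lambda>m. f m * z ^ m) sums F z"
    using assms unfolding slit_continuable_def by blast
  have "(\<lambda>m. (of_nat m + e) * f m * z ^ m) sums (z * deriv F z + e * F z)" if z: "norm z < 1" for z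
  proof -
    from sums_mult[OF sums_deriv_unit_disc[OF F(2) z], of z]
    have "(\<lambda>n. of_nat (Suc n) * f (Suc n) * z ^ Suc n) sums (z * deriv F z)"
      by (simp add: diffs_def mult_ac)
    then have "(\<lambda>n. of_nat n * f n * z ^ n) sums (z * deriv F z)"
      by (subst (asm) sums_Suc_iff) simp
    from sums_add[OF this sums_mult[OF F(2)[OF z], of e]] show ?thesis
      by (simp add: algebra_simps)
  qed
  moreover have "(\<lambda>z. z * deriv F z + e * F z) holomorphic_on slit_plane"
    by (intro holomorphic_intros F open_slit_plane)
  ultimately show ?thesis unfolding slit_continuable_def by blast
qed

text \<open>
  The function \<open>(F z - F 0) / z\<close> has a removable singularity at the origin.
\<close>
lemma slit_continuable_tail:
  assumes "slit_continuable f"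
  shows "slit_continuable (\<lambda>m. f (Suc m))"
proof -
  obtain F where F: "F holomorphic_on slit_plane"
    "\<And>z. norm z < 1 \<Longrightarrow> (\<lambda>m. f m * z ^ m) sums F z"
    using assms unfolding slit_continuable_def by blast
  have F0: "F 0 = f 0" using F(2)[of 0] by (simp add: sums_iff)
  define G where "G z = (if z = 0 then deriv F 0 else F z / z - F 0 / (z - 0))" for z
  have holG: "G holomorphic_on slit_plane"
    unfolding G_def[abs_def] by (rule pole_theorem_open[OF F(1) open_slit_plane]) auto
  have Gz: "(\<lambda>m. f (Suc m) * z ^ m) sums G z" if z: "norm z < 1" "z \<noteq> 0" for z
  proof -
    have "(\<lambda>m. f (Suc m) * z ^ Suc m) sums (F z - F 0)"
      using F(2)[OF z(1)] by (subst sums_Suc_iff) (simp add: F0)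
    from sums_mult[OF this, of "1 / z"] show ?thesis using z by (simp add: G_def field_simps)
  qed
  have "diffs f 0 = deriv F 0"
    using sums_unique2[OF powser_sums_zero[of "diffs f"] sums_deriv_unit_disc[OF F(2), of 0]] by simp
  then have "G 0 = f 1" by (simp add: G_def diffs_def)
  then have "(\<lambda>m. f (Suc m) * z ^ m) sums G z" if "norm z < 1" for z
    using Gz[OF that] by (cases "z = 0") (auto simp: powser_sums_zero_iff)
  then show ?thesis using holG unfolding slit_continuable_def by blast
qed

lemma slit_continuable_cons:
  assumes "slit_continuable (\<lambda>m. f (Suc m))"
  shows "slit_continuable f"
proof -
  obtain F where F: "F holomorphic_on slit_plane"
    "\<And>z. norm z < 1 \<Longrightarrow> (\<lambda>m. f (Suc m) * z ^ m) sums F z"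
    using assms unfolding slit_continuable_def by blast
  have "(\<lambda>m. f m * z ^ m) sums (z * F z + f 0)" if "norm z < 1" for z
    using sums_mult[OF F(2)[OF that], of z] sums_Suc_iff[of "\<lambda>m. f m * z ^ m" "z * F z"]
    by (simp add: mult_ac)
  moreover have "(\<lambda>z. z * F z + f 0) holomorphic_on slit_plane"
    by (intro holomorphic_intros F)
  ultimately show ?thesis unfolding slit_continuable_def by blast
qed

lemma slit_continuable_cmult:
  assumes "slit_continuable f"
  shows "slit_continuable (\<lambda>m. c * f m)"
proof -
  obtain F where F: "F holomorphic_on slit_plane"
    "\<And>z. norm z < 1 \<Longrightarrow> (\<lambda>m. f m * z ^ m) sums F z"
    using assms unfolding slit_continuable_def by blast
  have "(\<lambda>m. c * f m * z ^ m) sums (c * F z)" if "norm z < 1" for z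
    using sums_mult[OF F(2)[OF that], of c] by (simp add: mult_ac)
  moreover have "(\<lambda>z. c * F z) holomorphic_on slit_plane"
    by (intro holomorphic_intros F)
  ultimately show ?thesis unfolding slit_continuable_def by blast
qed

lemma Beta_plus_of_nat:
  assumes "Re a > 0" "Re b > 0"
  shows "Beta (a + of_nat m) (b + of_nat l) =
    Beta a b * (pochhammer a m * pochhammer b l / pochhammer (a + b) (m + l) :: complex)"
proof -
  have nz: "Gamma z \<noteq> 0" if "Re z > 0" for z :: complex
    using Re_pos_not_nonpos_Ints[OF that] by (simp add: Gamma_eq_zero_iff)
  have P: "Gamma (z + of_nat n) = Gamma z * pochhammer z n" if "Re z > 0" for z :: complex and n
    using pochhammer_Gamma[OF Re_pos_not_nonpos_Ints[OF that], of n] nz[OF that] by (simp add: field_simps)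
  have "a + of_nat m + (b + of_nat l) = (a + b) + of_nat (m + l)" by simp
  then have "Gamma (a + of_nat m + (b + of_nat l)) = Gamma (a + b) * pochhammer (a + b) (m + l)"
    using P[of "a+b" "m+l"] assms by (simp only:) simp
  then show ?thesis
    unfolding Beta_def using assms P[of a m] P[of b l] by simp
qed

lemma of_real_powr_add_of_nat: "r > 0 \<Longrightarrow> of_real r powr (z + of_nat n - 1) = of_real r powr (z - 1) * (of_real r::complex) ^ n"
proof -
  assume r: "r > 0"
  have "z + of_nat n - 1 = (z - 1) + of_nat n" by simp
  then have "of_real r powr (z + of_nat n - 1) = of_real r powr (z - 1) * (of_real r powr of_nat n :: complex)"
    by (simp only: powr_add)
  then show ?thesis using r powr_nat'[of "complex_of_real r" n] by (simp only:) auto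
qed

lemma Beta_kernel_power:
  "Beta_kernel a b u * (of_real u ^ m * of_real (1 - u) ^ l) = Beta_kernel (a + of_nat m) (b + of_nat l) u"
proof (cases "u \<in> {0<..<1}")
  case True
  then have *: "of_real u powr (a + of_nat m - 1) = of_real u powr (a - 1) * (of_real u::complex) ^ m"
   "of_real (1-u) powr (b + of_nat l - 1) = of_real (1-u) powr (b - 1) * (of_real (1-u)::complex) ^ l"
    by (intro of_real_powr_add_of_nat; simp)+
  show ?thesis unfolding Beta_kernel_def *
    by (simp only: scaleR_conv_of_real mult_ac)
qed (simp add: Beta_kernel_def)

lemma Beta_nonzero: "Re a > 0 \<Longrightarrow> Re b > 0 \<Longrightarrow> Beta a b \<noteq> (0::complex)"
  using Re_pos_not_nonpos_Ints[of a] Re_pos_not_nonpos_Ints[of b] Re_pos_not_nonpos_Ints[of "a+b"]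
  by (simp add: Beta_def Gamma_eq_zero_iff)

text \<open>
  Euler's integral: averaging \<open>F (u z)\<close> over the beta distribution in \<open>u\<close> multiplies the \<open>m\<close>-th coefficient by
  \<open>(b)\<^sub>m / (e)\<^sub>m\<close>, and the slit plane is star-shaped about the origin.
\<close>
lemma slit_continuable_Beta_multiplier:
  assumes f: "slit_continuable f" and b: "Re b > 0" and e: "Re e > Re b"
  shows "slit_continuable (\<lambda>m. pochhammer b m / pochhammer e m * f m)"
proof -
  obtain F where F: "F holomorphic_on slit_plane"
    "\<And>z. norm z < 1 \<Longrightarrow> (\<lambda>m. f m * z ^ m) sums F z"
    using f unfolding slit_continuable_def by blast
  define G where "G z = (\<integral>u. Beta_kernel b (e - b) u * F (of_real u * z) \<partial>lborel) / Beta b (e - b)" for z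
  have nz: "Beta b (e - b) \<noteq> 0" by (rule Beta_nonzero) (use b e in auto)
  have "(\<lambda>z. \<integral>u. Beta_kernel b (e - b) u * F (of_real u * z) \<partial>lborel) holomorphic_on slit_plane"
  proof (rule holomorphic_on_integral_Beta_kernel)
    have sub: "(\<lambda>(u, z). of_real u * z) ` ({0..1} \<times> slit_plane) \<subseteq> slit_plane"
      using slit_plane_scale by auto
    have "continuous_on ({0..1} \<times> slit_plane) (\<lambda>x. F ((\<lambda>(u, z). of_real u * z) x))"
      by (rule continuous_on_compose2[OF holomorphic_on_imp_continuous_on[OF F(1)] _ sub])
         (auto simp: case_prod_unfold intro!: continuous_intros)
    then show "continuous_on ({0..1} \<times> slit_plane) (\<lambda>(u, z). F (of_real u * z))"
      by (simp add: case_prod_unfold)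
    show "(\<lambda>z. F (of_real u * z)) holomorphic_on slit_plane" if "0 < u" "u < 1" for u
      using that slit_plane_scale
      by (intro holomorphic_on_compose_gen[OF _ F(1), unfolded o_def] holomorphic_intros) auto
  qed (use b e open_slit_plane in auto)
  then have holG: "G holomorphic_on slit_plane"
    unfolding G_def[abs_def] by (intro holomorphic_intros nz) auto
  have "(\<lambda>m. pochhammer b m / pochhammer e m * f m * z ^ m) sums G z" if z: "norm z < 1" for z
  proof -
    let ?t = "\<lambda>m u. Beta_kernel (b + of_nat m) (e - b) u * (f m * z ^ m)"
    have t: "?t m u = Beta_kernel b (e - b) u * (f m * (of_real u * z) ^ m)" for m u
      using Beta_kernel_power[of b "e - b" u m 0] by (simp add: power_mult_distrib mult_ac)
    have abs: "(\<lambda>m. norm (f m * z ^ m)) summable_on UNIV"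
      by (rule has_sum_complex_abs[OF sums_unit_disc_has_sum[OF F(2) z]])
    have le: "norm (Beta_kernel (b + of_nat m) (e - b) u) \<le> norm (Beta_kernel b (e - b) u)" for m u
      by (auto simp: norm_Beta_kernel indicator_def intro!: mult_right_mono powr_mono')
    have sum: "((\<lambda>m. \<integral>u. ?t m u \<partial>lborel) has_sum (\<integral>u. Beta_kernel b (e - b) u * F (of_real u * z) \<partial>lborel)) UNIV"
    proof (rule has_sum_integral_countable)
      show "integrable lborel (?t m)" for m
        by (intro integrable_mult_left integrable_Beta_kernel) (use b e in auto)
      show "(\<lambda>m. \<integral>u. norm (?t m u) \<partial>lborel) summable_on UNIV"
      proof (rule summable_on_comparison_test)
        show "(\<lambda>m. Beta (Re b) (Re (e - b)) * norm (f m * z ^ m)) summable_on UNIV"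
          by (intro summable_on_cmult_right abs)
        fix m
        have "(\<integral>u. norm (?t m u) \<partial>lborel) = (\<integral>u. norm (Beta_kernel (b + of_nat m) (e - b) u) \<partial>lborel) * norm (f m * z ^ m)"
          by (simp add: norm_mult)
        also have "\<dots> \<le> (\<integral>u. norm (Beta_kernel b (e - b) u) \<partial>lborel) * norm (f m * z ^ m)"
          using le b e by (intro mult_right_mono integral_mono integrable_norm integrable_Beta_kernel) auto
        also have "\<dots> = Beta (Re b) (Re (e - b)) * norm (f m * z ^ m)"
          using b e by (subst integral_norm_Beta_kernel) auto
        finally show "(\<integral>u. norm (?t m u) \<partial>lborel) \<le> Beta (Re b) (Re (e - b)) * norm (f m * z ^ m)" .
      qed auto
      fix u :: real
      show "((\<lambda>m. ?t m u) has_sum Beta_kernel b (e - b) u * F (of_real u * z)) UNIV"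
      proof (cases "u \<in> {0<..<1}")
        case True
        then have "norm (of_real u * z) < 1"
          using z mult_left_le_one_le[of "norm z" u] by (simp add: norm_mult)
        then show ?thesis unfolding t
          by (intro has_sum_cmult_right sums_unit_disc_has_sum F)
      next
        case False
        then show ?thesis by (simp add: Beta_kernel_def)
      qed
    qed
    have "(\<integral>u. ?t m u \<partial>lborel) = Beta b (e - b) * (pochhammer b m / pochhammer e m * f m * z ^ m)" for m
      using Beta_plus_of_nat[of b "e - b" m 0] integral_Beta_kernel[of "b + of_nat m" "e - b"] b e
      by simp
    with sum have "((\<lambda>m. Beta b (e - b) * (pochhammer b m / pochhammer e m * f m * z ^ m)) has_sum
        Beta b (e - b) * G z) UNIV" using nz by (simp add: G_def)
    then have "((\<lambda>m. pochhammer b m / pochhammer e m * f m * z ^ m) has_sum G z) UNIV"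
      using nz by (subst (asm) has_sum_cmult_right_iff) auto
    then show ?thesis by (rule has_sum_imp_sums)
  qed
  then show ?thesis using holG unfolding slit_continuable_def by blast
qed

text \<open>
  The conditions \<open>0 < Re b < Re e\<close> of Euler's integral are removed by two reductions: the operator
  \<open>z d/dz + e\<close> leads from lower parameter \<open>e + 1\<close> to \<open>e\<close>, and splitting off the constant term leads from
  parameters \<open>b + 1\<close>, \<open>e + 1\<close> to \<open>b\<close>, \<open>e\<close>.
\<close>
lemma slit_continuable_pochhammer_quotient:
  assumes f: "slit_continuable f" and e: "Re e > 0"
  shows "slit_continuable (\<lambda>m. pochhammer b m / pochhammer e m * f m)"
proof -
  have pos: "slit_continuable (\<lambda>m. pochhammer b m / pochhammer e m * f m)"
    if "slit_continuable f" "Re b > 0" "Re e > 0" for f b e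
  proof -
    obtain j :: nat where "Re b < Re e + of_nat j"
      using reals_Archimedean2[of "Re b - Re e"] by (auto simp: algebra_simps)
    then show ?thesis using \<open>Re e > 0\<close>
    proof (induction j arbitrary: e)
      case 0
      then show ?case using slit_continuable_Beta_multiplier[OF that(1,2)] by simp
    next
      case (Suc j)
      have "slit_continuable (\<lambda>m. pochhammer b m / pochhammer (e + 1) m * f m)"
        by (rule Suc.IH) (use Suc.prems in auto)
      from slit_continuable_cmult[OF slit_continuable_theta[OF this, of e], of "1 / e"]
      have "slit_continuable (\<lambda>m. 1 / e * ((of_nat m + e) * (pochhammer b m / pochhammer (e + 1) m * f m)))" .
      also have "(\<lambda>m. 1 / e * ((of_nat m + e) * (pochhammer b m / pochhammer (e + 1) m * f m))) =
          (\<lambda>m. pochhammer b m / pochhammer e m * f m)"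
      proof
        fix m
        have "pochhammer e m * (e + of_nat m) = e * pochhammer (e + 1) m"
          using pochhammer_rec[of e m] pochhammer_Suc[of e m] by simp
        moreover have "e \<noteq> 0" "pochhammer e m \<noteq> 0" "pochhammer (e + 1) m \<noteq> 0"
          using Suc.prems by (auto intro!: pochhammer_nonzero)
        ultimately have "(of_nat m + e) / (e * pochhammer (e + 1) m) = 1 / pochhammer e m"
          by (metis add.commute mult.commute mult_eq_0_iff nonzero_divide_mult_cancel_right)
        then have "(of_nat m + e) / (e * pochhammer (e + 1) m) * (pochhammer b m * f m) =
            1 / pochhammer e m * (pochhammer b m * f m)" by (simp only:)
        then show "1 / e * ((of_nat m + e) * (pochhammer b m / pochhammer (e + 1) m * f m)) =
            pochhammer b m / pochhammer e m * f m" by simp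
      qed
      finally show ?case .
    qed
  qed
  obtain k :: nat where "- Re b < of_nat k"
    using reals_Archimedean2[of "- Re b"] by blast
  then have "Re b + of_nat k > 0" by simp
  then show ?thesis using f e
  proof (induction k arbitrary: b e f)
    case 0
    then show ?case using pos by simp
  next
    case (Suc k)
    have "slit_continuable (\<lambda>m. pochhammer (b + 1) m / pochhammer (e + 1) m * f (Suc m))"
      by (rule Suc.IH) (use Suc.prems slit_continuable_tail in auto)
    from slit_continuable_cmult[OF this, of "b / e"]
    have "slit_continuable (\<lambda>m. pochhammer b (Suc m) / pochhammer e (Suc m) * f (Suc m))"
      by (simp add: pochhammer_rec mult_ac)
    then show ?case by (rule slit_continuable_cons)
  qed
qed

lemma pochhammer_binomial_series:
  fixes z :: complex
  assumes "norm z < 1"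
  shows "(\<lambda>m. pochhammer a m / fact m * z ^ m) sums (1 - z) powr (- a)"
proof -
  have "(\<lambda>n. ((- a) gchoose n) * (- z) ^ n) sums (1 + (- z)) powr (- a)"
    using assms by (intro gen_binomial_complex) auto
  moreover have "((- a) gchoose n) * (- z) ^ n = pochhammer a n / fact n * z ^ n" for n
  proof -
    have "(- z) ^ n = (-1) ^ n * z ^ n" by (rule power_minus)
    moreover have "(-1) ^ n * (-1) ^ n = (1::complex)" by (simp flip: power_mult_distrib)
    ultimately show ?thesis unfolding gbinomial_pochhammer by (simp add: field_simps)
  qed
  ultimately show ?thesis by simp
qed

lemma slit_continuable_binomial: "slit_continuable (\<lambda>m. pochhammer a m / fact m)"
  unfolding slit_continuable_def
proof (intro exI conjI allI impI)
  show "(\<lambda>z. (1 - z) powr (- a)) holomorphic_on slit_plane"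
    by (intro holomorphic_intros) (auto simp: slit_plane_iff complex_nonpos_Reals_iff)
qed (rule pochhammer_binomial_series)

text \<open>
  The Gauss series arises from the binomial series by one Pochhammer quotient.
\<close>
lemma slit_continuable_2F1:
  assumes "Re e > 0"
  shows "slit_continuable (\<lambda>m. pochhammer a m * pochhammer b m / (pochhammer e m * fact m))"
  using slit_continuable_pochhammer_quotient[OF slit_continuable_binomial[of a] assms, of b]
  by (simp add: mult_ac)

section \<open>Finite hypergeometric identities\<close>

lemma sum_triangle_swap:
  fixes f :: "nat \<Rightarrow> nat \<Rightarrow> 'a::comm_monoid_add"
  shows "(\<Sum>k\<le>n. \<Sum>l\<le>k. f k l) = (\<Sum>l\<le>n. \<Sum>i\<le>n - l. f (l + i) l)"
proof -
  have "(\<Sum>k\<le>n. \<Sum>l\<le>k. f k l) = (\<Sum>(k,l)\<in>(SIGMA k:{..n}. {..k}). f k l)"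
    by (rule sum.Sigma) auto
  also have "\<dots> = (\<Sum>(l,i)\<in>(SIGMA l:{..n}. {..n - l}). f (l + i) l)"
    by (rule sum.reindex_bij_witness[of _ "\<lambda>(l,i). (l + i, l)" "\<lambda>(k,l). (l, k - l)"]) auto
  also have "\<dots> = (\<Sum>l\<le>n. \<Sum>i\<le>n - l. f (l + i) l)"
    by (rule sum.Sigma[symmetric]) auto
  finally show ?thesis .
qed

text \<open>
  The Chu-Vandermonde identity after reversing the factors of one of the two Pochhammer symbols.
\<close>
lemma pochhammer_diff_expand:
  fixes B b :: "'a::comm_ring_1"
  shows "pochhammer (B - b) k =
    (\<Sum>l\<le>k. of_nat (k choose l) * (-1) ^ l * pochhammer b l * pochhammer (B + of_nat l) (k - l))"
proof -
  have "pochhammer (B - b) k = pochhammer (- (b - B)) k" by simp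
  also have "\<dots> = (-1) ^ k * pochhammer (b + (1 - B - of_nat k)) k"
    by (subst pochhammer_minus) (simp add: algebra_simps)
  also have "\<dots> = (\<Sum>l\<le>k. (-1) ^ k * (of_nat (k choose l) * pochhammer b l * pochhammer (1 - B - of_nat k) (k - l)))"
    by (subst pochhammer_binomial_sum) (simp add: sum_distrib_left)
  also have "\<dots> = (\<Sum>l\<le>k. of_nat (k choose l) * (-1) ^ l * pochhammer b l * pochhammer (B + of_nat l) (k - l))"
  proof (rule sum.cong[OF refl])
    fix l assume "l \<in> {..k}"
    then have l: "l \<le> k" by simp
    have "pochhammer (1 - B - of_nat k) (k - l) = pochhammer (- (B + of_nat k - 1)) (k - l)"
      by (simp add: algebra_simps)
    also have "\<dots> = (-1) ^ (k - l) * pochhammer (B + of_nat l) (k - l)"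
      using l by (subst pochhammer_minus) (simp add: of_nat_diff algebra_simps)
    finally have *: "pochhammer (1 - B - of_nat k) (k - l) = (-1) ^ (k - l) * pochhammer (B + of_nat l) (k - l)" .
    have "(-1) ^ k * (-1) ^ (k - l) = (-1 :: 'a) ^ l"
      using l by (simp add: power_add[symmetric] minus_one_power_iff)
    then show "(-1) ^ k * (of_nat (k choose l) * pochhammer b l * pochhammer (1 - B - of_nat k) (k - l)) =
        of_nat (k choose l) * (-1) ^ l * pochhammer b l * pochhammer (B + of_nat l) (k - l)"
      unfolding * by (simp add: ac_simps flip: \<open>(-1) ^ k * (-1) ^ (k - l) = (-1 :: 'a) ^ l\<close>)
  qed
  finally show ?thesis .
qed

lemma pochhammer_split:
  assumes "l \<le> k" "k \<le> n"
  shows "pochhammer (B + of_nat l) (n - l) =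
     pochhammer (B + of_nat l) (k - l) * pochhammer (B + of_nat k) (n - k)"
proof -
  have "B + of_nat l + of_nat (k - l) = B + of_nat k"
    using assms by (metis add.assoc le_add_diff_inverse of_nat_add)
  then show ?thesis
    using pochhammer_product[of "k - l" "n - l" "B + of_nat l"] assms by simp
qed

text \<open>
  A transformation of terminating \<open>\<^sub>3F\<^sub>2\<close> series of Thomae's type, cleared of denominators so that it is a
  polynomial identity. Expand \<open>(B - b)\<^sub>k\<close> on the left, interchange the sums, and the inner sum becomes a
  Chu-Vandermonde sum for \<open>(A + l)\<^sub>n\<^sub>-\<^sub>l\<close>.
\<close>
lemma pochhammer_thomae:
  fixes a b A B :: "'a::comm_ring_1"
  shows "(\<Sum>k\<le>n. of_nat (n choose k) * pochhammer (A - a) (n - k) * pochhammer a k *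
             pochhammer (B - b) k * pochhammer (B + of_nat k) (n - k)) =
         (\<Sum>l\<le>n. (-1) ^ l * of_nat (n choose l) * pochhammer a l * pochhammer b l *
             pochhammer (A + of_nat l) (n - l) * pochhammer (B + of_nat l) (n - l))"
    (is "?L = ?R")
proof -
  have "?L = (\<Sum>k\<le>n. \<Sum>l\<le>k. of_nat (n choose k) * pochhammer (A - a) (n - k) * pochhammer a k *
       (of_nat (k choose l) * (-1) ^ l * pochhammer b l * pochhammer (B + of_nat l) (k - l)) *
       pochhammer (B + of_nat k) (n - k))"
    by (subst pochhammer_diff_expand[of B b]) (simp add: sum_distrib_left sum_distrib_right)
  also have "\<dots> = (\<Sum>k\<le>n. \<Sum>l\<le>k. (-1) ^ l * of_nat (n choose l) * pochhammer a l * pochhammer b l *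
       pochhammer (B + of_nat l) (n - l) *
       (of_nat ((n - l) choose (k - l)) * pochhammer (a + of_nat l) (k - l) * pochhammer (A - a) (n - k)))"
  proof (intro sum.cong refl, goal_cases)
    case (1 k l)
    then have kl: "l \<le> k" "k \<le> n" by auto
    have c: "of_nat (n choose k) * of_nat (k choose l) = (of_nat (n choose l) * of_nat ((n - l) choose (k - l)) :: 'a)"
      using choose_mult[OF kl] by (metis of_nat_mult)
    have p: "pochhammer a k = pochhammer a l * pochhammer (a + of_nat l) (k - l)"
      by (rule pochhammer_product[OF kl(1)])
    show ?case unfolding pochhammer_split[OF kl] p
      using arg_cong[OF c, of "\<lambda>x. x * (pochhammer (A - a) (n - k) * (pochhammer a l * pochhammer (a + of_nat l) (k - l)) *
       ((-1) ^ l * pochhammer b l * pochhammer (B + of_nat l) (k - l)) * pochhammer (B + of_nat k) (n - k))"]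
      by (simp add: ac_simps)
  qed
  also have "\<dots> = (\<Sum>l\<le>n. \<Sum>i\<le>n - l. (-1) ^ l * of_nat (n choose l) * pochhammer a l * pochhammer b l *
       pochhammer (B + of_nat l) (n - l) *
       (of_nat ((n - l) choose i) * pochhammer (a + of_nat l) i * pochhammer (A - a) (n - l - i)))"
    by (subst sum_triangle_swap) simp
  also have "\<dots> = (\<Sum>l\<le>n. (-1) ^ l * of_nat (n choose l) * pochhammer a l * pochhammer b l *
       pochhammer (B + of_nat l) (n - l) * pochhammer ((a + of_nat l) + (A - a)) (n - l))"
    by (subst pochhammer_binomial_sum) (simp add: sum_distrib_left)
  also have "\<dots> = ?R" by (intro sum.cong refl) (simp add: ac_simps)
  finally show ?thesis .
qed

text \<open>
  The balanced case \<open>b = A\<close> of the previous transformation: on its right-hand side the Pochhammer symbols of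
  \<open>b\<close> and \<open>A\<close> combine to a constant factor, and the remaining sum is again of Chu-Vandermonde type.
\<close>
lemma saalschuetz:
  fixes a b c :: "'a::comm_ring_1"
  shows "(\<Sum>k\<le>n. of_nat (n choose k) * pochhammer a k * pochhammer b k *
            pochhammer (c + of_nat k) (n - k) * pochhammer (c - a - b) (n - k)) =
         pochhammer (c - a) n * pochhammer (c - b) n"
proof -
  have "(\<Sum>k\<le>n. of_nat (n choose k) * pochhammer a k * pochhammer b k *
            pochhammer (c + of_nat k) (n - k) * pochhammer (c - a - b) (n - k)) =
      (\<Sum>k\<le>n. of_nat (n choose k) * pochhammer ((c - b) - a) (n - k) * pochhammer a k *
             pochhammer (c - (c - b)) k * pochhammer (c + of_nat k) (n - k))"
    by (intro sum.cong refl) (simp add: ac_simps diff_diff_eq)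
  also have "\<dots> = (\<Sum>l\<le>n. (-1) ^ l * of_nat (n choose l) * pochhammer a l * pochhammer (c - b) l *
             pochhammer (c - b + of_nat l) (n - l) * pochhammer (c + of_nat l) (n - l))"
    by (rule pochhammer_thomae)
  also have "\<dots> = (\<Sum>l\<le>n. pochhammer (c - b) n * (of_nat (n choose l) * (-1) ^ l * pochhammer a l *
             pochhammer (c + of_nat l) (n - l)))"
  proof (intro sum.cong refl, goal_cases)
    case (1 l)
    then have "pochhammer (c - b) n = pochhammer (c - b) l * pochhammer (c - b + of_nat l) (n - l)"
      by (intro pochhammer_product) auto
    then show ?case by (simp add: ac_simps)
  qed
  also have "\<dots> = pochhammer (c - b) n * pochhammer (c - a) n"
    by (subst pochhammer_diff_expand[of c a]) (simp add: sum_distrib_left)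
  finally show ?thesis by (simp add: mult.commute)
qed

section \<open>Growth of Pochhammer symbols\<close>

text \<open>
  Gauss's product for the reciprocal Gamma function with \<open>n + 1\<close> in place of \<open>n\<close>; the weight then never
  vanishes, and the bounds below hold for all \<open>n\<close>, including \<open>n = 0\<close>.
\<close>
lemma pochhammer_asymp:
  fixes z :: complex
  shows "(\<lambda>n. pochhammer z n / (fact n * of_nat (Suc n) powr (z - 1))) \<longlonglongrightarrow> rGamma z"
proof -
  have "(\<lambda>n. exp (z * of_real (ln (real n) - ln (real n + 2))) * of_real ((real n + 2) / (real n + 1)))
      \<longlonglongrightarrow> exp (z * of_real 0) * of_real 1"
  proof (intro tendsto_intros)
    show "(\<lambda>n. ln (real n) - ln (real n + 2)) \<longlonglongrightarrow> 0" by real_asymp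
    show "(\<lambda>n. (real n + 2) / (real n + 1)) \<longlonglongrightarrow> 1" by real_asymp
  qed
  from tendsto_mult[OF rGamma_series_LIMSEQ[of z] this]
  have "(\<lambda>n. rGamma_series z n * (exp (z * of_real (ln (real n) - ln (real n + 2))) *
      of_real ((real n + 2) / (real n + 1)))) \<longlonglongrightarrow> rGamma z" by simp
  moreover have "eventually (\<lambda>n. rGamma_series z n * (exp (z * of_real (ln (real n) - ln (real n + 2))) *
      of_real ((real n + 2) / (real n + 1))) =
      pochhammer z (Suc n) / (fact (Suc n) * of_nat (Suc (Suc n)) powr (z - 1))) sequentially"
    using eventually_gt_at_top[of 0]
  proof eventually_elim
    case (elim n)
    have e: "exp (z * of_real (ln (real n) - ln (real n + 2))) =
        exp (z * of_real (ln (real n))) / exp (z * of_real (ln (real n + 2)))"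
      by (simp add: right_diff_distrib exp_diff)
    have "of_nat (Suc (Suc n)) powr (z - 1) = (of_real (real n + 2) powr (z - 1) :: complex)"
      by (simp add: add.commute)
    also have "\<dots> = exp ((z - 1) * of_real (ln (real n + 2)))"
      by (simp add: powr_def Ln_of_real del: of_real_add)
    also have "\<dots> = exp (z * of_real (ln (real n + 2))) / of_real (exp (ln (real n + 2)))"
      by (simp only: left_diff_distrib exp_diff mult_1 exp_of_real)
    also have "exp (ln (real n + 2)) = real n + 2" by simp
    finally have p: "of_nat (Suc (Suc n)) powr (z - 1) = exp (z * of_real (ln (real n + 2))) / (of_real (real n + 2) :: complex)" .
    have nz: "of_nat n + 1 \<noteq> (0::complex)" "of_nat n + 2 \<noteq> (0::complex)"
      by (auto simp: complex_eq_iff)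
    have cancel: "P / (f * x) * (x / y * (v / u)) = P / (u * f * (y / v))"
      if "x \<noteq> 0" "y \<noteq> 0" "u \<noteq> 0" "v \<noteq> 0" for P f x y u v :: complex
      using that by (cases "f = 0") (simp_all add: field_simps)
    have "fact (Suc n) = (of_nat n + 1) * (fact n :: complex)" by (simp add: algebra_simps)
    moreover have "complex_of_real ((real n + 2) / (real n + 1)) = (of_nat n + 2) / (of_nat n + 1)"
      "complex_of_real (real n + 2) = of_nat n + 2" "complex_of_real (ln (real n)) = of_real (ln (of_nat n))" by simp_all
    ultimately show ?case using cancel[OF exp_not_eq_zero exp_not_eq_zero nz] unfolding e p rGamma_series_def
      by (simp only: Suc_eq_plus1)
  qed
  ultimately have "(\<lambda>n. pochhammer z (Suc n) / (fact (Suc n) * of_nat (Suc (Suc n)) powr (z - 1))) \<longlonglongrightarrow> rGamma z"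
    by (rule Lim_transform_eventually)
  then show ?thesis by (rule LIMSEQ_imp_Suc)
qed

lemma pochhammer_weight_nonzero: "fact n * of_nat (Suc n) powr z \<noteq> (0::complex)"
  by (simp del: of_nat_Suc)

lemma norm_pochhammer_weight:
  "norm (fact n * of_nat (Suc n) powr z :: complex) = fact n * real (Suc n) powr Re z"
proof -
  have "norm (of_nat (Suc n) powr z :: complex) = real (Suc n) powr Re z"
    by (subst norm_powr_real_powr) (auto simp del: of_nat_Suc)
  then show ?thesis by (simp add: norm_mult del: of_nat_Suc)
qed

text \<open>
  If \<open>c\<close> is no pole of Gamma, this is the previous asymptotics for \<open>rGamma c / (c)\<^sub>n\<close>. The poles are reached by
  downward induction on the real part.
\<close>
lemma rGamma_shift_asymp:
  fixes c :: complex
  shows "(\<lambda>n. fact n * of_nat (Suc n) powr (c - 1) * rGamma (c + of_nat n)) \<longlonglongrightarrow> 1"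
proof -
  obtain M :: nat where "- Re c < of_nat M" using reals_Archimedean2[of "- Re c"] by blast
  then show ?thesis
  proof (induction M arbitrary: c)
    case 0
    then have c: "c \<notin> \<int>\<^sub>\<le>\<^sub>0" by (auto elim!: nonpos_Ints_cases)
    then have r: "rGamma c \<noteq> 0" by (simp add: rGamma_eq_zero_iff)
    have "(\<lambda>n. rGamma c / (pochhammer c n / (fact n * of_nat (Suc n) powr (c - 1)))) \<longlonglongrightarrow> rGamma c / rGamma c"
      by (intro tendsto_intros pochhammer_asymp r)
    moreover have "rGamma c / (pochhammer c n / (fact n * of_nat (Suc n) powr (c - 1))) =
        fact n * of_nat (Suc n) powr (c - 1) * rGamma (c + of_nat n)" for n
    proof -
      have "pochhammer c n \<noteq> 0" using c pochhammer_eq_0_imp_nonpos_Int by blast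
      then show ?thesis by (simp add: pochhammer_rGamma[of c n] del: of_nat_Suc)
    qed
    ultimately show ?case using r by simp
  next
    case (Suc M)
    have "(\<lambda>n. fact n * of_nat (Suc n) powr (c + 1 - 1) * rGamma (c + 1 + of_nat n)) \<longlonglongrightarrow> 1"
      by (rule Suc.IH) (use Suc.prems in auto)
    moreover have "(\<lambda>n. 1 + (c - 1) * of_real (1 / real (Suc n))) \<longlonglongrightarrow> 1 + (c - 1) * of_real 0"
      by (intro tendsto_intros LIMSEQ_Suc[OF lim_1_over_n])
    ultimately have "(\<lambda>n. (fact n * of_nat (Suc n) powr (c + 1 - 1) * rGamma (c + 1 + of_nat n)) *
        (1 + (c - 1) * of_real (1 / real (Suc n)))) \<longlonglongrightarrow> 1 * (1 + (c - 1) * of_real 0)"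
      by (rule tendsto_mult)
    moreover have eq: "(fact n * of_nat (Suc n) powr (c + 1 - 1) * rGamma (c + 1 + of_nat n)) *
        (1 + (c - 1) * of_real (1 / real (Suc n))) =
        fact n * of_nat (Suc n) powr (c - 1) * rGamma (c + of_nat n)" for n
    proof -
      have nz: "of_nat (Suc n) \<noteq> (0::complex)" by (simp del: of_nat_Suc)
      have "rGamma (c + of_nat n) = (c + of_nat n) * rGamma (c + 1 + of_nat n)"
        using rGamma_plus1[of "c + of_nat n"] by (simp add: add_ac)
      moreover have "of_nat (Suc n) powr (c + 1 - 1) = of_nat (Suc n) powr (c - 1) * (of_nat (Suc n) :: complex)"
        using powr_add[of "of_nat (Suc n)" "c - 1" 1] nz by (simp del: of_nat_Suc)
      moreover have "of_nat (Suc n) * (1 + (c - 1) * of_real (1 / real (Suc n))) = c + of_nat n"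
        using nz by (simp add: field_simps)
      ultimately have "fact n * of_nat (Suc n) powr (c - 1) * rGamma (c + of_nat n) = fact n *
          of_nat (Suc n) powr (c - 1) * (of_nat (Suc n) * (1 + (c - 1) * of_real (1 / real (Suc n))) * rGamma (c + 1 + of_nat n))"
        "of_nat (Suc n) powr (c + 1 - 1) = of_nat (Suc n) powr (c - 1) * (of_nat (Suc n) :: complex)"
        by simp_all
      then show ?thesis by (simp only: ac_simps)
    qed
    ultimately show ?case unfolding eq by simp
  qed
qed

lemma pochhammer_upper_bound:
  fixes z :: complex
  shows "\<exists>C>0. \<forall>n. norm (pochhammer z n) \<le> C * (fact n * real (Suc n) powr (Re z - 1))"
proof -
  have "Bseq (\<lambda>n. pochhammer z n / (fact n * of_nat (Suc n) powr (z - 1)))"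
    by (rule convergent_imp_Bseq) (use pochhammer_asymp in \<open>auto simp: convergent_def\<close>)
  then obtain C where C: "C > 0" "\<And>n. norm (pochhammer z n / (fact n * of_nat (Suc n) powr (z - 1))) \<le> C"
    by (auto simp: Bseq_def)
  have "norm (pochhammer z n) \<le> C * (fact n * real (Suc n) powr (Re z - 1))" for n
    using C(2)[of n] unfolding norm_divide norm_pochhammer_weight
    by (simp add: pos_divide_le_eq del: of_nat_Suc)
  then show ?thesis using C(1) by blast
qed

lemma pochhammer_lower_bound:
  fixes z :: complex
  assumes z: "z \<notin> \<int>\<^sub>\<le>\<^sub>0"
  shows "\<exists>C>0. \<forall>n. fact n * real (Suc n) powr (Re z - 1) \<le> C * norm (pochhammer z n)"
proof -
  have "(\<lambda>n. inverse (pochhammer z n / (fact n * of_nat (Suc n) powr (z - 1)))) \<longlonglongrightarrow> inverse (rGamma z)"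
    by (intro tendsto_intros pochhammer_asymp) (use z in \<open>simp add: rGamma_eq_zero_iff\<close>)
  then have "Bseq (\<lambda>n. inverse (pochhammer z n / (fact n * of_nat (Suc n) powr (z - 1))))"
    by (intro convergent_imp_Bseq) (auto simp: convergent_def)
  then obtain C where C: "C > 0"
    "\<And>n. norm (inverse (pochhammer z n / (fact n * of_nat (Suc n) powr (z - 1)))) \<le> C"
    by (auto simp: Bseq_def)
  have "fact n * real (Suc n) powr (Re z - 1) \<le> C * norm (pochhammer z n)" for n
  proof -
    have "norm (pochhammer z n) > 0" using z pochhammer_eq_0_imp_nonpos_Int by auto
    moreover have "(fact n * real (Suc n) powr (Re z - 1)) / norm (pochhammer z n) \<le> C"
      using C(2)[of n] unfolding norm_inverse norm_divide norm_pochhammer_weight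
      by (simp add: field_simps del: of_nat_Suc)
    ultimately show ?thesis by (simp add: pos_divide_le_eq)
  qed
  then show ?thesis using C(1) by blast
qed

lemma rGamma_shift_bound:
  fixes c :: complex
  shows "\<exists>C>0. \<forall>n. norm (rGamma (c + of_nat n)) \<le> C / (fact n * real (Suc n) powr (Re c - 1))"
proof -
  have "Bseq (\<lambda>n. fact n * of_nat (Suc n) powr (c - 1) * rGamma (c + of_nat n))"
    by (rule convergent_imp_Bseq) (use rGamma_shift_asymp in \<open>auto simp: convergent_def\<close>)
  then obtain C where C: "C > 0" "\<And>n. norm (fact n * of_nat (Suc n) powr (c - 1) * rGamma (c + of_nat n)) \<le> C"
    by (auto simp: Bseq_def)
  have "norm (rGamma (c + of_nat n)) \<le> C / (fact n * real (Suc n) powr (Re c - 1))" for n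
    using C(2)[of n] unfolding norm_mult[of _ "rGamma _"] norm_pochhammer_weight
    by (simp add: pos_le_divide_eq mult_ac del: of_nat_Suc)
  then show ?thesis using C(1) by blast
qed

text \<open>
  Formally \<open>(z + k)\<^sub>j\<close> is \<open>(z)\<^sub>k\<^sub>+\<^sub>j / (z)\<^sub>k\<close>, but the denominator may vanish. Moving \<open>z\<close> away from the real axis only
  increases the absolute value of every factor and makes the denominator nonzero.
\<close>
lemma pochhammer_shift_bound:
  fixes z :: complex
  shows "\<exists>C>0. \<forall>k j. norm (pochhammer (z + of_nat k) j) \<le>
     C * (fact (k + j) * real (Suc (k + j)) powr (Re z - 1)) / (fact k * real (Suc k) powr (Re z - 1))"
proof -
  \<comment> \<open>same real part, but a nonzero imaginary part that is larger in absolute value\<close>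
  define w where "w = Complex (Re z) (\<bar>Im z\<bar> + 1)"
  have w: "w \<notin> \<int>\<^sub>\<le>\<^sub>0" by (auto simp: w_def elim!: nonpos_Ints_cases simp: complex_eq_iff)
  obtain C1 where C1: "C1 > 0" "\<And>n. norm (pochhammer w n) \<le> C1 * (fact n * real (Suc n) powr (Re w - 1))"
    using pochhammer_upper_bound[of w] by blast
  obtain C2 where C2: "C2 > 0" "\<And>n. fact n * real (Suc n) powr (Re w - 1) \<le> C2 * norm (pochhammer w n)"
    using pochhammer_lower_bound[OF w] by blast
  have le: "norm (pochhammer (z + of_nat k) j) \<le> norm (pochhammer (w + of_nat k) j)" for k j
  proof -
    have "norm (z + of_nat k + of_nat i) \<le> norm (w + of_nat k + of_nat i)" for i
    proof -
      have "(Im z)\<^sup>2 \<le> (\<bar>Im z\<bar> + 1)\<^sup>2" by (subst abs_le_square_iff[symmetric]) simp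
      then show ?thesis unfolding cmod_def by (intro real_sqrt_le_mono) (simp add: w_def)
    qed
    then show ?thesis unfolding pochhammer_prod prod_norm[symmetric] by (intro prod_mono) auto
  qed
  have "norm (pochhammer (z + of_nat k) j) \<le>
     C1 * C2 * (fact (k + j) * real (Suc (k + j)) powr (Re z - 1)) / (fact k * real (Suc k) powr (Re z - 1))" for k j
  proof -
    have nz: "norm (pochhammer w k) > 0" using w pochhammer_eq_0_imp_nonpos_Int by auto
    have pos: "fact k * real (Suc k) powr (Re z - 1) > 0" by simp
    have "norm (pochhammer (w + of_nat k) j) = norm (pochhammer w (k + j)) / norm (pochhammer w k)"
      using nz by (simp add: pochhammer_product' norm_mult)
    also have "\<dots> \<le> (C1 * (fact (k + j) * real (Suc (k + j)) powr (Re z - 1))) / 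
        ((fact k * real (Suc k) powr (Re z - 1)) / C2)"
    proof (rule frac_le)
      show "norm (pochhammer w (k + j)) \<le> C1 * (fact (k + j) * real (Suc (k + j)) powr (Re z - 1))"
        using C1(2)[of "k + j"] by (simp add: w_def)
      show "fact k * real (Suc k) powr (Re z - 1) / C2 \<le> norm (pochhammer w k)"
        using C2(2)[of k] \<open>C2 > 0\<close> by (simp add: w_def pos_divide_le_eq mult.commute)
    qed (use pos C1(1) C2(1) in auto)
    finally show ?thesis using le[of k j] C2(1) by (simp add: mult_ac)
  qed
  then show ?thesis using C1(1) C2(1) by (intro exI[of _ "C1 * C2"]) auto
qed

section \<open>Gauss's summation theorem\<close>

lemma gauss_term_bound:
  fixes a b c :: complex
  shows "\<exists>C>0. \<forall>k. norm (pochhammer a k * pochhammer b k / fact k * rGamma (c + of_nat k)) \<le>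
     C * real (Suc k) powr (Re (a + b - c) - 1)"
proof -
  obtain C1 where C1: "C1 > 0" "\<And>n. norm (pochhammer a n) \<le> C1 * (fact n * real (Suc n) powr (Re a - 1))"
    using pochhammer_upper_bound[of a] by blast
  obtain C2 where C2: "C2 > 0" "\<And>n. norm (pochhammer b n) \<le> C2 * (fact n * real (Suc n) powr (Re b - 1))"
    using pochhammer_upper_bound[of b] by blast
  obtain C3 where C3: "C3 > 0" "\<And>n. norm (rGamma (c + of_nat n)) \<le> C3 / (fact n * real (Suc n) powr (Re c - 1))"
    using rGamma_shift_bound[of c] by blast
  have "norm (pochhammer a k * pochhammer b k / fact k * rGamma (c + of_nat k)) \<le>
     C1 * C2 * C3 * real (Suc k) powr (Re (a + b - c) - 1)" for k
  proof -
    have "norm (pochhammer a k * pochhammer b k / fact k * rGamma (c + of_nat k)) =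
        norm (pochhammer a k) * norm (pochhammer b k) / fact k * norm (rGamma (c + of_nat k))"
      by (simp add: norm_mult norm_divide)
    also have "\<dots> \<le> (C1 * (fact k * real (Suc k) powr (Re a - 1))) * (C2 * (fact k * real (Suc k) powr (Re b - 1))) / fact k *
        (C3 / (fact k * real (Suc k) powr (Re c - 1)))"
      using C1 C2 C3 by (intro mult_mono divide_right_mono) (auto intro!: mult_nonneg_nonneg less_imp_le)
    also have "\<dots> = C1 * C2 * C3 * (real (Suc k) powr (Re a - 1) * real (Suc k) powr (Re b - 1) / real (Suc k) powr (Re c - 1))"
      by simp
    also have "real (Suc k) powr (Re a - 1) * real (Suc k) powr (Re b - 1) / real (Suc k) powr (Re c - 1) =
        real (Suc k) powr (Re (a + b - c) - 1)"
      by (simp add: powr_add[symmetric] powr_diff[symmetric] algebra_simps del: of_nat_Suc)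
    finally show ?thesis .
  qed
  then show ?thesis using C1(1) C2(1) C3(1) by (intro exI[of _ "C1 * C2 * C3"]) auto
qed

lemma summable_Suc_powr: "s < -1 \<Longrightarrow> summable (\<lambda>k. real (Suc k) powr s)"
  using summable_Suc_iff[of "\<lambda>n. real n powr s"] summable_real_powr_iff[of s] by simp

lemma gauss_summable:
  fixes a b c :: complex
  assumes "Re (c - a - b) > 0"
  shows "summable (\<lambda>k. norm (pochhammer a k * pochhammer b k / fact k * rGamma (c + of_nat k)))"
proof -
  obtain C where C: "\<And>k. norm (pochhammer a k * pochhammer b k / fact k * rGamma (c + of_nat k)) \<le>
     C * real (Suc k) powr (Re (a + b - c) - 1)" using gauss_term_bound by blast
  have "summable (\<lambda>k. C * real (Suc k) powr (Re (a + b - c) - 1))"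
    using assms by (intro summable_mult summable_Suc_powr) auto
  then show ?thesis by (rule summable_comparison_test'[where N = 0]) (use C in auto)
qed

text \<open>
  The difference of the two sides is a telescoping series: with \<open>t c k\<close> as below, the \<open>k\<close>-th term of the
  difference equals \<open>k t c k - (k+1) t c (k+1)\<close>, and \<open>k t c k\<close> tends to \<open>0\<close>.
\<close>
lemma gauss_contiguous:
  fixes a b c :: complex
  assumes s: "Re (c - a - b) > 0"
  defines "t \<equiv> \<lambda>c k. pochhammer a k * pochhammer b k / fact k * rGamma (c + of_nat k)"
  shows "(c - a - b) * (\<Sum>k. t c k) = (c - a) * (c - b) * (\<Sum>k. t (c + 1) k)"
proof -
  have sm: "summable (t c)" "summable (t (c + 1))"
    using s unfolding t_def by (intro summable_norm_cancel[OF gauss_summable]; simp)+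
  have step: "(c - a - b) * t c k - (c - a) * (c - b) * t (c + 1) k = of_nat k * t c k - of_nat (Suc k) * t c (Suc k)" for k
  proof -
    define u where "u = pochhammer a k * pochhammer b k / fact k * rGamma (c + of_nat k + 1)"
    have 1: "t (c + 1) k = u" by (simp add: t_def u_def add_ac)
    have 2: "t c k = (c + of_nat k) * u"
      unfolding t_def u_def by (subst rGamma_plus1[of "c + of_nat k", symmetric]) simp
    have 3: "of_nat (Suc k) * t c (Suc k) = (a + of_nat k) * (b + of_nat k) * u"
    proof -
      have "of_nat (Suc k) \<noteq> (0::complex)" by (simp del: of_nat_Suc)
      then have "of_nat (Suc k) * (x / (of_nat (Suc k) * fact k)) = x / fact k" for x :: complex
        by (simp del: of_nat_Suc)
      then show ?thesis unfolding t_def u_def pochhammer_Suc fact_Suc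
        by (simp add: add_ac mult_ac del: of_nat_Suc) (simp add: add_ac mult_ac)
    qed
    show ?thesis unfolding 1 2 3 by (simp add: algebra_simps)
  qed
  have lim: "(\<lambda>k. of_nat k * t c k) \<longlonglongrightarrow> 0"
  proof -
    obtain C where C: "\<And>k. norm (t c k) \<le> C * real (Suc k) powr (Re (a + b - c) - 1)"
      unfolding t_def using gauss_term_bound by blast
    have "(\<lambda>k. real k * (C * real (Suc k) powr (Re (a + b - c) - 1))) \<longlonglongrightarrow> 0"
    proof -
      define e where "e = Re (c - a - b)"
      have "e > 0" using s by (simp add: e_def)
      then have "(\<lambda>k. real k * (C * (real k + 1) powr (- e - 1))) \<longlonglongrightarrow> 0"
        by real_asymp
      then show ?thesis by (simp add: e_def add.commute algebra_simps)
    qed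
    then show ?thesis
      by (rule Lim_null_comparison[rotated]) (use C in \<open>auto intro!: always_eventually mult_left_mono simp: norm_mult\<close>)
  qed
  have "(\<lambda>k. of_nat k * t c k - of_nat (Suc k) * t c (Suc k)) sums (of_nat 0 * t c 0 - 0)"
    by (rule telescope_sums'[OF lim])
  then have "(\<lambda>k. (c - a - b) * t c k - (c - a) * (c - b) * t (c + 1) k) sums 0"
    by (simp add: step)
  moreover have "(\<lambda>k. (c - a - b) * t c k - (c - a) * (c - b) * t (c + 1) k) sums
      ((c - a - b) * (\<Sum>k. t c k) - (c - a) * (c - b) * (\<Sum>k. t (c + 1) k))"
    by (intro sums_diff sums_mult summable_sums sm)
  ultimately have "0 = (c - a - b) * (\<Sum>k. t c k) - (c - a) * (c - b) * (\<Sum>k. t (c + 1) k)"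
    by (rule sums_unique2)
  then show ?thesis by simp
qed

lemma gauss_iterate:
  fixes a b c :: complex
  assumes s: "Re (c - a - b) > 0"
  defines "G \<equiv> \<lambda>c. \<Sum>k. pochhammer a k * pochhammer b k / fact k * rGamma (c + of_nat k)"
  shows "pochhammer (c - a - b) n * G c = pochhammer (c - a) n * pochhammer (c - b) n * G (c + of_nat n)"
proof (induction n)
  case (Suc n)
  have "pochhammer (c - a - b) (Suc n) * G c = (c - a - b + of_nat n) * (pochhammer (c - a - b) n * G c)"
    by (simp add: pochhammer_Suc mult_ac)
  also have "\<dots> = pochhammer (c - a) n * pochhammer (c - b) n * ((c + of_nat n - a - b) * G (c + of_nat n))"
    unfolding Suc by (simp add: algebra_simps)
  also have "(c + of_nat n - a - b) * G (c + of_nat n) = (c + of_nat n - a) * (c + of_nat n - b) * G (c + of_nat n + 1)"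
    unfolding G_def by (rule gauss_contiguous) (use s in simp)
  also have "pochhammer (c - a) n * pochhammer (c - b) n * \<dots> =
      pochhammer (c - a) (Suc n) * pochhammer (c - b) (Suc n) * G (c + of_nat (Suc n))"
    by (simp add: pochhammer_Suc algebra_simps)
  finally show ?case .
qed (simp add: G_def)

text \<open>
  As \<open>n\<close> grows, every term but the first of the series divided by \<open>rGamma (c + n)\<close> tends to \<open>0\<close>, so that Tannery's
  theorem gives the limit \<open>1\<close>.
\<close>
lemma gauss_limit:
  fixes a b c :: complex
  shows "(\<lambda>n. fact n * of_nat (Suc n) powr (c - 1) *
     (\<Sum>k. pochhammer a k * pochhammer b k / fact k * rGamma (c + of_nat n + of_nat k))) \<longlonglongrightarrow> 1"
proof -
  \<comment> \<open>so large that the series with lower parameter \<open>X = Re c + n0\<close> converges absolutely and dominates\<close>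
  obtain n0 :: nat where n0: "\<bar>Re c\<bar> + \<bar>Re (a + b - c)\<bar> + 1 < of_nat n0"
    using reals_Archimedean2 by blast
  define X where "X = complex_of_real (Re c + of_nat n0)"
  have X: "Re X > 0" "Re (X - a - b) > 0" using n0 by (auto simp: X_def)
  have Xk: "rGamma X \<noteq> 0" using X(1) by (auto simp: rGamma_eq_zero_iff elim!: nonpos_Ints_cases)
  define T where "T k n = pochhammer a k * pochhammer b k / fact k / pochhammer (c + of_nat n) k" for k n
  have lim: "(\<lambda>n. T k n) \<longlonglongrightarrow> (if k = 0 then 1 else 0)" for k
  proof (cases k)
    case (Suc j)
    have "filterlim (\<lambda>n. norm (pochhammer (c + of_nat n) k)) at_top sequentially"
    proof (rule filterlim_at_top_mono)
      show "filterlim (\<lambda>n. real n - norm c) at_top sequentially" by real_asymp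
      obtain n1 :: nat where n1: "norm c + 1 < of_nat n1" using reals_Archimedean2 by blast
      show "eventually (\<lambda>n. real n - norm c \<le> norm (pochhammer (c + of_nat n) k)) sequentially"
        using eventually_ge_at_top[of n1]
      proof eventually_elim
        case (elim n)
        have ge: "real n - norm c \<le> norm (c + of_nat n + of_nat i)" for i
          using norm_triangle_ineq2[of "of_nat (n + i)" "- c"] by (simp add: add_ac norm_of_nat del: of_nat_add) simp
        have "1 \<le> norm (c + of_nat n + of_nat i)" for i using ge[of i] elim n1 by linarith
        then have "1 \<le> (\<Prod>i<j. norm (c + of_nat n + of_nat (Suc i)))" by (intro prod_ge_1) (simp del: of_nat_Suc)
        then have "(real n - norm c) * 1 \<le> norm (c + of_nat n) * (\<Prod>i<j. norm (c + of_nat n + of_nat (Suc i)))"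
          using ge[of 0] by (intro mult_mono) auto
        also have "\<dots> = norm (pochhammer (c + of_nat n) k)"
          unfolding Suc pochhammer_prod prod_norm[symmetric] atLeast0LessThan
          by (subst prod.lessThan_Suc_shift) (simp add: o_def)
        finally show ?case by simp
      qed
    qed
    then have "filterlim (\<lambda>n. pochhammer (c + of_nat n) k) at_infinity sequentially"
      by (simp add: filterlim_at_infinity_conv_norm_at_top)
    from tendsto_divide_0[OF tendsto_const[of "pochhammer a k * pochhammer b k / fact k"] this]
    show ?thesis using Suc by (simp only: T_def if_False nat.simps)
  qed (simp add: T_def)
  have dom: "norm (T k n) \<le> norm (pochhammer a k * pochhammer b k / fact k * rGamma (X + of_nat k)) / norm (rGamma X)"
    if "n \<ge> n0" for k n
  proof -
    have "norm (pochhammer X k) \<le> norm (pochhammer (c + of_nat n) k)"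
      unfolding pochhammer_prod prod_norm[symmetric]
    proof (intro prod_mono conjI)
      fix i
      have "norm (X + of_nat i) = \<bar>Re X + real i\<bar>"
        unfolding X_def by (metis Re_complex_of_real norm_of_real of_real_add of_real_of_nat_eq)
      also have "\<dots> \<le> \<bar>Re (c + of_nat n + of_nat i)\<bar>" using X(1) that by (simp add: X_def)
      finally show "norm (X + of_nat i) \<le> norm (c + of_nat n + of_nat i)"
        using abs_Re_le_cmod order.trans by blast
    qed auto
    moreover have "norm (pochhammer X k) > 0"
      using X(1) pochhammer_eq_0_imp_nonpos_Int by (fastforce elim!: nonpos_Ints_cases)
    ultimately have "norm (T k n) \<le> norm (pochhammer a k * pochhammer b k / fact k) / norm (pochhammer X k)"
      unfolding T_def norm_divide[of _ "pochhammer (c + of_nat n) k"] by (intro divide_left_mono mult_pos_pos) auto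
    also have "1 / norm (pochhammer X k) = norm (rGamma (X + of_nat k)) / norm (rGamma X)"
      using pochhammer_rGamma[of X k] Xk by (auto simp: norm_mult)
    then have "norm (pochhammer a k * pochhammer b k / fact k) / norm (pochhammer X k) =
      norm (pochhammer a k * pochhammer b k / fact k * rGamma (X + of_nat k)) / norm (rGamma X)"
      by (metis (no_types, lifting) mult.right_neutral norm_mult times_divide_eq_right)
    finally show ?thesis .
  qed
  have "(\<lambda>n. \<Sum>k. T k n) \<longlonglongrightarrow> (\<Sum>k. if k = 0 then 1 else 0)"
  proof (rule tannerys_theorem[THEN conjunct2, THEN conjunct2])
    show "eventually (\<lambda>(k, n). norm (T k n) \<le>
        norm (pochhammer a k * pochhammer b k / fact k * rGamma (X + of_nat k)) / norm (rGamma X))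
        (at_top \<times>\<^sub>F sequentially)"
      unfolding eventually_prod_filter
      using dom by (intro exI[of _ "\<lambda>_. True"] exI[of _ "\<lambda>n. n \<ge> n0"]) (auto simp: eventually_ge_at_top)
    show "summable (\<lambda>k. norm (pochhammer a k * pochhammer b k / fact k * rGamma (X + of_nat k)) / norm (rGamma X))"
      by (intro summable_divide gauss_summable X)
  qed (use lim in auto)
  moreover have "(\<Sum>k. if k = 0 then 1 else 0 :: complex) = 1"
    using sums_single[of 0 "\<lambda>_. 1 :: complex"] by (simp add: sums_iff)
  ultimately have "(\<lambda>n. (fact n * of_nat (Suc n) powr (c - 1) * rGamma (c + of_nat n)) * (\<Sum>k. T k n)) \<longlonglongrightarrow> 1 * 1"
    by (intro tendsto_mult rGamma_shift_asymp) simp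
  moreover have "eventually (\<lambda>n. (fact n * of_nat (Suc n) powr (c - 1) * rGamma (c + of_nat n)) * (\<Sum>k. T k n) =
     fact n * of_nat (Suc n) powr (c - 1) *
     (\<Sum>k. pochhammer a k * pochhammer b k / fact k * rGamma (c + of_nat n + of_nat k))) sequentially"
    using eventually_ge_at_top[of n0]
  proof eventually_elim
    case (elim n)
    have "Re (c + of_nat n) > 0" "Re (c + of_nat n - a - b) > 0" using n0 elim by auto
    then have nz: "pochhammer (c + of_nat n) k \<noteq> 0" for k
      using pochhammer_eq_0_imp_nonpos_Int by (fastforce elim!: nonpos_Ints_cases)
    have "summable (\<lambda>k. T k n)"
    proof (rule summable_norm_cancel, rule summable_comparison_test'[where N = 0])
      show "summable (\<lambda>k. norm (pochhammer a k * pochhammer b k / fact k * rGamma (X + of_nat k)) / norm (rGamma X))"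
        by (intro summable_divide gauss_summable X)
    qed (use dom elim in auto)
    then have "rGamma (c + of_nat n) * (\<Sum>k. T k n) = (\<Sum>k. rGamma (c + of_nat n) * T k n)"
      by (rule suminf_mult[symmetric])
    also have "(\<lambda>k. rGamma (c + of_nat n) * T k n) =
        (\<lambda>k. pochhammer a k * pochhammer b k / fact k * rGamma (c + of_nat n + of_nat k))"
    proof
      fix k show "rGamma (c + of_nat n) * T k n =
          pochhammer a k * pochhammer b k / fact k * rGamma (c + of_nat n + of_nat k)"
        unfolding T_def using nz[of k] by (subst pochhammer_rGamma[of "c + of_nat n" k]) simp
    qed
    finally show ?case by (simp only: mult.assoc)
  qed
  ultimately have "(\<lambda>n. fact n * of_nat (Suc n) powr (c - 1) *
     (\<Sum>k. pochhammer a k * pochhammer b k / fact k * rGamma (c + of_nat n + of_nat k))) \<longlonglongrightarrow> 1 * 1"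
    by (rule Lim_transform_eventually)
  then show ?thesis by (simp only: mult_1)
qed

text \<open>
  Gauss's theorem, divided by \<open>\<Gamma>(c)\<close> so that poles of Gamma at \<open>c\<close> need no exception. Iterating the contiguous relation
  moves \<open>c\<close> to infinity, where the sum is known; the Pochhammer factors collected on the way tend to the
  product of Gamma values on the right.
\<close>
lemma gauss_sum:
  fixes a b c :: complex
  assumes s: "Re (c - a - b) > 0"
  shows "((\<lambda>k. pochhammer a k * pochhammer b k / fact k * rGamma (c + of_nat k)) has_sum
     rGamma (c - a) * rGamma (c - b) * Gamma (c - a - b)) UNIV"
proof -
  define G where "G c = (\<Sum>k. pochhammer a k * pochhammer b k / fact k * rGamma (c + of_nat k))" for c
  have np: "c - a - b \<notin> \<int>\<^sub>\<le>\<^sub>0" using Re_pos_not_nonpos_Ints[OF s] .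
  let ?w = "\<lambda>z n. fact n * of_nat (Suc n) powr (z - 1) :: complex"
  have "(\<lambda>n. (pochhammer (c - a) n / ?w (c - a) n) * (pochhammer (c - b) n / ?w (c - b) n) /
      (pochhammer (c - a - b) n / ?w (c - a - b) n) * (?w c n * G (c + of_nat n)))
      \<longlonglongrightarrow> rGamma (c - a) * rGamma (c - b) / rGamma (c - a - b) * 1"
    unfolding G_def
    by (rule tendsto_mult[OF tendsto_divide[OF tendsto_mult[OF pochhammer_asymp pochhammer_asymp] pochhammer_asymp] gauss_limit])
       (use np in \<open>simp add: rGamma_eq_zero_iff\<close>)
  moreover have eq: "(pochhammer (c - a) n / ?w (c - a) n) * (pochhammer (c - b) n / ?w (c - b) n) /
      (pochhammer (c - a - b) n / ?w (c - a - b) n) * (?w c n * G (c + of_nat n)) = G c" for n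
  proof -
    have nz: "pochhammer (c - a - b) n \<noteq> 0" using np pochhammer_eq_0_imp_nonpos_Int by blast
    have w: "?w c n * ?w (c - a - b) n = ?w (c - a) n * ?w (c - b) n"
    proof -
      have "of_nat (Suc n) powr (c - 1) * of_nat (Suc n) powr (c - a - b - 1) =
          of_nat (Suc n) powr (c - a - 1) * (of_nat (Suc n) powr (c - b - 1) :: complex)"
        unfolding powr_add[symmetric] by (rule arg_cong[of _ _ "\<lambda>z. _ powr z"]) simp
      from arg_cong[OF this, of "\<lambda>x. fact n * fact n * x"] show ?thesis by (simp only: mult_ac)
    qed
    have wnz: "?w z n \<noteq> 0" for z by (rule pochhammer_weight_nonzero)
    have fin: "pochhammer (c - a) n * pochhammer (c - b) n * G (c + of_nat n) / pochhammer (c - a - b) n = G c"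
    proof -
      have "pochhammer (c - a) n * pochhammer (c - b) n * G (c + of_nat n) = pochhammer (c - a - b) n * G c"
        unfolding G_def by (rule gauss_iterate[OF s, symmetric])
      then show ?thesis using nz by simp
    qed
    have K: "(x1 / w1) * (x2 / w2) / (x3 / w3) * (w4 * g) = x1 * x2 * g / x3"
      if "w4 * w3 = w1 * w2" "w1 \<noteq> 0" "w2 \<noteq> 0" for x1 x2 x3 w1 w2 w3 w4 g :: complex
    proof -
      have "(x1 / w1) * (x2 / w2) / (x3 / w3) * (w4 * g) = x1 * x2 * g / x3 * ((w4 * w3) / (w1 * w2))"
        by (simp add: mult_ac)
      also have "w4 * w3 / (w1 * w2) = 1" using that by simp
      finally show ?thesis by simp
    qed
    show ?thesis by (rule trans[OF K[OF w wnz wnz] fin])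
  qed
  ultimately have "(\<lambda>n::nat. G c) \<longlonglongrightarrow> rGamma (c - a) * rGamma (c - b) / rGamma (c - a - b) * 1"
    by (simp only: eq)
  from LIMSEQ_unique[OF tendsto_const this]
  have "G c = rGamma (c - a) * rGamma (c - b) / rGamma (c - a - b)" by simp
  then have "G c = rGamma (c - a) * rGamma (c - b) * Gamma (c - a - b)"
    by (simp add: rGamma_inverse_Gamma divide_inverse)
  moreover have "(\<lambda>k. pochhammer a k * pochhammer b k / fact k * rGamma (c + of_nat k)) sums G c"
    unfolding G_def by (rule summable_sums[OF summable_norm_cancel[OF gauss_summable[OF s]]])
  ultimately show ?thesis using norm_summable_imp_has_sum[OF gauss_summable[OF s]] by simp
qed

section \<open>Continuation of Appell's function\<close>

lemma F3_integrand_continuous: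
  fixes X Y :: "'z::topological_space \<Rightarrow> complex"
  assumes f: "f holomorphic_on slit_plane" and g: "g holomorphic_on slit_plane"
    and XY: "continuous_on T X" "continuous_on T Y" "X ` T \<subseteq> slit_plane" "Y ` T \<subseteq> slit_plane"
  shows "continuous_on ({0..1} \<times> T) (\<lambda>(u, z). f (of_real u * X z) * g (of_real (1 - u) * Y z))"
  proof -
    have X: "continuous_on ({0..1} \<times> T) (\<lambda>x. X (snd x))" and Y: "continuous_on ({0..1} \<times> T) (\<lambda>x. Y (snd x))"
      by (auto intro!: continuous_on_compose2[OF XY(1)] continuous_on_compose2[OF XY(2)] continuous_intros)
    have "continuous_on ({0..1} \<times> T) (\<lambda>x. f (of_real (fst x) * X (snd x)))"
      by (rule continuous_on_compose2[OF holomorphic_on_imp_continuous_on[OF f]])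
         (use XY(3) slit_plane_scale in \<open>auto intro!: continuous_intros X\<close>)
    moreover have "continuous_on ({0..1} \<times> T) (\<lambda>x. g (of_real (1 - fst x) * Y (snd x)))"
      by (rule continuous_on_compose2[OF holomorphic_on_imp_continuous_on[OF g]])
         (use XY(4) slit_plane_scale in \<open>auto intro!: continuous_intros Y simp del: of_real_diff\<close>)
    ultimately show ?thesis by (auto simp: case_prod_unfold intro!: continuous_on_mult)
  qed

lemma F3_integral_holomorphic:
  assumes e: "Re e > 0" and e': "Re e' > 0"
    and f: "f holomorphic_on slit_plane" and g: "g holomorphic_on slit_plane"
    and XY: "X holomorphic_on slit_plane" "Y holomorphic_on slit_plane"
      "X ` slit_plane \<subseteq> slit_plane" "Y ` slit_plane \<subseteq> slit_plane"
  shows "(\<lambda>z. (\<integral>u. Beta_kernel e e' u * (f (of_real u * X z) * g (of_real (1 - u) * Y z)) \<partial>lborel) / Beta e e')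
      holomorphic_on slit_plane"
  proof -
    have "(\<lambda>z. \<integral>u. Beta_kernel e e' u * (f (of_real u * X z) * g (of_real (1 - u) * Y z)) \<partial>lborel) holomorphic_on slit_plane"
    proof (rule holomorphic_on_integral_Beta_kernel[OF e e' open_slit_plane])
      show "continuous_on ({0..1} \<times> slit_plane) (\<lambda>(u, z). f (of_real u * X z) * g (of_real (1 - u) * Y z))"
        by (intro F3_integrand_continuous f g holomorphic_on_imp_continuous_on XY)
      show "(\<lambda>z. f (of_real u * X z) * g (of_real (1 - u) * Y z)) holomorphic_on slit_plane" if "0 < u" "u < 1" for u
      proof (intro holomorphic_intros holomorphic_on_compose_gen[OF _ f, unfolded o_def] holomorphic_on_compose_gen[OF _ g, unfolded o_def])
        show "X holomorphic_on slit_plane" "Y holomorphic_on slit_plane" by fact+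
        show "(\<lambda>z. complex_of_real u * X z) ` slit_plane \<subseteq> slit_plane"
          using \<open>X ` slit_plane \<subseteq> slit_plane\<close> that slit_plane_scale by auto
        show "(\<lambda>z. complex_of_real (1 - u) * Y z) ` slit_plane \<subseteq> slit_plane"
          using \<open>Y ` slit_plane \<subseteq> slit_plane\<close> that slit_plane_scale[of _ "1 - u"] by auto
      qed
    qed
    then show ?thesis by (intro holomorphic_intros Beta_nonzero e e') auto
  qed

text \<open>
  For \<open>|X|, |Y| < 1\<close>, inserting the two power series and integrating term by term produces beta values
  \<open>Beta (e + m) (e' + l)\<close>, which merge the lower parameters \<open>e\<close> and \<open>e'\<close> into \<open>(e + e')\<^sub>m\<^sub>+\<^sub>l\<close>. The integral itself makes
  sense on the product of the slit planes.
\<close>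
lemma F3_continuation_integral:
  assumes e: "Re e > 0" and e': "Re e' > 0"
    and f: "f holomorphic_on slit_plane"
      "\<And>z. norm z < 1 \<Longrightarrow> (\<lambda>m. pochhammer a m * pochhammer b m / (pochhammer e m * fact m) * z ^ m) sums f z"
    and g: "g holomorphic_on slit_plane"
      "\<And>z. norm z < 1 \<Longrightarrow> (\<lambda>m. pochhammer a' m * pochhammer b' m / (pochhammer e' m * fact m) * z ^ m) sums g z"
  shows "is_F3_continuation a a' b b' (e + e')
     (\<lambda>X Y. (\<integral>u. Beta_kernel e e' u * (f (of_real u * X) * g (of_real (1 - u) * Y)) \<partial>lborel) / Beta e e')"
proof -
  have nz: "Beta e e' \<noteq> 0" by (rule Beta_nonzero[OF e e'])
  show ?thesis unfolding is_F3_continuation_def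
  proof (intro conjI ballI allI impI)
    have "continuous_on (slit_plane \<times> slit_plane) (\<lambda>z. \<integral>u. Beta_kernel e e' u * (f (of_real u * fst z) * g (of_real (1 - u) * snd z)) \<partial>lborel)"
      by (intro continuous_on_integral_Beta_kernel e e' F3_integrand_continuous f g continuous_intros) auto
    then show "continuous_on (slit_plane \<times> slit_plane) (\<lambda>(X, Y).
       (\<integral>u. Beta_kernel e e' u * (f (of_real u * X) * g (of_real (1 - u) * Y)) \<partial>lborel) / Beta e e')"
      using nz by (auto simp: case_prod_unfold intro!: continuous_intros)
    show "(\<lambda>X. (\<integral>u. Beta_kernel e e' u * (f (of_real u * X) * g (of_real (1 - u) * Y)) \<partial>lborel) / Beta e e') holomorphic_on slit_plane"
      if "Y \<in> slit_plane" for Y by (rule F3_integral_holomorphic[OF e e' f(1) g(1)]) (use that in \<open>auto intro!: holomorphic_intros\<close>)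
    show "(\<lambda>Y. (\<integral>u. Beta_kernel e e' u * (f (of_real u * X) * g (of_real (1 - u) * Y)) \<partial>lborel) / Beta e e') holomorphic_on slit_plane"
      if "X \<in> slit_plane" for X by (rule F3_integral_holomorphic[OF e e' f(1) g(1)]) (use that in \<open>auto intro!: holomorphic_intros\<close>)
  next
    fix X Y :: complex assume XY: "norm X < 1" "norm Y < 1"
    define p where "p = (\<lambda>m. pochhammer a m * pochhammer b m / (pochhammer e m * fact m))"
    define q where "q = (\<lambda>m. pochhammer a' m * pochhammer b' m / (pochhammer e' m * fact m))"
    have pX: "((\<lambda>m. p m * z ^ m) has_sum f z) UNIV" if "norm z < 1" for z
      by (rule sums_unit_disc_has_sum) (use f(2) that in \<open>auto simp: p_def\<close>)
    have qY: "((\<lambda>m. q m * z ^ m) has_sum g z) UNIV" if "norm z < 1" for z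
      by (rule sums_unit_disc_has_sum) (use g(2) that in \<open>auto simp: q_def\<close>)
    have prod: "((\<lambda>(m, l). (p m * z ^ m) * (q l * w ^ l)) has_sum f z * g w) UNIV"
      and prod_abs: "(\<lambda>(m, l). norm ((p m * z ^ m) * (q l * w ^ l))) summable_on UNIV"
      if zw: "norm z < 1" "norm w < 1" for z w
    proof -
      have 1: "(\<lambda>m. norm (p m * z ^ m)) summable_on UNIV" and 2: "(\<lambda>l. norm (q l * w ^ l)) summable_on UNIV"
        by (rule has_sum_complex_abs[OF pX[OF zw(1)]], rule has_sum_complex_abs[OF qY[OF zw(2)]])
      have "(\<lambda>(m, l). norm (p m * z ^ m) * norm (q l * w ^ l)) summable_on UNIV \<times> UNIV"
        by (rule summable_on_SigmaI[where g = "\<lambda>m. norm (p m * z ^ m) * infsum (\<lambda>l. norm (q l * w ^ l)) UNIV"])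
           (use 1 2 in \<open>auto intro!: has_sum_cmult_right summable_on_cmult_left\<close>)
      then show A: "(\<lambda>(m, l). norm ((p m * z ^ m) * (q l * w ^ l))) summable_on UNIV"
        by (simp add: norm_mult)
      then have "(\<lambda>(m, l). (p m * z ^ m) * (q l * w ^ l)) summable_on UNIV \<times> UNIV"
        by (subst summable_on_iff_abs_summable_on_complex) (simp add: case_prod_unfold)
      from has_sum_SigmaI[OF _ _ this, of "\<lambda>m. p m * z ^ m * g w" "f z * g w"]
      show "((\<lambda>(m, l). (p m * z ^ m) * (q l * w ^ l)) has_sum f z * g w) UNIV"
        using has_sum_cmult_right[OF qY[OF zw(2)]] has_sum_cmult_left[OF pX[OF zw(1)]] by simp
    qed
    let ?t = "\<lambda>(m, l) u. Beta_kernel (e + of_nat m) (e' + of_nat l) u * ((p m * X ^ m) * (q l * Y ^ l))"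
    have t: "?t (m, l) u = Beta_kernel e e' u * ((p m * (of_real u * X) ^ m) * (q l * (of_real (1 - u) * Y) ^ l))" for m l u
      unfolding power_mult_distrib prod.case Beta_kernel_power[symmetric] by (simp only: mult_ac)
    have le: "norm (Beta_kernel (e + of_nat m) (e' + of_nat l) u) \<le> norm (Beta_kernel e e' u)" for m l u
      by (auto simp: norm_Beta_kernel indicator_def intro!: mult_mono powr_mono')
    have sum: "((\<lambda>i. \<integral>u. ?t i u \<partial>lborel) has_sum
        (\<integral>u. Beta_kernel e e' u * (f (of_real u * X) * g (of_real (1 - u) * Y)) \<partial>lborel)) UNIV"
    proof (rule has_sum_integral_countable)
      show "integrable lborel (?t i)" for i
        unfolding case_prod_unfold by (intro integrable_mult_left integrable_Beta_kernel) (use e e' in auto)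
      show "(\<lambda>i. \<integral>u. norm (?t i u) \<partial>lborel) summable_on UNIV"
      proof (rule summable_on_comparison_test)
        show "(\<lambda>i. Beta (Re e) (Re e') * (case i of (m, l) \<Rightarrow> norm ((p m * X ^ m) * (q l * Y ^ l)))) summable_on UNIV"
          by (intro summable_on_cmult_right prod_abs XY)
        fix i :: "nat \<times> nat"
        obtain m l where i: "i = (m, l)" by (cases i)
        have "(\<integral>u. norm (?t i u) \<partial>lborel) = (\<integral>u. norm (Beta_kernel (e + of_nat m) (e' + of_nat l) u) \<partial>lborel) * norm ((p m * X ^ m) * (q l * Y ^ l))"
          unfolding i prod.case norm_mult[of "Beta_kernel _ _ _"] by simp
        also have "\<dots> \<le> (\<integral>u. norm (Beta_kernel e e' u) \<partial>lborel) * norm ((p m * X ^ m) * (q l * Y ^ l))"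
          using le e e' by (intro mult_right_mono integral_mono integrable_norm integrable_Beta_kernel) auto
        also have "\<dots> = Beta (Re e) (Re e') * norm ((p m * X ^ m) * (q l * Y ^ l))"
          by (subst integral_norm_Beta_kernel[OF e e']) auto
        finally show "(\<integral>u. norm (?t i u) \<partial>lborel) \<le> Beta (Re e) (Re e') * (case i of (m, l) \<Rightarrow> norm ((p m * X ^ m) * (q l * Y ^ l)))"
          by (simp add: i)
      qed auto
      fix u :: real
      show "((\<lambda>i. ?t i u) has_sum Beta_kernel e e' u * (f (of_real u * X) * g (of_real (1 - u) * Y))) UNIV"
      proof (cases "u \<in> {0<..<1}")
        case True
        have n: "norm (of_real r * z) < 1" if "0 < r" "r < 1" "norm z < 1" for r and z :: complex
          using that mult_left_le_one_le[of "norm z" r] by (simp add: norm_mult)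
        have "((\<lambda>i. Beta_kernel e e' u * (case i of (m, l) \<Rightarrow> (p m * (of_real u * X) ^ m) * (q l * (of_real (1 - u) * Y) ^ l)))
            has_sum Beta_kernel e e' u * (f (of_real u * X) * g (of_real (1 - u) * Y))) UNIV"
          by (intro has_sum_cmult_right prod n) (use True XY in auto)
        also have "(\<lambda>i. Beta_kernel e e' u * (case i of (m, l) \<Rightarrow> (p m * (of_real u * X) ^ m) * (q l * (of_real (1 - u) * Y) ^ l))) = (\<lambda>i. ?t i u)"
        proof
          fix i show "Beta_kernel e e' u * (case i of (m, l) \<Rightarrow> (p m * (of_real u * X) ^ m) * (q l * (of_real (1 - u) * Y) ^ l)) = ?t i u"
            using t by (cases i) (simp only: prod.case)
        qed
        finally show ?thesis .
      qed (auto simp: Beta_kernel_def case_prod_unfold)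
    qed
    have "(\<integral>u. ?t i u \<partial>lborel) = Beta e e' * F3_term a a' b b' (e + e') X Y i" for i
    proof -
      obtain m l where i: "i = (m, l)" by (cases i)
      have nzp: "pochhammer e m \<noteq> 0" "pochhammer e' l \<noteq> 0" using e e' pochhammer_nonzero by auto
      have "(\<integral>u. ?t i u \<partial>lborel) = Beta (e + of_nat m) (e' + of_nat l) * ((p m * X ^ m) * (q l * Y ^ l))"
        unfolding i prod.case using integral_Beta_kernel[of "e + of_nat m" "e' + of_nat l"] e e' by simp
      also have "Beta (e + of_nat m) (e' + of_nat l) = Beta e e' * (pochhammer e m * pochhammer e' l / pochhammer (e + e') (m + l))"
        by (rule Beta_plus_of_nat[OF e e'])
      also have "Beta e e' * (pochhammer e m * pochhammer e' l / pochhammer (e + e') (m + l)) * ((p m * X ^ m) * (q l * Y ^ l)) =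
          Beta e e' * F3_term a a' b b' (e + e') X Y i"
        using nzp by (simp add: i F3_term_def p_def q_def) (simp add: mult_ac)
      finally show ?thesis .
    qed
    with sum have "((\<lambda>i. Beta e e' * F3_term a a' b b' (e + e') X Y i) has_sum
       Beta e e' * ((\<integral>u. Beta_kernel e e' u * (f (of_real u * X) * g (of_real (1 - u) * Y)) \<partial>lborel) / Beta e e')) UNIV"
      using nz by simp
    then show "(F3_term a a' b b' (e + e') X Y has_sum
       (\<integral>u. Beta_kernel e e' u * (f (of_real u * X) * g (of_real (1 - u) * Y)) \<partial>lborel) / Beta e e') UNIV"
      using nz by (subst (asm) has_sum_cmult_right_iff) auto
  qed
qed

lemma slit_plane_pfaff:
  assumes "z \<in> slit_plane" shows "z / (z - 1) \<in> slit_plane"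
  unfolding slit_plane_def
proof safe
  fix r :: real assume r: "1 \<le> r" "z / (z - 1) = of_real r"
  have "z \<noteq> 1" using assms by (auto simp: slit_plane_iff)
  then have "z * of_real (r - 1) = of_real r" using r(2) by (simp add: field_simps)
  then have "r \<noteq> 1" using r(1) by auto
  moreover from this have "of_real (r - 1) \<noteq> (0::complex)" by (metis eq_iff_diff_eq_0 of_real_eq_0_iff)
  then have "z = of_real (r / (r - 1))"
    using \<open>z * of_real (r - 1) = of_real r\<close> unfolding of_real_divide by (rule eq_divide_imp)
  moreover have "r / (r - 1) \<ge> 1" using r(1) \<open>r \<noteq> 1\<close> by (simp add: field_simps)
  ultimately show False using assms by (auto simp: slit_plane_iff)
qed

text \<open>
  Holomorphy along the curve \<open>Y = X / (X - 1)\<close> is recorded for the integral representation itself; separate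
  holomorphy, as in the definition of the continuation, does not give it directly.
\<close>
lemma F3_continuation_exists:
  assumes "Re c > 0"
  shows "\<exists>F. is_F3_continuation a a' b b' c F \<and> (\<lambda>X. F X (X / (X - 1))) holomorphic_on slit_plane"
proof -
  \<comment> \<open>any splitting of \<open>c\<close> into two parameters with positive real parts would do\<close>
  have c2: "Re (c / 2) > 0" using assms by simp
  obtain f where f: "f holomorphic_on slit_plane"
      "\<And>z. norm z < 1 \<Longrightarrow> (\<lambda>m. pochhammer a m * pochhammer b m / (pochhammer (c/2) m * fact m) * z ^ m) sums f z"
    using slit_continuable_2F1[OF c2, of a b] unfolding slit_continuable_def by blast
  obtain g where g: "g holomorphic_on slit_plane"
      "\<And>z. norm z < 1 \<Longrightarrow> (\<lambda>m. pochhammer a' m * pochhammer b' m / (pochhammer (c/2) m * fact m) * z ^ m) sums g z"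
    using slit_continuable_2F1[OF c2, of a' b'] unfolding slit_continuable_def by blast
  define F where "F = (\<lambda>X Y. (\<integral>u. Beta_kernel (c/2) (c/2) u * (f (of_real u * X) * g (of_real (1 - u) * Y)) \<partial>lborel)
      / Beta (c/2) (c/2))"
  have "is_F3_continuation a a' b b' (c/2 + c/2) F"
    unfolding F_def by (rule F3_continuation_integral[OF c2 c2 f g])
  moreover have "(\<lambda>X. F X (X / (X - 1))) holomorphic_on slit_plane"
    unfolding F_def
    by (rule F3_integral_holomorphic[OF c2 c2 f(1) g(1), of "\<lambda>X. X" "\<lambda>X. X / (X - 1)"])
       (use slit_plane_pfaff in \<open>auto intro!: holomorphic_intros simp: slit_plane_iff[of 1]\<close>)
  ultimately show ?thesis by auto
qed

section \<open>Appell's function on the curve XY = X + Y\<close>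

lemma has_sum_antidiagonal:
  fixes f :: "nat \<times> nat \<Rightarrow> complex"
  assumes "(f has_sum S) UNIV"
  shows "((\<lambda>n. \<Sum>k\<le>n. f (n - k, k)) has_sum S) UNIV"
proof -
  have "((\<lambda>(n, k). f (n - k, k)) has_sum S) (SIGMA n:UNIV. {..n}) \<longleftrightarrow> (f has_sum S) UNIV"
    by (rule has_sum_reindex_bij_witness[of _ "\<lambda>(j, k). (j + k, k)" "\<lambda>(n, k). (n - k, k)"]) auto
  with assms have "((\<lambda>(n, k). f (n - k, k)) has_sum S) (SIGMA n:UNIV. {..n})" by simp
  from has_sum_Sigma'[OF this, of "\<lambda>n. \<Sum>k\<le>n. f (n - k, k)"] show ?thesis by simp
qed

lemma summable_on_product:
  fixes f g :: "nat \<Rightarrow> real"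
  assumes "f summable_on UNIV" "g summable_on UNIV" "\<And>n. f n \<ge> 0" "\<And>n. g n \<ge> 0"
  shows "(\<lambda>(j, k). f j * g k) summable_on UNIV"
proof -
  have "(\<lambda>(j, k). f j * g k) summable_on UNIV \<times> UNIV"
    by (rule summable_on_SigmaI[where g = "\<lambda>j. f j * infsum g UNIV"])
       (use assms in \<open>auto intro!: has_sum_cmult_right summable_on_cmult_left\<close>)
  then show ?thesis by simp
qed

text \<open>
  Multiplication by the binomial series of \<open>(1 - X)\<^sup>a\<^sup>+\<^sup>b\<^sup>-\<^sup>c\<close> is a Cauchy product whose coefficients are evaluated by
  \<open>saalschuetz\<close>.
\<close>
lemma euler_transformation_2F1:
  fixes X :: complex
  assumes X: "norm X < 1" and c: "Re c > 0"
    and f: "((\<lambda>m. pochhammer a m * pochhammer b m / (pochhammer c m * fact m) * X ^ m) has_sum f) UNIV"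
  shows "((\<lambda>m. pochhammer (c - a) m * pochhammer (c - b) m / (pochhammer c m * fact m) * X ^ m)
           has_sum (f * (1 - X) powr (a + b - c))) UNIV"
proof -
  let ?u = "\<lambda>m. pochhammer a m * pochhammer b m / (pochhammer c m * fact m) * X ^ m"
  let ?v = "\<lambda>m. pochhammer (c - a - b) m / fact m * X ^ m"
  have v: "(?v has_sum (1 - X) powr (- (c - a - b))) UNIV"
    by (rule sums_unit_disc_has_sum[OF pochhammer_binomial_series X])
  have su: "summable (\<lambda>m. norm (?u m))" and sv: "summable (\<lambda>m. norm (?v m))"
    by (rule summable_on_imp_summable[OF has_sum_complex_abs[OF f]],
        rule summable_on_imp_summable[OF has_sum_complex_abs[OF v]])
  have coeff: "(\<Sum>i\<le>n. ?u i * ?v (n - i)) =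
      pochhammer (c - a) n * pochhammer (c - b) n / (pochhammer c n * fact n) * X ^ n" for n
  proof -
    have nz: "pochhammer c k \<noteq> 0" for k by (rule pochhammer_nonzero[OF c])
    have "?u i * ?v (n - i) = (of_nat (n choose i) * pochhammer a i * pochhammer b i *
            pochhammer (c + of_nat i) (n - i) * pochhammer (c - a - b) (n - i)) * (X ^ n / (pochhammer c n * fact n))"
      if "i \<le> n" for i
    proof -
      have 1: "X ^ n = X ^ i * X ^ (n - i)" using that by (simp add: power_add[symmetric])
      have 2: "pochhammer c n = pochhammer c i * pochhammer (c + of_nat i) (n - i)"
        by (rule pochhammer_product[OF that])
      have 3: "of_nat (n choose i) = fact n / (fact i * fact (n - i) :: complex)"
        by (rule binomial_fact[OF that])
      have "pochhammer (c + of_nat i) (n - i) \<noteq> 0" using nz[of n] 2 by auto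
      then show ?thesis using nz[of i] unfolding 1 2 3 by (simp add: field_simps)
    qed
    then have "(\<Sum>i\<le>n. ?u i * ?v (n - i)) = (\<Sum>i\<le>n. (of_nat (n choose i) * pochhammer a i * pochhammer b i *
            pochhammer (c + of_nat i) (n - i) * pochhammer (c - a - b) (n - i)) * (X ^ n / (pochhammer c n * fact n)))"
      by (intro sum.cong) auto
    also have "\<dots> = pochhammer (c - a) n * pochhammer (c - b) n * (X ^ n / (pochhammer c n * fact n))"
      by (subst sum_distrib_right[symmetric], subst saalschuetz) simp
    finally show ?thesis by simp
  qed
  have "(\<lambda>n. \<Sum>i\<le>n. ?u i * ?v (n - i)) sums ((\<Sum>k. ?u k) * (\<Sum>k. ?v k))"
    by (rule Cauchy_product_sums[OF su sv])
  also have "(\<Sum>k. ?u k) = f" using has_sum_imp_sums[OF f] by (simp add: sums_iff)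
  also have "(\<Sum>k. ?v k) = (1 - X) powr (a + b - c)" using has_sum_imp_sums[OF v] by (simp add: sums_iff algebra_simps)
  finally have s: "(\<lambda>n. pochhammer (c - a) n * pochhammer (c - b) n / (pochhammer c n * fact n) * X ^ n) sums
      (f * (1 - X) powr (a + b - c))" unfolding coeff .
  obtain G where G: "\<And>z. norm z < 1 \<Longrightarrow>
      (\<lambda>n. pochhammer (c - a) n * pochhammer (c - b) n / (pochhammer c n * fact n) * z ^ n) sums G z"
    using slit_continuable_2F1[OF c] unfolding slit_continuable_def by blast
  have "G X = f * (1 - X) powr (a + b - c)" by (rule sums_unique2[OF G[OF X] s])
  with sums_unit_disc_has_sum[OF G X] show ?thesis by simp
qed

text \<open>
  A crude bound, good enough for absolute convergence in some neighbourhood of the origin.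
\<close>
lemma norm_pochhammer_shift_le:
  fixes z :: complex
  shows "norm (pochhammer (z + of_nat k) j) \<le> (norm z + 1) ^ j * (fact (k + j) / fact k)"
proof (induction j)
  case (Suc j)
  have "norm (z + of_nat k + of_nat j) \<le> norm z + real (k + j)"
    using norm_triangle_ineq[of z "of_nat (k + j)"] unfolding norm_of_nat by (simp add: add_ac)
  also have "\<dots> \<le> (norm z + 1) * real (Suc (k + j))"
    by (simp add: algebra_simps)
  finally have "norm (pochhammer (z + of_nat k) (Suc j)) \<le>
      ((norm z + 1) ^ j * (fact (k + j) / fact k)) * ((norm z + 1) * real (Suc (k + j)))"
    using Suc unfolding pochhammer_Suc norm_mult by (intro mult_mono) auto
  also have "\<dots> = (norm z + 1) ^ Suc j * (fact (k + Suc j) / fact k)"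
    by (simp del: of_nat_Suc)
  finally show ?case .
qed auto

lemma norm_pochhammer_ge:
  fixes c :: complex
  assumes "0 < \<kappa>" "\<kappa> \<le> 1" "\<kappa> \<le> Re c"
  shows "\<kappa> ^ n * fact n \<le> norm (pochhammer c n)"
proof (induction n)
  case (Suc n)
  have "\<kappa> * real (Suc n) \<le> Re c + real n"
    using assms mult_left_le_one_le[of "real n" \<kappa>] by (simp add: algebra_simps)
  also have "\<dots> \<le> norm (c + of_nat n)" using complex_Re_le_cmod[of "c + of_nat n"] by simp
  finally have "(\<kappa> ^ n * fact n) * (\<kappa> * real (Suc n)) \<le> norm (pochhammer c n) * norm (c + of_nat n)"
    using Suc assms by (intro mult_mono) auto
  then show ?case by (simp add: pochhammer_Suc norm_mult mult_ac del: of_nat_Suc)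
qed auto

text \<open>
  Coefficients of \<open>(1-X)\<^sup>a\<^sup>+\<^sup>b\<^sup>-\<^sup>c F\<^sub>3(X, X/(X-1))\<close> as a double power series. Up to the multiplier
  \<open>(c - b)\<^sub>n / (c)\<^sub>n\<close>, \<open>n = j + k\<close>, they are the Cauchy product of the binomial series of \<open>(1-X)\<^sup>a\<^sup>+\<^sup>a\<^sup>'\<^sup>-\<^sup>c\<close> with the series of
  \<open>\<^sub>2F\<^sub>1(a', c-b-b'; c-b; X)\<close>; writing \<open>(c - b + k)\<^sub>j\<close> avoids a division by \<open>(c - b)\<^sub>k\<close>.
\<close>
definition curve_coeff :: "complex \<Rightarrow> complex \<Rightarrow> complex \<Rightarrow> complex \<Rightarrow> complex \<Rightarrow> nat \<times> nat \<Rightarrow> complex" where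
  "curve_coeff a a' b b' c = (\<lambda>(j, k).
     pochhammer (c - a - a') j * pochhammer (c - b + of_nat k) j *
     (pochhammer a' k * pochhammer (c - b - b') k) / (fact j * fact k * pochhammer c (j + k)))"

text \<open>
  Sharp bounds for the Pochhammer symbols are essential here: the exponents decide for which \<open>s\<close> the series
  may be integrated termwise up to \<open>X = 1\<close>.
\<close>
lemma curve_coeff_bound:
  assumes c: "Re c > 0"
  shows "\<exists>C>0. \<forall>j k. norm (curve_coeff a a' b b' c (j, k)) \<le>
    C * (real (Suc j) powr (Re (c - a - a') - 1) * real (Suc k) powr (Re (a' - b') - 1) *
         real (Suc (j + k)) powr (- Re b))"
proof -
  obtain C1 where C1: "C1 > 0" "\<And>n. norm (pochhammer (c - a - a') n) \<le> C1 * (fact n * real (Suc n) powr (Re (c - a - a') - 1))"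
    using pochhammer_upper_bound[of "c - a - a'"] by blast
  obtain C2 where C2: "C2 > 0" "\<And>k j. norm (pochhammer (c - b + of_nat k) j) \<le>
     C2 * (fact (k + j) * real (Suc (k + j)) powr (Re (c - b) - 1)) / (fact k * real (Suc k) powr (Re (c - b) - 1))"
    using pochhammer_shift_bound[of "c - b"] by blast
  obtain C3 where C3: "C3 > 0" "\<And>n. norm (pochhammer a' n) \<le> C3 * (fact n * real (Suc n) powr (Re a' - 1))"
    using pochhammer_upper_bound[of a'] by blast
  obtain C4 where C4: "C4 > 0" "\<And>n. norm (pochhammer (c - b - b') n) \<le> C4 * (fact n * real (Suc n) powr (Re (c - b - b') - 1))"
    using pochhammer_upper_bound[of "c - b - b'"] by blast
  obtain C5 where C5: "C5 > 0" "\<And>n. fact n * real (Suc n) powr (Re c - 1) \<le> C5 * norm (pochhammer c n)"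
    using pochhammer_lower_bound[OF Re_pos_not_nonpos_Ints[OF c]] by blast
  define C where "C = C1 * C2 * C3 * C4 * C5"
  have "norm (curve_coeff a a' b b' c (j, k)) \<le>
    C * (real (Suc j) powr (Re (c - a - a') - 1) * real (Suc k) powr (Re (a' - b') - 1) *
         real (Suc (j + k)) powr (- Re b))" for j k
  proof -
    define J K N where "J = real (Suc j)" and "K = real (Suc k)" and "N = real (Suc (j + k))"
    have pos: "J > 0" "K > 0" "N > 0" by (auto simp: J_def K_def N_def)
    have "norm (pochhammer c (j + k)) > 0" using pochhammer_nonzero[OF c] by simp
    have c5: "fact (j + k) * N powr (Re c - 1) / C5 \<le> norm (pochhammer c (j + k))"
      using C5(2)[of "j + k"] C5(1) by (simp add: N_def pos_divide_le_eq mult.commute)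
    have "norm (curve_coeff a a' b b' c (j, k)) =
        norm (pochhammer (c - a - a') j) * norm (pochhammer (c - b + of_nat k) j) *
        (norm (pochhammer a' k) * norm (pochhammer (c - b - b') k)) / (fact j * fact k * norm (pochhammer c (j + k)))"
      by (simp add: curve_coeff_def norm_mult norm_divide)
    also have "\<dots> \<le> (C1 * (fact j * J powr (Re (c - a - a') - 1))) *
         (C2 * (fact (k + j) * N powr (Re (c - b) - 1)) / (fact k * K powr (Re (c - b) - 1))) *
         ((C3 * (fact k * K powr (Re a' - 1))) * (C4 * (fact k * K powr (Re (c - b - b') - 1)))) /
         (fact j * fact k * (fact (j + k) * N powr (Re c - 1) / C5))"
      using C1(2)[of j] C2(2)[of k j] C3(2)[of k] C4(2)[of k] c5 C1(1) C2(1) C3(1) C4(1) C5(1) pos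
      unfolding J_def[symmetric] K_def[symmetric] N_def[symmetric] add.commute[of k j]
      by (intro frac_le mult_mono) (auto intro!: mult_nonneg_nonneg mult_pos_pos divide_nonneg_pos)
    also have "\<dots> = C * (J powr (Re (c - a - a') - 1) * (K powr (Re a' - 1) * K powr (Re (c - b - b') - 1) / K powr (Re (c - b) - 1)) *
        (N powr (Re (c - b) - 1) / N powr (Re c - 1)))"
      by (simp add: C_def add.commute[of k j])
    also have "K powr (Re a' - 1) * K powr (Re (c - b - b') - 1) / K powr (Re (c - b) - 1) = K powr (Re (a' - b') - 1)"
      unfolding powr_add[symmetric] powr_diff[symmetric] by (rule arg_cong[of _ _ "\<lambda>z. _ powr z"]) simp
    also have "N powr (Re (c - b) - 1) / N powr (Re c - 1) = N powr (- Re b)"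
      unfolding powr_diff[symmetric] by (rule arg_cong[of _ _ "\<lambda>z. _ powr z"]) simp
    finally show ?thesis by (simp only: J_def K_def N_def)
  qed
  then show ?thesis using C1(1) C2(1) C3(1) C4(1) C5(1) by (intro exI[of _ C]) (auto simp: C_def)
qed

lemma summable_powr_geometric:
  assumes "0 \<le> r" "r < (1::real)"
  shows "(\<lambda>n. real (Suc n) powr s * r ^ n) summable_on UNIV"
proof (cases "r = 0")
  case True
  have "(\<lambda>n. real (Suc n) powr s * r ^ n) summable_on {0}" by simp
  then show ?thesis by (subst (asm) summable_on_cong_neutral[of UNIV "{0}"]) (use True in auto)
next
  case False
  then have r: "r > 0" using assms by simp
  define L where "L = - ln r"
  have L: "L > 0" using r assms by (simp add: L_def)
  define h where "h = (\<lambda>n. (s + 2) * ln (real n + 1) - L * real n)"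
  have "filterlim (\<lambda>n. (s + 2) * ln (real n + 1) - L * real n) at_bot sequentially"
  proof -
    have 1: "(\<lambda>n. ln (real n + 1) / real n) \<longlonglongrightarrow> 0" by real_asymp
    have "(\<lambda>n. (s + 2) * (ln (real n + 1) / real n) - L) \<longlonglongrightarrow> (s+2) * 0 - L" by (intro tendsto_intros 1)
    then have "(\<lambda>n. (s + 2) * (ln (real n + 1) / real n) - L) \<longlonglongrightarrow> -L" by simp
    from filterlim_tendsto_neg_mult_at_bot[OF this _ filterlim_real_sequentially] L
    have "filterlim (\<lambda>n. ((s + 2) * (ln (real n + 1) / real n) - L) * real n) at_bot sequentially" by simp
    moreover have "eventually (\<lambda>n. ((s + 2) * (ln (real n + 1) / real n) - L) * real n = (s + 2) * ln (real n + 1) - L * real n) sequentially"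
      using eventually_gt_at_top[of 0] by eventually_elim (simp add: field_simps)
    ultimately show ?thesis by (rule filterlim_mono_eventually[OF _ order_refl order_refl])
  qed
  then have "\<forall>Z. eventually (\<lambda>n. h n \<le> Z) sequentially" unfolding h_def filterlim_at_bot .
  then have "eventually (\<lambda>n. h n \<le> 0) sequentially" ..
  then obtain n0 where n0: "\<And>n. n \<ge> n0 \<Longrightarrow> h n \<le> 0" by (auto simp: eventually_sequentially)
  have "norm (real (Suc n) powr s * r ^ n) \<le> real (Suc n) powr (-2)" if "n \<ge> n0" for n
  proof -
    have "real (Suc n) powr s * r ^ n = exp (s * ln (real n + 1)) * exp (- L * real n)"
    proof -
      have "r ^ n = exp (real n * ln r)" using r by (subst exp_of_nat_mult) simp
      moreover have "real (Suc n) powr s = exp (s * ln (real n + 1))" by (simp add: powr_def add.commute)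
      ultimately show ?thesis by (simp add: L_def mult.commute[of "real n"])
    qed
    also have "\<dots> = exp (h n + (-2) * ln (real n + 1))"
    proof -
      have "h n + (-2) * ln (real n + 1) = s * ln (real n + 1) + (- L * real n)" by (simp add: h_def ring_distribs)
      then show ?thesis by (simp only: exp_add)
    qed
    also have "\<dots> \<le> exp ((-2) * ln (real n + 1))" using n0[OF that] by simp
    also have "\<dots> = real (Suc n) powr (-2)" by (simp add: powr_def add.commute)
    finally show ?thesis using assms by simp
  qed
  then have le: "norm (norm (real (Suc n) powr s * r ^ n)) \<le> real (Suc n) powr (-2)" if "n \<ge> n0" for n
    using that by simp
  have "summable (\<lambda>n. real (Suc n) powr (-2))" by (rule summable_Suc_powr) simp
  then have "summable (\<lambda>n. norm (real (Suc n) powr s * r ^ n))"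
    by (rule summable_comparison_test'[OF _ le])
  from norm_summable_imp_summable_on[OF this] show ?thesis .
qed

lemma curve_series_summable:
  assumes c: "Re c > 0" and X: "norm X < 1"
  shows "(\<lambda>(j, k). curve_coeff a a' b b' c (j, k) * X ^ (j + k)) summable_on UNIV"
proof -
  obtain C where C: "C > 0" "\<And>j k. norm (curve_coeff a a' b b' c (j, k)) \<le>
    C * (real (Suc j) powr (Re (c - a - a') - 1) * real (Suc k) powr (Re (a' - b') - 1) *
         real (Suc (j + k)) powr (- Re b))" using curve_coeff_bound[OF c] by blast
  define u v where "u = Re (c - a - a') - 1 + \<bar>Re b\<bar>" and "v = Re (a' - b') - 1 + \<bar>Re b\<bar>"
  let ?f = "\<lambda>j. real (Suc j) powr u * norm X ^ j" and ?g = "\<lambda>k. real (Suc k) powr v * norm X ^ k"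
  have "(\<lambda>(j, k). ?f j * ?g k) summable_on UNIV"
    using X by (intro summable_on_product summable_powr_geometric) auto
  from summable_on_cmult_right[OF this, of C] show ?thesis
  proof (rule summable_on_norm_le)
    fix i :: "nat \<times> nat" obtain j k where i: "i = (j, k)" by (cases i)
    have "real (Suc (j + k)) powr (- Re b) \<le> real (Suc (j + k)) powr \<bar>Re b\<bar>" by (intro powr_mono) auto
    also have "\<dots> \<le> (real (Suc j) * real (Suc k)) powr \<bar>Re b\<bar>" by (intro powr_mono2) (auto simp: algebra_simps)
    also have "\<dots> = real (Suc j) powr \<bar>Re b\<bar> * real (Suc k) powr \<bar>Re b\<bar>" by (simp add: powr_mult del: of_nat_Suc)
    finally have "C * (real (Suc j) powr (Re (c - a - a') - 1) * real (Suc k) powr (Re (a' - b') - 1) *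
         real (Suc (j + k)) powr (- Re b)) \<le> C * (real (Suc j) powr (Re (c - a - a') - 1) * real (Suc k) powr (Re (a' - b') - 1) *
         (real (Suc j) powr \<bar>Re b\<bar> * real (Suc k) powr \<bar>Re b\<bar>))"
      using C(1) by (intro mult_left_mono) auto
    also have "\<dots> = C * (real (Suc j) powr u * real (Suc k) powr v)"
      by (simp add: u_def v_def powr_add mult_ac del: of_nat_Suc)
    finally have "norm (curve_coeff a a' b b' c (j, k)) \<le> C * (real (Suc j) powr u * real (Suc k) powr v)"
      using C(2)[of j k] by linarith
    then have "norm (curve_coeff a a' b b' c (j, k)) * norm X ^ (j + k) \<le>
        C * (real (Suc j) powr u * real (Suc k) powr v) * norm X ^ (j + k)" by (rule mult_right_mono) auto
    then show "norm (case i of (j, k) \<Rightarrow> curve_coeff a a' b b' c (j, k) * X ^ (j + k)) \<le>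
        C * (case i of (j, k) \<Rightarrow> ?f j * ?g k)"
      by (simp add: i norm_mult norm_power power_add mult_ac del: of_nat_Suc)
  qed
qed

text \<open>
  The terms obtained from the double series of \<open>F\<^sub>3\<close> on the curve by applying Euler's transformation to the
  series in \<open>X\<close> that multiplies \<open>Y\<^sup>l\<close>, without the common power of \<open>1 - X\<close>.
\<close>
definition euler_term :: "complex \<Rightarrow> complex \<Rightarrow> complex \<Rightarrow> complex \<Rightarrow> complex \<Rightarrow> complex \<Rightarrow> nat \<times> nat \<Rightarrow> complex" where
  "euler_term a a' b b' c X = (\<lambda>(m, l).
     pochhammer a' l * pochhammer b' l / (pochhammer c l * fact l) * (- X) ^ l *
     (pochhammer (c - a + of_nat l) m * pochhammer (c - b + of_nat l) m / (pochhammer (c + of_nat l) m * fact m) * X ^ m))"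

lemma euler_term_summable:
  assumes c: "Re c > 0"
  shows "\<exists>r>0. \<forall>X. norm X < r \<longrightarrow> euler_term a a' b b' c X summable_on UNIV"
proof -
  define K where "K = norm a' + norm b' + norm (c - a) + norm (c - b) + 1"
  define \<kappa> where "\<kappa> = min 1 (Re c)"
  define R where "R = 2 * K\<^sup>2 / \<kappa>"
  have K: "K \<ge> 1" "norm a' + 1 \<le> K" "norm b' + 1 \<le> K" "norm (c - a) + 1 \<le> K" "norm (c - b) + 1 \<le> K"
    by (auto simp: K_def)
  have \<kappa>: "\<kappa> > 0" "\<kappa> \<le> 1" "\<kappa> \<le> Re c" using c by (auto simp: \<kappa>_def)
  have R: "R > 0" using K \<kappa> by (simp add: R_def)
  have P: "norm (pochhammer (z + of_nat k) j) \<le> K ^ j * (fact (k + j) / fact k)" if "norm z + 1 \<le> K" for z :: complex and k j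
    by (rule order.trans[OF norm_pochhammer_shift_le mult_right_mono[OF power_mono]]) (use that in auto)
  have bound: "norm (euler_term a a' b b' c X (m, l)) \<le> (R * norm X) ^ m * (R * norm X) ^ l" for X m l
  proof -
    have split: "pochhammer c l * pochhammer (c + of_nat l) m = pochhammer c (l + m)"
      by (rule pochhammer_product'[symmetric])
    have "norm (euler_term a a' b b' c X (m, l)) =
      norm (pochhammer a' l) * norm (pochhammer b' l) * (norm (pochhammer (c - a + of_nat l) m) * norm (pochhammer (c - b + of_nat l) m)) /
      (norm (pochhammer c (l + m)) * (fact l * fact m)) * norm X ^ (l + m)"
      by (simp add: euler_term_def norm_mult norm_divide norm_power power_add split[symmetric]) (simp add: mult_ac)
    also have "\<dots> \<le> (K ^ l * fact l) * (K ^ l * fact l) * ((K ^ m * (fact (l + m) / fact l)) * (K ^ m * (fact (l + m) / fact l))) /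
      ((\<kappa> ^ (l + m) * fact (l + m)) * (fact l * fact m)) * norm X ^ (l + m)"
      using P[of a' 0 l] P[of b' 0 l] P[of "c - a" l m] P[of "c - b" l m] norm_pochhammer_ge[OF \<kappa>, of "l + m"] K \<kappa>
      by (intro mult_right_mono frac_le mult_mono) auto
    also have "\<dots> = (K\<^sup>2 / \<kappa> * norm X) ^ (l + m) * (fact (l + m) / (fact l * fact m))"
      using \<kappa> by (simp add: power_add power_mult_distrib power_divide power2_eq_square) (simp add: mult_ac)
    also have "fact (l + m) / (fact l * fact m) = real ((l + m) choose l)"
      by (subst binomial_fact) auto
    also have "(K\<^sup>2 / \<kappa> * norm X) ^ (l + m) * real ((l + m) choose l) \<le> (K\<^sup>2 / \<kappa> * norm X) ^ (l + m) * 2 ^ (l + m)"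
      using \<kappa> of_nat_mono[OF binomial_le_pow2[of "l + m" l], where ?'a = real] by (intro mult_left_mono) auto
    also have "\<dots> = (R * norm X) ^ m * (R * norm X) ^ l"
      by (simp add: R_def power_mult_distrib[symmetric] power_add[symmetric] mult_ac add.commute)
    finally show ?thesis .
  qed
  show ?thesis
  proof (intro exI conjI allI impI)
    show "1 / R > 0" using R by simp
    fix X :: complex assume "norm X < 1 / R"
    then have "R * norm X < 1" "R * norm X \<ge> 0" using R by (auto simp: field_simps)
    then have "(\<lambda>n. (R * norm X) ^ n) summable_on UNIV"
      by (intro norm_summable_imp_summable_on) (auto simp: norm_power summable_geometric)
    then have "(\<lambda>(m, l). (R * norm X) ^ m * (R * norm X) ^ l) summable_on UNIV"
      using R by (intro summable_on_product) auto
    then show "euler_term a a' b b' c X summable_on UNIV"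
      by (rule summable_on_norm_le) (use bound in auto)
  qed
qed

text \<open>
  The two double series have the same homogeneous parts; this is exactly \<open>pochhammer_thomae\<close>.
\<close>
lemma euler_term_antidiagonal:
  assumes c: "Re c > 0"
  shows "(\<Sum>k\<le>n. euler_term a a' b b' c X (n - k, k)) =
         (\<Sum>k\<le>n. curve_coeff a a' b b' c (n - k, k) * X ^ n)"
proof -
  have nz: "pochhammer c k \<noteq> 0" for k by (rule pochhammer_nonzero[OF c])
  let ?w = "X ^ n / (pochhammer c n * fact n)"
  have L: "euler_term a a' b b' c X (n - l, l) = ((-1) ^ l * of_nat (n choose l) * pochhammer a' l * pochhammer b' l *
             pochhammer (c - a + of_nat l) (n - l) * pochhammer (c - b + of_nat l) (n - l)) * ?w" if "l \<le> n" for l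
  proof -
    have 1: "X ^ n = X ^ l * X ^ (n - l)" using that by (simp add: power_add[symmetric])
    have 2: "pochhammer c n = pochhammer c l * pochhammer (c + of_nat l) (n - l)"
      by (rule pochhammer_product[OF that])
    have 3: "of_nat (n choose l) = fact n / (fact l * fact (n - l) :: complex)"
      by (rule binomial_fact[OF that])
    have 4: "(- X) ^ l = (-1) ^ l * X ^ l" by (rule power_minus)
    show ?thesis unfolding euler_term_def prod.case 1 2 3 4 by (simp add: mult_ac)
  qed
  have R: "curve_coeff a a' b b' c (n - k, k) * X ^ n = (of_nat (n choose k) * pochhammer (c - a - a') (n - k) * pochhammer a' k *
             pochhammer (c - b - b') k * pochhammer (c - b + of_nat k) (n - k)) * ?w" if "k \<le> n" for k
  proof -
    have 3: "of_nat (n choose k) = fact n / (fact k * fact (n - k) :: complex)"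
      by (rule binomial_fact[OF that])
    show ?thesis using that unfolding curve_coeff_def prod.case 3 by (simp add: mult_ac)
  qed
  have "(\<Sum>k\<le>n. euler_term a a' b b' c X (n - k, k)) = (\<Sum>l\<le>n. (-1) ^ l * of_nat (n choose l) * pochhammer a' l * pochhammer b' l *
             pochhammer (c - a + of_nat l) (n - l) * pochhammer (c - b + of_nat l) (n - l)) * ?w"
    unfolding sum_distrib_right using L by (intro sum.cong) auto
  also have "\<dots> = (\<Sum>k\<le>n. of_nat (n choose k) * pochhammer (c - a - a') (n - k) * pochhammer a' k *
             pochhammer (c - b - b') k * pochhammer (c - b + of_nat k) (n - k)) * ?w"
    by (subst pochhammer_thomae) simp
  also have "\<dots> = (\<Sum>k\<le>n. curve_coeff a a' b b' c (n - k, k) * X ^ n)"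
    unfolding sum_distrib_right using R by (intro sum.cong) auto
  finally show ?thesis .
qed

text \<open>
  Euler's transformation contributes \<open>(1-X)\<^sup>c\<^sup>+\<^sup>l\<^sup>-\<^sup>a\<^sup>-\<^sup>b\<close> to the coefficient of \<open>Y\<^sup>l\<close>, and on the curve \<open>Y (1 - X) = -X\<close>.
\<close>
lemma F3_curve_euler_expansion:
  assumes c: "Re c > 0" and X: "norm X < 1" and summ: "euler_term a a' b b' c X summable_on UNIV"
    and S: "(F3_term a a' b b' c X (X / (X - 1)) has_sum S) UNIV"
  shows "(euler_term a a' b b' c X has_sum (S * (1 - X) powr (a + b - c))) UNIV"
proof -
  let ?Y = "X / (X - 1)"
  let ?cl = "\<lambda>l. pochhammer a' l * pochhammer b' l / (pochhammer c l * fact l)"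
  have X1: "X \<noteq> 1" using X by auto
  have "\<exists>f. \<forall>l. ((\<lambda>m. pochhammer a m * pochhammer b m / (pochhammer (c + of_nat l) m * fact m) * X ^ m) has_sum f l) UNIV"
  proof (rule choice, rule allI)
    fix l :: nat
    have "Re (c + of_nat l) > 0" using c by simp
    then obtain G where G: "\<And>z. norm z < 1 \<Longrightarrow>
        (\<lambda>m. pochhammer a m * pochhammer b m / (pochhammer (c + of_nat l) m * fact m) * z ^ m) sums G z"
      using slit_continuable_2F1[of "c + of_nat l" a b] unfolding slit_continuable_def by blast
    show "\<exists>s. ((\<lambda>m. pochhammer a m * pochhammer b m / (pochhammer (c + of_nat l) m * fact m) * X ^ m) has_sum s) UNIV"
      using sums_unit_disc_has_sum[OF G X] by blast
  qed
  then obtain f where f: "\<And>l. ((\<lambda>m. pochhammer a m * pochhammer b m / (pochhammer (c + of_nat l) m * fact m) * X ^ m) has_sum f l) UNIV"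
    by blast
  have "((\<lambda>(l, m). F3_term a a' b b' c X ?Y (m, l)) has_sum S) (UNIV \<times> UNIV)"
    using S has_sum_swap[where f = "F3_term a a' b b' c X ?Y" and A = UNIV and B = UNIV] by simp
  moreover have "((\<lambda>m. F3_term a a' b b' c X ?Y (m, l)) has_sum ?cl l * ?Y ^ l * f l) UNIV" for l
  proof -
    have eq: "F3_term a a' b b' c X ?Y (m, l) = ?cl l * ?Y ^ l *
        (pochhammer a m * pochhammer b m / (pochhammer (c + of_nat l) m * fact m) * X ^ m)" for m
      using pochhammer_product'[of c l m] by (simp add: F3_term_def add.commute[of m l] mult_ac)
    show ?thesis unfolding eq by (rule has_sum_cmult_right[OF f])
  qed
  ultimately have "((\<lambda>l. ?cl l * ?Y ^ l * f l) has_sum S) UNIV"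
    using has_sum_Sigma'[where f = "\<lambda>(l, m). F3_term a a' b b' c X ?Y (m, l)" and A = UNIV and B = "\<lambda>_. UNIV"] by simp
  from has_sum_cmult_left[OF this, of "(1 - X) powr (a + b - c)"]
  have 1: "((\<lambda>l. ?cl l * ?Y ^ l * f l * (1 - X) powr (a + b - c)) has_sum S * (1 - X) powr (a + b - c)) UNIV" .
  have inner: "((\<lambda>m. euler_term a a' b b' c X (m, l)) has_sum ?cl l * ?Y ^ l * f l * (1 - X) powr (a + b - c)) UNIV" for l
  proof -
    have "Re (c + of_nat l) > 0" using c by simp
    from euler_transformation_2F1[OF X this f[of l]]
    have "((\<lambda>m. pochhammer (c - a + of_nat l) m * pochhammer (c - b + of_nat l) m / (pochhammer (c + of_nat l) m * fact m) * X ^ m)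
       has_sum (f l * (1 - X) powr (a + b - (c + of_nat l)))) UNIV"
      by (simp add: add_diff_eq diff_add_eq)
    from has_sum_cmult_right[OF this, of "?cl l * (- X) ^ l"]
    have "((\<lambda>m. euler_term a a' b b' c X (m, l)) has_sum ?cl l * (- X) ^ l * (f l * (1 - X) powr (a + b - (c + of_nat l)))) UNIV"
      by (simp add: euler_term_def)
    also have "?cl l * (- X) ^ l * (f l * (1 - X) powr (a + b - (c + of_nat l))) = ?cl l * ?Y ^ l * f l * (1 - X) powr (a + b - c)"
    proof -
      have "(1 - X) powr (a + b - c) = (1 - X) powr (a + b - (c + of_nat l) + of_nat l)"
        by (rule arg_cong[of _ _ "\<lambda>z. _ powr z"]) simp
      also have "\<dots> = (1 - X) powr (a + b - (c + of_nat l)) * (1 - X) ^ l"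
        using X1 by (simp only: powr_add) (simp add: powr_nat')
      finally have p: "(1 - X) powr (a + b - c) = (1 - X) powr (a + b - (c + of_nat l)) * (1 - X) ^ l" .
      have "?Y * (1 - X) = - X" using X1 by (simp add: field_simps)
      then have "(- X) ^ l = ?Y ^ l * (1 - X) ^ l" by (metis power_mult_distrib)
      then show ?thesis unfolding p by (simp only: mult_ac)
    qed
    finally show ?thesis .
  qed
  have "((\<lambda>(l, m). euler_term a a' b b' c X (m, l)) has_sum S * (1 - X) powr (a + b - c)) (UNIV \<times> UNIV)"
  proof (rule has_sum_SigmaI[OF _ 1])
    show "(\<lambda>(l, m). euler_term a a' b b' c X (m, l)) summable_on UNIV \<times> UNIV"
      using summ unfolding summable_on_def using has_sum_swap[where f = "euler_term a a' b b' c X" and A = UNIV and B = UNIV] by simp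
  qed (use inner in simp)
  then show ?thesis using has_sum_swap[where f = "euler_term a a' b b' c X" and A = UNIV and B = UNIV] by simp
qed

lemma appell_F3_is_continuation:
  assumes "Re c > 0" shows "is_F3_continuation a a' b b' c (appell_F3 a a' b b' c)"
proof -
  obtain F where F: "is_F3_continuation a a' b b' c F" using F3_continuation_exists[OF assms] by blast
  show ?thesis unfolding appell_F3_def by (rule someI[of "is_F3_continuation a a' b b' c", OF F])
qed

lemma appell_F3_has_sum:
  assumes "Re c > 0" "norm X < 1" "norm Y < 1"
  shows "(F3_term a a' b b' c X Y has_sum appell_F3 a a' b b' c X Y) UNIV"
  using appell_F3_is_continuation[OF assms(1), of a a' b b'] assms(2,3)
  unfolding is_F3_continuation_def by simp

text \<open>
  By uniqueness, \<open>appell_F3\<close> agrees with the integral representation, for which holomorphy along the curve is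
  known.
\<close>
lemma appell_F3_holomorphic_on_curve:
  assumes "Re c > 0"
  shows "(\<lambda>X. appell_F3 a a' b b' c X (X / (X - 1))) holomorphic_on slit_plane"
proof -
  obtain F where F: "is_F3_continuation a a' b b' c F" "(\<lambda>X. F X (X / (X - 1))) holomorphic_on slit_plane"
    using F3_continuation_exists[OF assms] by blast
  show ?thesis
    by (rule holomorphic_transform[OF F(2)],
        rule is_F3_continuation_unique[OF F(1) appell_F3_is_continuation[OF assms]])
       (use slit_plane_pfaff in auto)
qed

text \<open>
  Both sides are holomorphic in the unit disc, and they agree in a neighbourhood of the origin where the
  Euler transformed double series converges absolutely.
\<close>
lemma appell_F3_on_curve:
  assumes c: "Re c > 0" and X: "norm X < 1"
  shows "((\<lambda>(j, k). curve_coeff a a' b b' c (j, k) * X ^ (j + k)) has_sum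
    (appell_F3 a a' b b' c X (X / (X - 1)) * (1 - X) powr (a + b - c))) UNIV"
proof -
  define t where "t = curve_coeff a a' b b' c"
  define H where "H X = infsum (\<lambda>(j, k). t (j, k) * X ^ (j + k)) UNIV" for X
  define \<Phi> where "\<Phi> X = appell_F3 a a' b b' c X (X / (X - 1)) * (1 - X) powr (a + b - c)" for X
  have H: "((\<lambda>(j, k). t (j, k) * X ^ (j + k)) has_sum H X) UNIV" if "norm X < 1" for X
    unfolding H_def t_def by (rule has_sum_infsum[OF curve_series_summable[OF c that]])
  have H_anti: "((\<lambda>n. (\<Sum>k\<le>n. t (n - k, k)) * X ^ n) has_sum H X) UNIV" if "norm X < 1" for X
    using has_sum_antidiagonal[OF H[OF that]] by (simp add: sum_distrib_right)
  have "H holomorphic_on ball 0 1"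
    by (rule power_series_holomorphic[of 0 1 "\<lambda>n. \<Sum>k\<le>n. t (n - k, k)"])
       (use has_sum_imp_sums[OF H_anti] in auto)
  moreover have "\<Phi> holomorphic_on ball 0 1"
    unfolding \<Phi>_def
    by (intro holomorphic_intros holomorphic_on_subset[OF appell_F3_holomorphic_on_curve[OF c] ball_subset_slit_plane])
       (auto simp: complex_nonpos_Reals_iff dest: complex_Re_le_cmod[THEN order.strict_trans1])
  moreover obtain r where r: "r > 0" "\<And>X. norm X < r \<Longrightarrow> euler_term a a' b b' c X summable_on UNIV"
    using euler_term_summable[OF c] by blast
  \<comment> \<open>\<open>|X| < 1/2\<close> ensures \<open>|X / (X - 1)| < 1\<close>\<close>
  define r' where "r' = min r (1/2)"
  have "\<Phi> X = H X" if "X \<in> ball 0 r'" for X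
  proof -
    have X: "norm X < r" "norm X < 1/2" using that by (auto simp: r'_def)
    have "norm (X - 1) \<ge> 1 - norm X" using norm_triangle_ineq2[of 1 X] by (simp add: norm_minus_commute)
    then have "norm X < norm (X - 1)" using X by linarith
    then have Y: "norm (X / (X - 1)) < 1"
      unfolding norm_divide using order.strict_trans1[OF norm_ge_zero, of X "norm (X - 1)"] by (simp only: divide_less_eq_1_pos)
    have X1: "norm X < 1" using X by simp
    have "(F3_term a a' b b' c X (X / (X - 1)) has_sum appell_F3 a a' b b' c X (X / (X - 1))) UNIV"
      by (rule appell_F3_has_sum[OF c X1 Y])
    from F3_curve_euler_expansion[OF c X1 r(2)[OF X(1)] this]
    have "(euler_term a a' b b' c X has_sum \<Phi> X) UNIV" by (simp add: \<Phi>_def)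
    from has_sum_antidiagonal[OF this] have "((\<lambda>n. (\<Sum>k\<le>n. t (n - k, k)) * X ^ n) has_sum \<Phi> X) UNIV"
      by (simp add: euler_term_antidiagonal[OF c] t_def sum_distrib_right)
    then show ?thesis using H_anti[OF X1] has_sum_unique by blast
  qed
  moreover have "ball 0 r' \<subseteq> ball (0::complex) 1" "ball (0::complex) r' \<noteq> {}" using r(1) by (auto simp: r'_def)
  ultimately have "\<Phi> X = H X"
    using X analytic_continuation_open[of "ball 0 r'" "ball 0 1" \<Phi> H X] by auto
  with H[OF X] show ?thesis by (simp add: t_def \<Phi>_def)
qed

section \<open>The multiplier of a power\<close>

lemma Beta_real_shift_bound:
  assumes u: "u > 0" and v: "v > (0::real)"
  shows "\<exists>C>0. \<forall>n. Beta (u + real n) v \<le> C * real (Suc n) powr (- v)"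
proof -
  obtain C1 where C1: "C1 > 0" "\<And>n. norm (pochhammer (complex_of_real u) n) \<le> C1 * (fact n * real (Suc n) powr (u - 1))"
    using pochhammer_upper_bound[of "complex_of_real u"] by auto
  have "complex_of_real (u + v) \<notin> \<int>\<^sub>\<le>\<^sub>0" using u v by (intro Re_pos_not_nonpos_Ints) simp
  from pochhammer_lower_bound[OF this]
  obtain C2 where C2: "C2 > 0" "\<And>n. fact n * real (Suc n) powr (u + v - 1) \<le> C2 * norm (pochhammer (complex_of_real (u + v)) n)"
    by auto
  have B: "Beta u v > 0" using u v by (simp add: Beta_def Gamma_real_pos)
  have "Beta (u + real n) v \<le> (Beta u v * C1 * C2) * real (Suc n) powr (- v)" for n
  proof -
    have "complex_of_real (Beta (u + real n) v) = Beta (of_real u + of_nat n) (of_real v + of_nat 0)"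
      by (simp flip: Beta_complex_of_real)
    also have "\<dots> = of_real (Beta u v) * (pochhammer (of_real u) n / pochhammer (of_real (u + v)) n)"
      using u v by (subst Beta_plus_of_nat) (auto simp: Beta_complex_of_real)
    finally have eq: "norm (complex_of_real (Beta (u + real n) v)) =
        Beta u v * (norm (pochhammer (complex_of_real u) n) / norm (pochhammer (complex_of_real (u + v)) n))"
      using B by (simp only: norm_mult norm_divide norm_of_real abs_of_pos)
    have "Beta (u + real n) v > 0" using u v by (simp add: Beta_def Gamma_real_pos)
    then have "Beta (u + real n) v = Beta u v * (norm (pochhammer (complex_of_real u) n) / norm (pochhammer (complex_of_real (u + v)) n))"
      using eq by simp
    also have "\<dots> \<le> Beta u v * ((C1 * (fact n * real (Suc n) powr (u - 1))) / (fact n * real (Suc n) powr (u + v - 1) / C2))"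
      using C1 C2 B by (intro mult_left_mono frac_le) (auto simp: pos_divide_le_eq mult.commute)
    also have "\<dots> = (Beta u v * C1 * C2) * (real (Suc n) powr (u - 1) / real (Suc n) powr (u + v - 1))"
      by simp
    also have "real (Suc n) powr (u - 1) / real (Suc n) powr (u + v - 1) = real (Suc n) powr (- v)"
      unfolding powr_diff[symmetric] by (rule arg_cong[of _ _ "\<lambda>z. _ powr z"]) simp
    finally show ?thesis .
  qed
  then show ?thesis using B C1(1) C2(1) by (intro exI[of _ "Beta u v * C1 * C2"]) auto
qed

lemma summable_on_Suc_powr: "s < -1 \<Longrightarrow> (\<lambda>k. real (Suc k) powr s) summable_on UNIV"
  using summable_Suc_powr[of s] by (intro norm_summable_imp_summable_on) simp

text \<open>
  The terms are of order \<open>(j+1)\<^sup>P\<^sup>-\<^sup>1 (k+1)\<^sup>q\<^sup>-\<^sup>1 (j+k+1)\<^sup>-\<^sup>s\<close> with \<open>P = Re (c-a-a')\<close> and \<open>q = Re (a'-b') \<le> 0\<close>. Since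
  \<open>Re s\<close> exceeds both \<open>0\<close> and \<open>P\<close>, the last factor has enough decay to be shared between \<open>j\<close> and \<open>k\<close>.
\<close>
lemma curve_Beta_summable:
  assumes c: "Re c > 0" and s: "Re s > 0" "Re s > Re b" "Re s > Re (c - a - a')" and le: "Re a' \<le> Re b'"
  shows "(\<lambda>(j, k). norm (curve_coeff a a' b b' c (j, k)) * Beta (Re c + real (j + k)) (Re s - Re b)) summable_on UNIV"
proof -
  obtain C where C: "C > 0" "\<And>j k. norm (curve_coeff a a' b b' c (j, k)) \<le>
    C * (real (Suc j) powr (Re (c - a - a') - 1) * real (Suc k) powr (Re (a' - b') - 1) *
         real (Suc (j + k)) powr (- Re b))" using curve_coeff_bound[OF c] by blast
  obtain D where D: "D > 0" "\<And>n. Beta (Re c + real n) (Re s - Re b) \<le> D * real (Suc n) powr (- (Re s - Re b))"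
    using Beta_real_shift_bound[of "Re c" "Re s - Re b"] c s by auto
  \<comment> \<open>the exponent \<open>Re s\<close> is split into \<open>s1 > max 0 P\<close> for \<open>j\<close> and \<open>s2 > 0\<close> for \<open>k\<close>\<close>
  define s2 where "s2 = (Re s - max 0 (Re (c - a - a'))) / 2"
  define s1 where "s1 = Re s - s2"
  have s12: "s2 > 0" "s1 > Re (c - a - a')" "s1 > 0" using s by (auto simp: s1_def s2_def field_simps max_def)
  let ?f = "\<lambda>j. real (Suc j) powr (Re (c - a - a') - 1 - s1)" and ?g = "\<lambda>k. real (Suc k) powr (Re (a' - b') - 1 - s2)"
  have "(\<lambda>(j, k). ?f j * ?g k) summable_on UNIV"
    using s12 le by (intro summable_on_product summable_on_Suc_powr) auto
  from summable_on_cmult_right[OF this, of "C * D"] show ?thesis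
  proof (rule summable_on_comparison_test)
    fix i :: "nat \<times> nat" obtain j k where i: "i = (j, k)" by (cases i)
    define J K N where "J = real (Suc j)" and "K = real (Suc k)" and "N = real (Suc (j + k))"
    have JK: "J > 0" "K > 0" "N > 0" "J \<le> N" "K \<le> N" by (auto simp: J_def K_def N_def)
    have B0: "Beta (Re c + real (j + k)) (Re s - Re b) \<ge> 0"
      using c s by (simp add: Beta_def Gamma_real_pos less_imp_le)
    have "norm (curve_coeff a a' b b' c (j, k)) * Beta (Re c + real (j + k)) (Re s - Re b) \<le>
       (C * (J powr (Re (c - a - a') - 1) * K powr (Re (a' - b') - 1) * N powr (- Re b))) * (D * N powr (- (Re s - Re b)))"
      using C(2)[of j k] D(2)[of "j + k"] C(1) D(1) B0 unfolding J_def K_def N_def by (intro mult_mono) auto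
    also have "\<dots> = C * D * (J powr (Re (c - a - a') - 1) * K powr (Re (a' - b') - 1) * (N powr (- Re b) * N powr (- (Re s - Re b))))"
      by (simp only: mult_ac)
    also have "N powr (- Re b) * N powr (- (Re s - Re b)) = N powr (- s1) * N powr (- s2)"
      unfolding powr_add[symmetric] by (rule arg_cong[of _ _ "\<lambda>z. _ powr z"]) (simp add: s1_def)
    also have "N powr (- s1) * N powr (- s2) \<le> J powr (- s1) * K powr (- s2)"
      using JK s12 by (intro mult_mono powr_mono2') auto
    also have "J powr (Re (c - a - a') - 1) * K powr (Re (a' - b') - 1) * (J powr (- s1) * K powr (- s2)) =
        (J powr (Re (c - a - a') - 1) * J powr (- s1)) * (K powr (Re (a' - b') - 1) * K powr (- s2))"
      by (simp only: mult_ac)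
    also have "\<dots> = ?f j * ?g k"
      unfolding powr_add[symmetric] by (simp add: J_def K_def del: of_nat_Suc)
    finally have "norm (curve_coeff a a' b b' c (j, k)) * Beta (Re c + real (j + k)) (Re s - Re b) \<le> C * D * (?f j * ?g k)"
      using C(1) D(1) by (simp add: mult_left_mono)
    then show "(case i of (j, k) \<Rightarrow> norm (curve_coeff a a' b b' c (j, k)) * Beta (Re c + real (j + k)) (Re s - Re b)) \<le>
       C * D * (case i of (j, k) \<Rightarrow> ?f j * ?g k)" by (simp add: i)
    show "0 \<le> (case i of (j, k) \<Rightarrow> norm (curve_coeff a a' b b' c (j, k)) * Beta (Re c + real (j + k)) (Re s - Re b))"
      using B0 by (simp add: i)
  qed
qed

text \<open>
  The factor by which the fractional integral of \<open>t\<^sup>-\<^sup>s\<close> differs from a pure power. In the denominator the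
  entire function \<open>rGamma\<close> is used, since those arguments may be poles of Gamma.
\<close>
definition MSM_multiplier :: "complex \<Rightarrow> complex \<Rightarrow> complex \<Rightarrow> complex \<Rightarrow> complex \<Rightarrow> complex \<Rightarrow> complex" where
  "MSM_multiplier a a' b b' c s =
     Gamma (s - b) * Gamma (s + a + a' - c) * Gamma (s + a + b' - c) *
     rGamma s * rGamma (s + a - b) * rGamma (s + a + a' + b' - c)"

text \<open>
  The beta value cancels \<open>(c)\<^sub>j\<^sub>+\<^sub>k\<close>, and what remains factors into two nested Gauss sums: the one over \<open>j\<close> has
  lower parameter \<open>c - b + s + k\<close>, and its value contributes the lower parameter of the sum over \<open>k\<close>.
\<close>
lemma curve_Beta_sum:
  assumes c: "Re c > 0" and s: "Re s > Re b" "Re s > Re (c - a - a')" "Re s > Re (c - a - b')"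
    and V: "((\<lambda>(j, k). curve_coeff a a' b b' c (j, k) * Beta (c + of_nat (j + k)) (s - b)) has_sum V) UNIV"
  shows "V = Gamma c * MSM_multiplier a a' b b' c s"
proof -
  define p B where "p = c - a - a'" and "B = c - b"
  have nzc: "pochhammer c n \<noteq> 0" for n by (rule pochhammer_nonzero[OF c])
  have E: "Re (B + s) > 0" using c s by (simp add: B_def)
  let ?u = "\<lambda>j k. pochhammer p j * pochhammer (B + of_nat k) j / fact j * rGamma (B + s + of_nat k + of_nat j)"
  let ?v = "\<lambda>k. pochhammer a' k * pochhammer (B - b') k / fact k"
  have beta: "Beta (c + of_nat n) (s - b) = Gamma c * Gamma (s - b) * pochhammer c n * rGamma (B + s + of_nat n)" for n
  proof -
    have "Gamma (c + of_nat n) = Gamma c * pochhammer c n"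
      using pochhammer_Gamma[OF Re_pos_not_nonpos_Ints[OF c], of n] Re_pos_not_nonpos_Ints[OF c]
      by (simp add: Gamma_eq_zero_iff)
    moreover have "c + of_nat n + (s - b) = B + s + of_nat n" by (simp add: B_def)
    ultimately show ?thesis unfolding Beta_altdef by (simp only: mult_ac)
  qed
  have summand: "curve_coeff a a' b b' c (j, k) * Beta (c + of_nat (j + k)) (s - b) =
      Gamma c * Gamma (s - b) * (?v k * ?u j k)" for j k
  proof -
    have "B + s + of_nat (j + k) = B + s + of_nat k + of_nat j" by simp
    then show ?thesis unfolding beta curve_coeff_def prod.case p_def[symmetric] B_def[symmetric]
      using nzc[of "j + k"] by (simp del: of_nat_add) (simp add: mult_ac add.assoc)
  qed
  have "((\<lambda>(k, j). Gamma c * Gamma (s - b) * (?v k * ?u j k)) has_sum V) (UNIV \<times> UNIV)"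
    using V unfolding summand
    by (subst (asm) UNIV_Times_UNIV[symmetric], subst (asm) has_sum_swap) simp
  moreover have "((\<lambda>j. Gamma c * Gamma (s - b) * (?v k * ?u j k)) has_sum
      Gamma c * Gamma (s - b) * (?v k * (rGamma (B + s - p + of_nat k) * rGamma s * Gamma (s - p)))) UNIV" for k
  proof (intro has_sum_cmult_right)
    have "Re ((B + s + of_nat k) - p - (B + of_nat k)) > 0" using s by (simp add: p_def)
    from gauss_sum[OF this]
    have "((\<lambda>j. ?u j k) has_sum rGamma ((B + s + of_nat k) - p) * rGamma ((B + s + of_nat k) - (B + of_nat k)) *
       Gamma ((B + s + of_nat k) - p - (B + of_nat k))) UNIV" .
    also have "(B + s + of_nat k) - p = B + s - p + of_nat k" by simp
    also have "(B + s + of_nat k) - (B + of_nat k) = s" by simp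
    also have "B + s - p + of_nat k - (B + of_nat k) = s - p" by simp
    finally show "((\<lambda>j. ?u j k) has_sum rGamma (B + s - p + of_nat k) * rGamma s * Gamma (s - p)) UNIV" .
  qed
  ultimately have "((\<lambda>k. Gamma c * Gamma (s - b) * (?v k * (rGamma (B + s - p + of_nat k) * rGamma s * Gamma (s - p)))) has_sum V) UNIV"
    using has_sum_Sigma'[where f = "\<lambda>(k, j). Gamma c * Gamma (s - b) * (?v k * ?u j k)" and A = UNIV and B = "\<lambda>_. UNIV"] by simp
  then have 1: "((\<lambda>k. Gamma c * Gamma (s - b) * rGamma s * Gamma (s - p) * (?v k * rGamma (B + s - p + of_nat k))) has_sum V) UNIV"
    by (simp only: mult_ac)
  have "Re (B + s - p - a' - (B - b')) > 0" using s by (simp add: p_def)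
  from has_sum_cmult_right[OF gauss_sum[OF this], of "Gamma c * Gamma (s - b) * rGamma s * Gamma (s - p)"]
  have "V = Gamma c * Gamma (s - b) * rGamma s * Gamma (s - p) *
      (rGamma (B + s - p - a') * rGamma (B + s - p - (B - b')) * Gamma (B + s - p - a' - (B - b')))"
    using 1 has_sum_unique by blast
  also have "B + s - p - a' = s + a - b" by (simp add: p_def B_def)
  also have "B + s - p - (B - b') = s + a + a' + b' - c" by (simp add: p_def B_def)
  also have "s + a - b - (B - b') = s + a + b' - c" by (simp add: B_def)
  also have "s - p = s + a + a' - c" by (simp add: p_def)
  finally show ?thesis unfolding MSM_multiplier_def by (simp only: mult_ac)
qed

text \<open>
  The integrand of the fractional integral of \<open>t\<^sup>-\<^sup>s\<close> after the substitution \<open>t = x / (1 - u)\<close>, without the power of \<open>x\<close>.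
  The power of \<open>1 - u\<close> is split so that the second factor is the double series of \<open>appell_F3_on_curve\<close>.
\<close>
definition unit_integrand where
  "unit_integrand a a' b b' c s u = Beta_kernel c (s - b) u *
     (appell_F3 a a' b b' c (of_real u) (of_real u / (of_real u - 1)) * of_real (1 - u) powr (a + b - c))"

lemma unit_integral_ordered:
  assumes c: "Re c > 0" and s: "Re s > 0" "Re s > Re b" "Re s > Re (c - a - a')" "Re s > Re (c - a - b')"
    and le: "Re a' \<le> Re b'"
  shows "integrable lborel (unit_integrand a a' b b' c s)"
    and "(\<integral>u. unit_integrand a a' b b' c s u \<partial>lborel) = Gamma c * MSM_multiplier a a' b b' c s"
proof -
  have sb: "Re (s - b) > 0" using s by simp
  define f where "f = (\<lambda>(j, k) u. curve_coeff a a' b b' c (j, k) * Beta_kernel (c + of_nat (j + k)) (s - b) u)"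
  have int: "integrable lborel (f i)" for i
    unfolding f_def case_prod_unfold by (intro integrable_mult_right integrable_Beta_kernel) (use c sb in auto)
  have norm: "(\<integral>u. norm (f (j, k) u) \<partial>lborel) =
      norm (curve_coeff a a' b b' c (j, k)) * Beta (Re c + real (j + k)) (Re s - Re b)" for j k
    using integral_norm_Beta_kernel[of "c + of_nat (j + k)" "s - b"] c sb by (simp add: f_def norm_mult)
  have summ: "(\<lambda>i. \<integral>u. norm (f i u) \<partial>lborel) summable_on UNIV"
  proof -
    have "(\<lambda>i. \<integral>u. norm (f i u) \<partial>lborel) = (\<lambda>(j, k). norm (curve_coeff a a' b b' c (j, k)) * Beta (Re c + real (j + k)) (Re s - Re b))"
      using norm by (auto simp: fun_eq_iff)
    then show ?thesis using curve_Beta_summable[OF c s(1-3) le] by simp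
  qed
  have pw: "((\<lambda>i. f i u) has_sum unit_integrand a a' b b' c s u) UNIV" for u
  proof (cases "u \<in> {0<..<1}")
    case True
    then have "norm (complex_of_real u) < 1" by simp
    from has_sum_cmult_right[OF appell_F3_on_curve[OF c this], of "Beta_kernel c (s - b) u" a a' b b']
    have "((\<lambda>i. Beta_kernel c (s - b) u * (case i of (j, k) \<Rightarrow> curve_coeff a a' b b' c (j, k) * of_real u ^ (j + k)))
      has_sum unit_integrand a a' b b' c s u) UNIV" by (simp add: unit_integrand_def)
    moreover have "Beta_kernel c (s - b) u * (case i of (j, k) \<Rightarrow> curve_coeff a a' b b' c (j, k) * of_real u ^ (j + k)) = f i u" for i
      using Beta_kernel_power[of c "s - b" u "fst i + snd i" 0]
      by (simp add: f_def case_prod_unfold mult_ac)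
    ultimately show ?thesis by simp
  qed (auto simp: f_def unit_integrand_def Beta_kernel_def case_prod_unfold)
  note hs = has_sum_integral_countable[OF int summ pw]
  show "integrable lborel (unit_integrand a a' b b' c s)" by (rule hs(1))
  have "(\<integral>u. f (j, k) u \<partial>lborel) = curve_coeff a a' b b' c (j, k) * Beta (c + of_nat (j + k)) (s - b)" for j k
    using integral_Beta_kernel[of "c + of_nat (j + k)" "s - b"] c sb by (simp add: f_def)
  then have "(\<lambda>i. \<integral>u. f i u \<partial>lborel) = (\<lambda>(j, k). curve_coeff a a' b b' c (j, k) * Beta (c + of_nat (j + k)) (s - b))"
    by auto
  with hs(2) show "(\<integral>u. unit_integrand a a' b b' c s u \<partial>lborel) = Gamma c * MSM_multiplier a a' b b' c s"
    by (intro curve_Beta_sum[OF c s(2-4)]) simp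
qed

lemma appell_F3_commute: "appell_F3 a a' b b' c = appell_F3 a b' b a' c"
proof -
  have "F3_term a a' b b' c = F3_term a b' b a' c"
    by (intro ext) (auto simp: F3_term_def mult_ac)
  then show ?thesis unfolding appell_F3_def is_F3_continuation_def by simp
qed

text \<open>
  \<open>F\<^sub>3\<close> and the multiplier are symmetric in \<open>a'\<close> and \<open>b'\<close>, so the order required for the summability estimate is no
  restriction.
\<close>
lemma unit_integral:
  assumes c: "Re c > 0" and s: "Re s > 0" "Re s > Re b" "Re s > Re (c - a - a')" "Re s > Re (c - a - b')"
  shows "integrable lborel (unit_integrand a a' b b' c s)"
    and "(\<integral>u. unit_integrand a a' b b' c s u \<partial>lborel) = Gamma c * MSM_multiplier a a' b b' c s"
proof -
  have "integrable lborel (unit_integrand a a' b b' c s) \<and>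
    (\<integral>u. unit_integrand a a' b b' c s u \<partial>lborel) = Gamma c * MSM_multiplier a a' b b' c s"
  proof (cases "Re a' \<le> Re b'")
    case True
    then show ?thesis using unit_integral_ordered[OF c s] by blast
  next
    case False
    have "unit_integrand a a' b b' c s = unit_integrand a b' b a' c s"
      by (simp add: unit_integrand_def fun_eq_iff appell_F3_commute[of a a' b b' c])
    moreover have "MSM_multiplier a a' b b' c s = MSM_multiplier a b' b a' c s"
      by (simp add: MSM_multiplier_def add_ac mult_ac)
    ultimately show ?thesis using unit_integral_ordered[OF c s(1,2,4,3)] False by simp
  qed
  then show "integrable lborel (unit_integrand a a' b b' c s)"
    "(\<integral>u. unit_integrand a a' b b' c s u \<partial>lborel) = Gamma c * MSM_multiplier a a' b b' c s" by auto
qed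

text \<open>
  A change of variables for complex-valued integrands needs integrability on both sides; for the left-hand side
  it comes from the change of variables for nonnegative functions, applied to the norm.
\<close>
lemma set_integral_substitution_inverse:
  fixes f :: "real \<Rightarrow> complex"
  assumes x: "x > 0" and cont: "continuous_on {x<..} f"
    and int: "set_integrable lborel {0<..<1} (\<lambda>u. (x / (1 - u)\<^sup>2) *\<^sub>R f (x / (1 - u)))"
  shows "set_integrable lborel {x<..} f"
    and "(LBINT t:{x<..}. f t) = (LBINT u:{0<..<1}. (x / (1 - u)\<^sup>2) *\<^sub>R f (x / (1 - u)))"
proof -
  have e1: "einterval 0 1 = {0<..<1}" by (auto simp: einterval_def one_ereal_def zero_ereal_def)
  have e2: "einterval (ereal x) \<infinity> = {x<..}" by (auto simp: einterval_def)
  have gt: "x < x / (1 - u)" if "0 < u" "u < 1" for u using x that by (simp add: field_simps)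
  have d: "DERIV (\<lambda>u. x / (1 - u)) u :> x / (1 - u)\<^sup>2" if "0 < ereal u" "ereal u < 1" for u
    using that by (auto intro!: derivative_eq_intros simp: power2_eq_square)
  have cf: "isCont f (x / (1 - u))" if "0 < ereal u" "ereal u < 1" for u
    using cont gt[of u] that by (simp add: continuous_on_eq_continuous_at)
  have cg: "isCont (\<lambda>u. x / (1 - u)\<^sup>2) u" if "0 < ereal u" "ereal u < 1" for u
    using that by (auto intro!: continuous_intros)
  have A: "((ereal \<circ> (\<lambda>u. x / (1 - u)) \<circ> real_of_ereal) \<longlongrightarrow> ereal x) (at_right 0)"
  proof -
    have "((\<lambda>u. x / (1 - u)) \<longlongrightarrow> x / (1 - 0)) (at_right 0)" by (intro tendsto_intros) auto
    then show ?thesis by (simp add: zero_ereal_def at_right_ereal filterlim_filtermap o_def)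
  qed
  have B: "((ereal \<circ> (\<lambda>u. x / (1 - u)) \<circ> real_of_ereal) \<longlongrightarrow> \<infinity>) (at_left 1)"
  proof -
    have "filterlim (\<lambda>u. x / (1 - u)) at_top (at_left 1)" using x by real_asymp
    then show ?thesis
      by (simp add: one_ereal_def at_left_ereal filterlim_filtermap o_def tendsto_PInfty_eq_at_top)
  qed
  have nn: "set_integrable lborel (einterval 0 1) (\<lambda>u. norm (f (x / (1 - u))) * (x / (1 - u)\<^sup>2))"
    using set_integrable_norm[OF int] x unfolding e1 by (simp add: mult.commute)
  have "set_integrable lborel (einterval (ereal x) \<infinity>) (\<lambda>t. norm (f t))"
    by (rule interval_integral_substitution_nonneg(1)[OF _ d _ cg _ _ A B nn])
       (use x cf in \<open>auto intro: continuous_intros\<close>)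
  then have "set_integrable lborel {x<..} (\<lambda>t. norm (f t))" unfolding e2 .
  moreover have "set_borel_measurable lborel {x<..} f"
    unfolding set_borel_measurable_def measurable_lborel2
    by (rule borel_measurable_continuous_on_indicator[OF _ cont]) auto
  ultimately show I: "set_integrable lborel {x<..} f"
    unfolding set_integrable_def set_borel_measurable_def
    by (subst integrable_norm_iff[symmetric]) auto
  have "(LBINT t=ereal x..\<infinity>. f t) = (LBINT u=0..1. (x / (1 - u)\<^sup>2) *\<^sub>R f (x / (1 - u)))"
    by (rule interval_integral_substitution_integrable[OF _ d cf cg _ A B])
       (use int I x in \<open>auto simp: e1 e2\<close>)
  then show "(LBINT t:{x<..}. f t) = (LBINT u:{0<..<1}. (x / (1 - u)\<^sup>2) *\<^sub>R f (x / (1 - u)))"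
    unfolding interval_lebesgue_integral_def e1 e2 by simp
qed

text \<open>
  With \<open>t = x / (1 - u)\<close> one has \<open>1 - x/t = u\<close> and \<open>1 - t/x = u / (u - 1)\<close>.
\<close>
lemma MSM_integrand_power:
  assumes c: "Re c > 0" and s: "Re s > 0" "Re s > Re b" "Re s > Re (c - a - a')" "Re s > Re (c - a - b')"
    and x: "x > 0"
  defines "f \<equiv> \<lambda>t::real. of_real (t - x) powr (c - 1) * of_real t powr (- a) *
        appell_F3 a a' b b' c (of_real (1 - x / t)) (of_real (1 - t / x)) * of_real t powr (- s)"
  shows "set_integrable lborel {x<..} f"
    and "(LBINT t:{x<..}. f t) = of_real x powr (c - a - s) * (Gamma c * MSM_multiplier a a' b b' c s)"
proof -
  have Y: "1 - t / x = (1 - x / t) / ((1 - x / t) - 1)" if "t > x" for t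
    using that x by (simp add: field_simps)
  have "continuous_on {x<..} (\<lambda>t. appell_F3 a a' b b' c (of_real (1 - x / t)) (of_real (1 - x / t) / (of_real (1 - x / t) - 1)))"
  proof (rule continuous_on_compose2[OF holomorphic_on_imp_continuous_on[OF appell_F3_holomorphic_on_curve[OF c]]])
    show "continuous_on {x<..} (\<lambda>t. complex_of_real (1 - x / t))"
      using x by (intro continuous_intros) auto
    show "(\<lambda>t. complex_of_real (1 - x / t)) ` {x<..} \<subseteq> slit_plane"
    proof safe
      fix t assume "x < t"
      then have "x / t > 0" using x by simp
      then show "complex_of_real (1 - x / t) \<in> slit_plane" by (simp add: slit_plane_iff)
    qed
  qed
  then have F: "continuous_on {x<..} (\<lambda>t. appell_F3 a a' b b' c (of_real (1 - x / t)) (of_real (1 - t / x)))"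
    by (rule continuous_on_eq) (simp add: Y)
  have cont: "continuous_on {x<..} f"
    unfolding f_def using x by (intro continuous_on_mult F continuous_on_powr_of_real continuous_intros) auto
  have eq: "(x / (1 - u)\<^sup>2) *\<^sub>R f (x / (1 - u)) =
      of_real x powr (c - a - s) * (of_real u powr (c - 1) * of_real (1 - u) powr (s - b - 1) *
        (appell_F3 a a' b b' c (of_real u) (of_real u / (of_real u - 1)) * of_real (1 - u) powr (a + b - c)))"
    if u: "u \<in> {0<..<1}" for u
  proof -
    define L M K where "L = complex_of_real (ln x)" and "M = complex_of_real (ln (1 - u))" and "K = complex_of_real (ln u)"
    have pos: "0 < u" "0 < 1 - u" "x / (1 - u) - x = x * u / (1 - u)" "x * u / (1 - u) > 0" "x / (1 - u) > 0"
      using u x by (auto simp: field_simps)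
    have 1: "1 - x / (x / (1 - u)) = u" using pos x by simp
    have 2: "1 - x / (1 - u) / x = u / (u - 1)" using pos x by (simp add: field_simps)
    have l1: "complex_of_real (ln (x * u / (1 - u))) = L + K - M"
      using pos x by (simp add: ln_div ln_mult L_def K_def M_def)
    have l2: "complex_of_real (ln (x / (1 - u))) = L - M"
      using pos x by (simp add: ln_div L_def M_def)
    have "exp (L - 2 * M) = of_real (exp (ln x) / exp (ln (1 - u)) ^ 2)"
      unfolding L_def M_def by (simp add: exp_diff exp_double exp_of_real)
    then have 3: "complex_of_real (x / (1 - u)\<^sup>2) = exp (L - 2 * M)" using pos x by simp
    have "of_real (x / (1 - u)\<^sup>2) * (of_real (x * u / (1 - u)) powr (c - 1) * of_real (x / (1 - u)) powr (- a) *
          \<Phi> * of_real (x / (1 - u)) powr (- s)) =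
        of_real x powr (c - a - s) * (of_real u powr (c - 1) * of_real (1 - u) powr (s - b - 1) *
          (\<Phi> * of_real (1 - u) powr (a + b - c)))" for \<Phi>
    proof -
      have "exp (L - 2 * M) * exp ((c - 1) * (L + K - M)) * exp (- a * (L - M)) * exp (- s * (L - M)) =
          exp ((c - a - s) * L) * exp ((c - 1) * K) * exp ((s - b - 1) * M) * exp ((a + b - c) * M)"
        unfolding exp_add[symmetric] by (rule arg_cong[of _ _ exp]) (simp add: algebra_simps)
      from arg_cong[OF this, of "\<lambda>z. z * \<Phi>"]
      show ?thesis unfolding 3 of_real_powr_eq_exp[OF pos(1)] of_real_powr_eq_exp[OF pos(2)] of_real_powr_eq_exp[OF pos(4)]
          of_real_powr_eq_exp[OF pos(5)] of_real_powr_eq_exp[OF x] l1 l2 L_def[symmetric] M_def[symmetric] K_def[symmetric]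
        by (simp only: mult_ac)
    qed
    then show ?thesis unfolding f_def 1 2 pos(3) scaleR_conv_of_real by simp
  qed
  have ind: "indicator {0<..<1} u *\<^sub>R ((x / (1 - u)\<^sup>2) *\<^sub>R f (x / (1 - u))) =
      of_real x powr (c - a - s) * unit_integrand a a' b b' c s u" for u
    using eq[of u] by (auto simp: unit_integrand_def Beta_kernel_def indicator_def)
  note U = unit_integral[OF c s]
  have int: "set_integrable lborel {0<..<1} (\<lambda>u. (x / (1 - u)\<^sup>2) *\<^sub>R f (x / (1 - u)))"
    unfolding set_integrable_def ind by (intro integrable_mult_right U(1))
  show "set_integrable lborel {x<..} f" by (rule set_integral_substitution_inverse(1)[OF x cont int])
  have "(LBINT t:{x<..}. f t) = (LBINT u:{0<..<1}. (x / (1 - u)\<^sup>2) *\<^sub>R f (x / (1 - u)))"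
    by (rule set_integral_substitution_inverse(2)[OF x cont int])
  also have "\<dots> = of_real x powr (c - a - s) * (Gamma c * MSM_multiplier a a' b b' c s)"
    unfolding set_lebesgue_integral_def ind using U(2) by simp
  finally show "(LBINT t:{x<..}. f t) = of_real x powr (c - a - s) * (Gamma c * MSM_multiplier a a' b b' c s)" .
qed

text \<open>
  The Lebesgue integral is linear only on integrable functions, so integrability for each single power is
  part of the argument.
\<close>
lemma MSM_integral_sum_powr:
  assumes c: "Re c > 0"
    and s: "\<And>k. k \<in> A \<Longrightarrow> Re (s k) > 0 \<and> Re (s k) > Re b \<and> Re (s k) > Re (c - a - a') \<and> Re (s k) > Re (c - a - b')"
    and x: "x > 0" and f: "\<And>t. t > 0 \<Longrightarrow> f t = (\<Sum>k\<in>A. w k * of_real t powr (- s k))"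
  shows "MSM_integral a a' b b' c f x =
    (\<Sum>k\<in>A. w k * MSM_multiplier a a' b b' c (s k) * of_real x powr (- (s k + a + a' - c)))"
proof -
  let ?g = "\<lambda>t. of_real (t - x) powr (c - 1) * of_real t powr (- a) *
        appell_F3 a a' b b' c (of_real (1 - x / t)) (of_real (1 - t / x))"
  have G: "Gamma c \<noteq> 0" using Re_pos_not_nonpos_Ints[OF c] by (simp add: Gamma_eq_zero_iff)
  have gf: "?g t * f t = (\<Sum>k\<in>A. w k * (?g t * of_real t powr (- s k)))" if "t > x" for t
  proof -
    have "t > 0" using that x by simp
    show ?thesis unfolding f[OF \<open>t > 0\<close>] sum_distrib_left by (intro sum.cong refl) (simp only: mult_ac)
  qed
  have "(LBINT t:{x<..}. ?g t * f t) = (LBINT t:{x<..}. (\<Sum>k\<in>A. w k * (?g t * of_real t powr (- s k))))"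
    unfolding set_lebesgue_integral_def
  proof (rule Bochner_Integration.integral_cong[OF refl])
    fix t show "indicator {x<..} t *\<^sub>R (?g t * f t) = indicator {x<..} t *\<^sub>R (\<Sum>k\<in>A. w k * (?g t * of_real t powr (- s k)))"
      using gf[of t] by (cases "t > x") (simp_all only: indicator_simps greaterThan_iff scaleR_zero_left not_False_eq_True)
  qed
  also have "\<dots> = (\<Sum>k\<in>A. LBINT t:{x<..}. w k * (?g t * of_real t powr (- s k)))"
    unfolding set_lebesgue_integral_def scaleR_sum_right
    by (rule Bochner_Integration.integral_sum)
       (use MSM_integrand_power(1)[OF c _ _ _ _ x, of "s _" b a a' b'] s in \<open>auto simp: set_integrable_def[symmetric]\<close>)
  also have "\<dots> = (\<Sum>k\<in>A. w k * (of_real x powr (c - a - s k) * (Gamma c * MSM_multiplier a a' b b' c (s k))))"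
    using MSM_integrand_power(2)[OF c _ _ _ _ x, of "s _" b a a' b'] s by (intro sum.cong) auto
  finally have I: "(LBINT t:{x<..}. ?g t * f t) =
    (\<Sum>k\<in>A. w k * (of_real x powr (c - a - s k) * (Gamma c * MSM_multiplier a a' b b' c (s k))))" .
  have "MSM_integral a a' b b' c f x = of_real x powr (- a') / Gamma c * (LBINT t:{x<..}. ?g t * f t)"
    unfolding MSM_integral_def ..
  also have "\<dots> = (\<Sum>k\<in>A. w k * MSM_multiplier a a' b b' c (s k) * of_real x powr (- (s k + a + a' - c)))"
    unfolding I sum_distrib_left
  proof (rule sum.cong[OF refl])
    fix k
    have "of_real x powr (- a') * of_real x powr (c - a - s k) = (of_real x powr (- (s k + a + a' - c)) :: complex)"
      unfolding powr_add[symmetric] by (rule arg_cong[of _ _ "\<lambda>z. _ powr z"]) (simp add: algebra_simps)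
    then show "of_real x powr (- a') / Gamma c * (w k * (of_real x powr (c - a - s k) * (Gamma c * MSM_multiplier a a' b b' c (s k)))) =
        w k * MSM_multiplier a a' b b' c (s k) * of_real x powr (- (s k + a + a' - c))"
      using G by (simp add: field_simps)
  qed
  finally show ?thesis .
qed

section \<open>The fractional derivative of the Jacobi type polynomial\<close>

text \<open>
  Each application of \<open>-d/dx\<close> to \<open>x\<^sup>-\<^sup>s\<close> contributes the factor \<open>s\<close> and raises \<open>s\<close> by one. The function needs to be
  a sum of powers only on the open half-line, because derivatives are local.
\<close>
lemma iterated_neg_derivative_powr:
  fixes g :: "real \<Rightarrow> complex"
  assumes g: "\<And>x. x > 0 \<Longrightarrow> g x = (\<Sum>k\<in>A. w k * of_real x powr (- s k))" and x: "x > 0"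
  shows "((\<lambda>g x. - vector_derivative g (at x)) ^^ N) g x =
    (\<Sum>k\<in>A. w k * pochhammer (s k) N * of_real x powr (- (s k + of_nat N)))"
  using x
proof (induction N arbitrary: x)
  case 0
  then show ?case using g by simp
next
  case (Suc N)
  let ?h = "((\<lambda>g x. - vector_derivative g (at x)) ^^ N) g"
  have D: "((\<lambda>x. of_real x powr z) has_vector_derivative z * of_real x powr (z - 1)) (at x)" for z :: complex
  proof -
    have "((\<lambda>w. w powr z) has_field_derivative z * of_real x powr (z - 1)) (at (of_real x))"
      using Suc.prems by (intro has_field_derivative_powr) (auto simp: complex_nonpos_Reals_iff)
    from has_vector_derivative_real_field[OF this] show ?thesis by (simp add: o_def)
  qed
  have "((\<lambda>x. \<Sum>k\<in>A. w k * pochhammer (s k) N * of_real x powr (- (s k + of_nat N))) has_vector_derivative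
     (\<Sum>k\<in>A. w k * pochhammer (s k) N * (- (s k + of_nat N) * of_real x powr (- (s k + of_nat N) - 1)))) (at x)"
    by (intro has_vector_derivative_sum has_vector_derivative_mult_right D)
  moreover have "(?h has_vector_derivative d) (at x)"
    if "((\<lambda>x. \<Sum>k\<in>A. w k * pochhammer (s k) N * of_real x powr (- (s k + of_nat N))) has_vector_derivative d) (at x)" for d
    using that
  proof (rule has_vector_derivative_transform_within_open[of _ _ _ "{0<..}"])
    fix y :: real assume "y \<in> {0<..}"
    then show "(\<Sum>k\<in>A. w k * pochhammer (s k) N * of_real y powr (- (s k + of_nat N))) = ?h y"
      using Suc.IH[of y] by simp
  qed (use Suc.prems in auto)
  ultimately have vd: "vector_derivative ?h (at x) =
     (\<Sum>k\<in>A. w k * pochhammer (s k) N * (- (s k + of_nat N) * of_real x powr (- (s k + of_nat N) - 1)))"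
    by (intro vector_derivative_at) blast
  have "- vector_derivative ?h (at x) =
     (\<Sum>k\<in>A. w k * pochhammer (s k) (Suc N) * of_real x powr (- (s k + of_nat (Suc N))))"
    unfolding vd sum_negf[symmetric]
  proof (rule sum.cong[OF refl])
    fix k
    have "- (s k + of_nat N) - 1 = - (s k + of_nat (Suc N))" by simp
    moreover have "- (u * v * (- y * z)) = u * (v * y) * z" for u v y z :: complex by simp
    ultimately show "- (w k * pochhammer (s k) N * (- (s k + of_nat N) * of_real x powr (- (s k + of_nat N) - 1))) =
        w k * pochhammer (s k) (Suc N) * of_real x powr (- (s k + of_nat (Suc N)))"
      by (simp only: pochhammer_Suc)
  qed
  then show ?case by simp
qed

lemma jacobi_M_coefficients:
  assumes q: "\<And>k::nat. k \<ge> 1 \<Longrightarrow> q \<noteq> - of_nat k"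
  shows "jacobi_M n p q y = (\<Sum>k\<le>n. ((-1) ^ n * pochhammer (q + 1) n *
     (pochhammer (1 + of_nat n - p) k * pochhammer (- of_nat n) k / (pochhammer (q + 1) k * fact k))) * (- y) ^ k)"
  unfolding jacobi_M_def sum_distrib_left
proof (rule sum.cong[OF refl])
  fix k assume "k \<in> {..n}"
  then have k: "k \<le> n" by simp
  have nz: "pochhammer (q + 1) m \<noteq> 0" for m
  proof
    assume "pochhammer (q + 1) m = 0"
    then obtain j where "q + 1 = - of_nat j" by (auto simp: pochhammer_eq_0_iff)
    then have "q = - of_nat (Suc j)" by (simp add: algebra_simps eq_neg_iff_add_eq_0)
    then show False using q[of "Suc j"] by simp
  qed
  have 1: "(p - of_nat n - 1) gchoose k = (-1) ^ k * pochhammer (1 + of_nat n - p) k / fact k"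
    by (simp add: gbinomial_pochhammer algebra_simps)
  have 2: "(q + of_nat n) gchoose (n - k) = pochhammer (q + 1 + of_nat k) (n - k) / fact (n - k)"
    using k by (simp add: gbinomial_pochhammer' of_nat_diff algebra_simps)
  have 3: "pochhammer (q + 1) n = pochhammer (q + 1) k * pochhammer (q + 1 + of_nat k) (n - k)"
    by (rule pochhammer_product[OF k])
  have 4: "pochhammer (- of_nat n) k = (-1) ^ k * (fact n / fact (n - k) :: complex)"
  proof -
    have "pochhammer (1 :: complex) n = pochhammer 1 (n - k) * pochhammer (1 + of_nat (n - k)) k"
      using pochhammer_product[of "n - k" n "1::complex"] k by simp
    then have "fact n = fact (n - k) * pochhammer (of_nat n - of_nat k + 1 :: complex) k"
      using k by (simp add: pochhammer_fact of_nat_diff algebra_simps)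
    then have "pochhammer (of_nat n - of_nat k + 1 :: complex) k = fact n / fact (n - k)" by simp
    then show ?thesis by (simp add: pochhammer_minus)
  qed
  show "(- 1) ^ n * fact n * ((p - of_nat n - 1 gchoose k) * (q + of_nat n gchoose (n - k)) * (- y) ^ k) =
        ((-1) ^ n * pochhammer (q + 1) n *
     (pochhammer (1 + of_nat n - p) k * pochhammer (- of_nat n) k / (pochhammer (q + 1) k * fact k))) * (- y) ^ k"
    unfolding 1 2 3 4 using nz[of k] by (simp add: mult_ac)
qed

theorem theorem4:
  fixes n :: nat and p q \<delta> \<delta>' \<mu> \<mu>' \<epsilon> \<tau> :: complex and x :: real
  assumes "\<And>k::nat. k \<ge> 1 \<Longrightarrow> q \<noteq> - of_nat k"
    and "Re \<epsilon> > 0"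
    and "Re \<tau> > Max {0, Re (- \<mu>'), Re (\<delta>' + \<mu> - \<epsilon>),
                     Re (\<delta> + \<delta>' - \<epsilon>) + of_int \<lfloor>Re \<epsilon>\<rfloor> + 1}"
    and "\<tau> - \<delta>' + \<mu>' \<notin> \<int>\<^sub>\<le>\<^sub>0"
    and "\<tau> + \<epsilon> - \<delta> - \<delta>' - \<mu> \<notin> \<int>\<^sub>\<le>\<^sub>0"
    and "x > 0"
  shows "MSM_derivative \<delta> \<delta>' \<mu> \<mu>' \<epsilon>
           (\<lambda>t. of_real t powr (- \<tau>) * jacobi_M n p q (of_real (1 / t))) x =
         (- 1) ^ n * Gamma (q + of_nat n + 1) * Gamma (\<mu>' + \<tau>) *
           Gamma (- \<delta> - \<delta>' + \<epsilon> + \<tau>) * Gamma (- \<delta>' - \<mu> + \<epsilon> + \<tau>) /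
         (Gamma (q + 1) * Gamma \<tau> * Gamma (- \<delta>' + \<mu>' + \<tau>) *
           Gamma (- \<delta> - \<delta>' - \<mu> + \<epsilon> + \<tau>)) *
         of_real x powr (\<delta> + \<delta>' - \<epsilon> - \<tau>) *
         hypergeom
           [1 + of_nat n - p, - of_nat n, \<tau> + \<mu>', \<tau> - \<delta> - \<delta>' + \<epsilon>, \<tau> - \<delta>' - \<mu> + \<epsilon>]
           [\<tau>, \<tau> - \<delta>' + \<mu>', \<tau> + \<epsilon> - \<delta> - \<delta>' - \<mu>, q + 1]
           (- 1 / of_real x)"
proof -
  define N where "N = nat (\<lfloor>Re \<epsilon>\<rfloor> + 1)"
  have N: "real N = of_int \<lfloor>Re \<epsilon>\<rfloor> + 1" using assms(2) by (simp add: N_def)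
  define c where "c = - \<epsilon> + of_nat N"
  \<comment> \<open>\<open>A1\<close>, \<open>A2\<close>, \<open>A3\<close> and \<open>\<tau>\<close>, \<open>D1\<close>, \<open>D2\<close> are the Gamma arguments in numerator and denominator for \<open>k = 0\<close>\<close>
  define A1 A2 A3 D1 D2 where "A1 = \<tau> + \<mu>'" and "A2 = \<tau> - \<delta> - \<delta>' + \<epsilon>" and "A3 = \<tau> - \<delta>' - \<mu> + \<epsilon>"
    and "D1 = \<tau> - \<delta>' + \<mu>'" and "D2 = \<tau> + \<epsilon> - \<delta> - \<delta>' - \<mu>"
  define W where "W k = (-1) ^ n * pochhammer (q + 1) n * (pochhammer (1 + of_nat n - p) k *
      pochhammer (- of_nat n) k / (pochhammer (q + 1) k * fact k))" for k
  define w where "w k = W k * (-1) ^ k" for k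
  define s where "s k = \<tau> + of_nat k" for k :: nat
  have c: "Re c > 0" using N by (simp add: c_def)
  have \<tau>: "Re \<tau> > 0" "Re \<tau> > - Re \<mu>'" "Re \<tau> > Re (\<delta>' + \<mu> - \<epsilon>)" "Re \<tau> > Re (\<delta> + \<delta>' - \<epsilon>) + real N"
    using assms(3) unfolding N by auto
  have cond: "Re (s k) > 0 \<and> Re (s k) > Re (- \<mu>') \<and> Re (s k) > Re (c - - \<delta>' - - \<delta>) \<and>
      Re (s k) > Re (c - - \<delta>' - (- \<mu> + of_nat N))" for k
    using \<tau> by (auto simp: s_def c_def)
  have J: "jacobi_M n p q y = (\<Sum>k\<le>n. W k * (- y) ^ k)" for y
    unfolding W_def by (rule jacobi_M_coefficients) (rule assms(1))
  have f: "of_real t powr (- \<tau>) * jacobi_M n p q (of_real (1 / t)) = (\<Sum>k\<le>n. w k * of_real t powr (- s k))"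
    if t: "t > 0" for t
    unfolding J sum_distrib_left
  proof (rule sum.cong[OF refl])
    fix k
    have "of_real t powr (- s k) = of_real t powr (- \<tau>) * (of_real t powr (- of_nat k) :: complex)"
      unfolding powr_add[symmetric] by (rule arg_cong[of _ _ "\<lambda>z. _ powr z"]) (simp add: s_def)
    also have "of_real t powr (- of_nat k) = (of_real (1 / t) ^ k :: complex)"
      using t by (simp add: powr_minus powr_nat' power_divide divide_inverse power_inverse)
    finally show "of_real t powr (- \<tau>) * (W k * (- of_real (1 / t)) ^ k) = w k * of_real t powr (- s k)"
      unfolding w_def power_minus[of "of_real (1 / t)"] by (simp only: mult_ac)
  qed
  have "MSM_derivative \<delta> \<delta>' \<mu> \<mu>' \<epsilon> (\<lambda>t. of_real t powr (- \<tau>) * jacobi_M n p q (of_real (1 / t))) x =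
     (\<Sum>k\<le>n. w k * MSM_multiplier (- \<delta>') (- \<delta>) (- \<mu>') (- \<mu> + of_nat N) c (s k) *
        pochhammer (s k + - \<delta>' + - \<delta> - c) N * of_real x powr (- (s k + - \<delta>' + - \<delta> - c + of_nat N)))"
    unfolding MSM_derivative_def Let_def N_def[symmetric] c_def[symmetric]
    by (rule iterated_neg_derivative_powr[OF MSM_integral_sum_powr[OF c cond _ f] assms(6)])
  also have "\<dots> = (\<Sum>k\<le>n. (-1) ^ n * pochhammer (q + 1) n * Gamma A1 * Gamma A2 * Gamma A3 * rGamma \<tau> * rGamma D1 * rGamma D2 *
      of_real x powr (\<delta> + \<delta>' - \<epsilon> - \<tau>) *
      ((pochhammer (1 + of_nat n - p) k * pochhammer (- of_nat n) k * pochhammer A1 k * pochhammer A2 k * pochhammer A3 k) /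
       (pochhammer \<tau> k * pochhammer D1 k * pochhammer D2 k * pochhammer (q + 1) k) * ((- 1 / of_real x) ^ k / fact k)))"
  proof (rule sum.cong[OF refl])
    fix k
    have G: "Gamma (z + of_nat k) = Gamma z * pochhammer z k" if "Re z > 0" for z
      using pochhammer_Gamma[OF Re_pos_not_nonpos_Ints[OF that], of k] Re_pos_not_nonpos_Ints[OF that]
      by (simp add: Gamma_eq_zero_iff)
    have rG: "rGamma (z + of_nat k) = rGamma z / pochhammer z k" if "z \<notin> \<int>\<^sub>\<le>\<^sub>0" for z :: complex
    proof -
      have "pochhammer z k \<noteq> 0" using that pochhammer_eq_0_imp_nonpos_Int by blast
      then show ?thesis using pochhammer_rGamma[of z k] by simp
    qed
    have A: "Re A1 > 0" "Re A2 > 0" "Re A3 > 0" using \<tau> by (auto simp: A1_def A2_def A3_def)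
    have D: "\<tau> \<notin> \<int>\<^sub>\<le>\<^sub>0" "D1 \<notin> \<int>\<^sub>\<le>\<^sub>0" "D2 \<notin> \<int>\<^sub>\<le>\<^sub>0"
      using Re_pos_not_nonpos_Ints[OF \<tau>(1)] assms(4,5) by (simp_all add: D1_def D2_def)
    \<comment> \<open>the \<open>N\<close> derivatives undo the shift of \<open>c\<close> by \<open>N\<close> in the second Gamma factor\<close>
    have 2: "Gamma (s k + - \<delta>' + - \<delta> - c) * pochhammer (s k + - \<delta>' + - \<delta> - c) N = Gamma A2 * pochhammer A2 k"
    proof -
      have "Re (s k + - \<delta>' + - \<delta> - c) > 0" using cond[of k] by simp
      then have np: "s k + - \<delta>' + - \<delta> - c \<notin> \<int>\<^sub>\<le>\<^sub>0" by (rule Re_pos_not_nonpos_Ints)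
      have "Gamma (s k + - \<delta>' + - \<delta> - c) * pochhammer (s k + - \<delta>' + - \<delta> - c) N =
          Gamma (s k + - \<delta>' + - \<delta> - c + of_nat N)"
        using pochhammer_Gamma[OF np, of N] np by (simp add: Gamma_eq_zero_iff)
      also have "s k + - \<delta>' + - \<delta> - c + of_nat N = A2 + of_nat k" by (simp add: s_def c_def A2_def)
      finally show ?thesis using G[OF A(2)] by simp
    qed
    have e: "s k - - \<mu>' = A1 + of_nat k" "s k + - \<delta>' + (- \<mu> + of_nat N) - c = A3 + of_nat k"
      "s k = \<tau> + of_nat k" "s k + - \<delta>' - - \<mu>' = D1 + of_nat k"
      "s k + - \<delta>' + - \<delta> + (- \<mu> + of_nat N) - c = D2 + of_nat k"
      by (simp_all add: s_def c_def A1_def A3_def D1_def D2_def)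
    have "MSM_multiplier (- \<delta>') (- \<delta>) (- \<mu>') (- \<mu> + of_nat N) c (s k) * pochhammer (s k + - \<delta>' + - \<delta> - c) N =
       Gamma (s k - - \<mu>') * (Gamma (s k + - \<delta>' + - \<delta> - c) * pochhammer (s k + - \<delta>' + - \<delta> - c) N) *
       Gamma (s k + - \<delta>' + (- \<mu> + of_nat N) - c) * rGamma (s k) * rGamma (s k + - \<delta>' - - \<mu>') *
       rGamma (s k + - \<delta>' + - \<delta> + (- \<mu> + of_nat N) - c)"
      unfolding MSM_multiplier_def by (simp only: mult_ac)
    also have "\<dots> = (Gamma A1 * pochhammer A1 k) * (Gamma A2 * pochhammer A2 k) * (Gamma A3 * pochhammer A3 k) *
       (rGamma \<tau> / pochhammer \<tau> k) * (rGamma D1 / pochhammer D1 k) * (rGamma D2 / pochhammer D2 k)"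
      unfolding 2 e(1,2,4,5) unfolding e(3) G[OF A(1)] G[OF A(3)] rG[OF D(1)] rG[OF D(2)] rG[OF D(3)] by (rule refl)
    finally have R: "MSM_multiplier (- \<delta>') (- \<delta>) (- \<mu>') (- \<mu> + of_nat N) c (s k) * pochhammer (s k + - \<delta>' + - \<delta> - c) N =
       (Gamma A1 * pochhammer A1 k) * (Gamma A2 * pochhammer A2 k) * (Gamma A3 * pochhammer A3 k) *
       (rGamma \<tau> / pochhammer \<tau> k) * (rGamma D1 / pochhammer D1 k) * (rGamma D2 / pochhammer D2 k)" .
    have "of_real x powr (- (s k + - \<delta>' + - \<delta> - c + of_nat N)) =
        of_real x powr (\<delta> + \<delta>' - \<epsilon> - \<tau>) * (of_real x powr (- of_nat k) :: complex)"
      unfolding powr_add[symmetric] by (rule arg_cong[of _ _ "\<lambda>z. _ powr z"]) (simp add: s_def c_def)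
    also have "of_real x powr (- of_nat k) = (1 / of_real x :: complex) ^ k"
      using assms(6) by (simp add: powr_minus powr_nat' power_divide divide_inverse power_inverse)
    finally have X: "of_real x powr (- (s k + - \<delta>' + - \<delta> - c + of_nat N)) =
        of_real x powr (\<delta> + \<delta>' - \<epsilon> - \<tau>) * (1 / of_real x :: complex) ^ k" .
    have Y: "(- 1 / of_real x :: complex) ^ k = (-1) ^ k * (1 / of_real x) ^ k"
      by (simp flip: power_mult_distrib)
    show "w k * MSM_multiplier (- \<delta>') (- \<delta>) (- \<mu>') (- \<mu> + of_nat N) c (s k) *
        pochhammer (s k + - \<delta>' + - \<delta> - c) N * of_real x powr (- (s k + - \<delta>' + - \<delta> - c + of_nat N)) =
      (-1) ^ n * pochhammer (q + 1) n * Gamma A1 * Gamma A2 * Gamma A3 * rGamma \<tau> * rGamma D1 * rGamma D2 *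
      of_real x powr (\<delta> + \<delta>' - \<epsilon> - \<tau>) *
      ((pochhammer (1 + of_nat n - p) k * pochhammer (- of_nat n) k * pochhammer A1 k * pochhammer A2 k * pochhammer A3 k) /
       (pochhammer \<tau> k * pochhammer D1 k * pochhammer D2 k * pochhammer (q + 1) k) * ((- 1 / of_real x) ^ k / fact k))"
      unfolding mult.assoc[of "w k" "MSM_multiplier _ _ _ _ _ _"] R unfolding X Y w_def W_def
      by (simp only: times_divide_eq_left times_divide_eq_right divide_divide_eq_left divide_divide_eq_right mult_ac)
  qed
  also have "\<dots> = (-1) ^ n * pochhammer (q + 1) n * Gamma A1 * Gamma A2 * Gamma A3 * rGamma \<tau> * rGamma D1 * rGamma D2 *
      of_real x powr (\<delta> + \<delta>' - \<epsilon> - \<tau>) *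
      hypergeom [1 + of_nat n - p, - of_nat n, A1, A2, A3] [\<tau>, D1, D2, q + 1] (- 1 / of_real x)"
    by (subst hypergeom_terminating[of n]) (simp_all add: sum_distrib_left mult.assoc)
  also have "pochhammer (q + 1) n = Gamma (q + of_nat n + 1) / Gamma (q + 1)"
  proof -
    have "q + 1 \<notin> \<int>\<^sub>\<le>\<^sub>0"
    proof
      assume "q + 1 \<in> \<int>\<^sub>\<le>\<^sub>0"
      then obtain j where "q + 1 = - of_nat j" by (auto elim: nonpos_Ints_cases')
      then have "q = - of_nat (Suc j)" by (simp add: algebra_simps eq_neg_iff_add_eq_0)
      then show False using assms(1)[of "Suc j"] by simp
    qed
    from pochhammer_Gamma[OF this, of n] show ?thesis by (simp add: add_ac)
  qed
  finally show ?thesis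
    unfolding A1_def A2_def A3_def D1_def D2_def
    by (simp add: rGamma_inverse_Gamma field_simps)
qed

end
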